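(* Let $(X,Y)$ have joint distribution $\mathbf{p}_{X,Y}=\{p_{i,j}\}$ on $\{(l_i,m_j): 1\le i\le I,\ 1\le j\le J\}$. Suppose that neither of the two marginal distributions $\mathbf{p}_X=\{p_{i,\cdot}\}$ and $\mathbf{p}_Y=\{p_{\cdot,j}\}$ is uniform. Let $\lambda\in(0,1)\cup(1,\infty)$ and $\alpha\in(0,1)$ be fixed, and let $Z_{AB}$ be computed from an i.i.d. sample of size $n$ from $\mathbf{p}_{X,Y}$. Then, under the alternative $H_a$ that $X$ and $Y$ are not independent, $$\lim_{n\to\infty}\operatorname{P}\bigl(Z_{AB}\in(-\infty,-z_{\alpha/2})\cup(z_{\alpha/2},\infty)\,\big|\,H_a\bigr)=1.$$
   Context: $(X,Y)$ is a pair of random elements on a finite joint alphabet $\mathscr{X}\times\mathscr{Y}=\{(l_i,m_j):1\le i\le I,1\le j\le J\}$, with joint distribution $p_{i,j}=\operatorname{P}(X=l_i,Y=m_j)$ and marginals $p_{i,\cdot}=\sum_j p_{i,j}$, $p_{\cdot,j}=\sum_i p_{i,j}$. Every letter has positive marginal probability: $p_{i,\cdot}>0$ and $p_{\cdot,j}>0$ for all $i,j$. A marginal is uniform if all its probabilities are equal. $\operatorname{P}(\cdot\,|\,H_a)$ denotes probability when the sample comes from a joint distribution under which $X$ and $Y$ are not independent. $z_{\alpha/2}$ is the $100\times(1-\alpha/2)$th percentile of the standard normal distribution. For fixed $\lambda>0$ let $c_{\lambda,\mathbf{p}}=\sum_{s,t}p_{s,t}^\lambda$ and define (with $0\ln 0=0$)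 $$T_A=\sum_{i,j}\frac{p_{i,j}^\lambda}{c_{\lambda,\mathbf{p}}}\ln\frac{p_{i,j}^\lambda}{c_{\lambda,\mathbf{p}}}-\sum_i\frac{p_{i,\cdot}^\lambda}{\sum_s p_{s,\cdot}^\lambda}\ln\frac{p_{i,\cdot}^\lambda}{\sum_s p_{s,\cdot}^\lambda}-\sum_j\frac{p_{\cdot,j}^\lambda}{\sum_t p_{\cdot,t}^\lambda}\ln\frac{p_{\cdot,j}^\lambda}{\sum_t p_{\cdot,t}^\lambda},$$ $$T_B=\sum_i\frac{p_{i,\cdot}^\lambda}{\sum_s p_{s,\cdot}^\lambda}\ln\frac{p_{i,\cdot}^\lambda}{\sum_s p_{s,\cdot}^\lambda}+\sum_j\frac{p_{\cdot,j}^\lambda}{\sum_t p_{\cdot,t}^\lambda}\ln\frac{p_{\cdot,j}^\lambda}{\sum_t p_{\cdot,t}^\lambda}-\sum_i\frac{\sum_t p_{i,t}^\lambda}{c_{\lambda,\mathbf{p}}}\ln\frac{\sum_t p_{i,t}^\lambda}{c_{\lambda,\mathbf{p}}}-\sum_j\frac{\sum_s p_{s,j}^\lambda}{c_{\lambda,\mathbf{p}}}\ln\frac{\sum_s p_{s,j}^\lambda}{c_{\lambda,\mathbf{p}}}.$$ Given an i.i.d. sample of size $n$ from $\mathbf{p}_{X,Y}$, let $f_{i,j}$ be the observed frequency of $(l_i,m_j)$, $\hat p_{i,j}=f_{i,j}/n$, $\hat p_{i,\cdot}=\sum_j f_{i,j}/n$, $\hat p_{\cdot,j}=\sum_i f_{i,j}/n$.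 The plug-in estimators $\hat T_A,\hat T_B$ are obtained from $T_A,T_B$ by replacing $p_{i,j},p_{i,\cdot},p_{\cdot,j}$ with $\hat p_{i,j},\hat p_{i,\cdot},\hat p_{\cdot,j}$. Variance: let $\mathbf{v}=(v_1,\dots,v_{IJ-1})^\tau$ list the $p_{i,j}$ with $(i,j)\ne(I,J)$ in row-by-row order, and regard $T_A$ as a function of $\mathbf{v}$, with $p_{I,J}=1-\sum_{(i,j)\ne(I,J)}p_{i,j}$. Let $\nabla=\{\partial T_A/\partial p_{i,j}\}_{(i,j)\neq(I,J)}$ be its gradient, and let $\Sigma=\Sigma(\mathbf{v})$ be the $(IJ-1)\times(IJ-1)$ matrix with diagonal entries $v_k(1-v_k)$ and off-diagonal entries $-v_kv_l$. Put $\sigma^2=\nabla^\tau\Sigma\nabla$; then $\hat\sigma^2$ is $\sigma^2$ with every $p_{i,j}$ replaced by $\hat p_{i,j}$, and $\hat\sigma=\sqrt{\hat\sigma^2}$. The test statistics are $Z_A=\sqrt{n}\,\hat T_A/\hat\sigma$, $Z_B=\sqrt{n}\,\hat T_B/\hat\sigma$, and $Z_{AB}=1_{[|Z_A|\ge|Z_B|]}Z_A+1_{[|Z_A|<|Z_B|]}Z_B$.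
   Formalization: If p_{I,J}=0 (or its estimate is 0), the variance is computed by eliminating some positive cell instead of (I,J), and empty cells contribute zero, since for λ<1 the stated gradient is infinite there; when the estimated σ is 0, the statistics are set to 0 (no rejection). *)

theory Defs
  imports "HOL-Probability.Probability"
begin

text \<open>
  Letters are numbered \<open>1..I\<close> and \<open>1..J\<close>; a distribution on the joint alphabet is a function
  \<open>p :: nat \<times> nat \<Rightarrow> real\<close> of which only the values on \<open>cells I J\<close> matter.
\<close>

definition cells :: "nat \<Rightarrow> nat \<Rightarrow> (nat \<times> nat) set" where
  "cells I J = {1..I} \<times> {1..J}"

definition row_marg :: "nat \<Rightarrow> (nat \<times> nat \<Rightarrow> real) \<Rightarrow> nat \<Rightarrow> real" where
  "row_marg J p i = (\<Sum>j=1..J. p (i, j))"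

definition col_marg :: "nat \<Rightarrow> (nat \<times> nat \<Rightarrow> real) \<Rightarrow> nat \<Rightarrow> real" where
  "col_marg I p j = (\<Sum>i=1..I. p (i, j))"

definition uniform_on :: "'a set \<Rightarrow> ('a \<Rightarrow> real) \<Rightarrow> bool" where
  "uniform_on S q \<longleftrightarrow> (\<forall>x\<in>S. \<forall>y\<in>S. q x = q y)"

text \<open>The value at \<open>0\<close> is \<open>0\<close>, so the convention \<open>0 ln 0 = 0\<close> holds.\<close>

definition xlnx :: "real \<Rightarrow> real" where
  "xlnx x = x * ln x"

definition c_pow :: "nat \<Rightarrow> nat \<Rightarrow> real \<Rightarrow> (nat \<times> nat \<Rightarrow> real) \<Rightarrow> real" where
  "c_pow I J lam p = (\<Sum>s=1..I. \<Sum>t=1..J. p (s, t) powr lam)"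

definition T_A :: "nat \<Rightarrow> nat \<Rightarrow> real \<Rightarrow> (nat \<times> nat \<Rightarrow> real) \<Rightarrow> real" where
  "T_A I J lam p =
     (\<Sum>i=1..I. \<Sum>j=1..J. xlnx (p (i, j) powr lam / c_pow I J lam p))
   - (\<Sum>i=1..I. xlnx (row_marg J p i powr lam / (\<Sum>s=1..I. row_marg J p s powr lam)))
   - (\<Sum>j=1..J. xlnx (col_marg I p j powr lam / (\<Sum>t=1..J. col_marg I p t powr lam)))"

definition T_B :: "nat \<Rightarrow> nat \<Rightarrow> real \<Rightarrow> (nat \<times> nat \<Rightarrow> real) \<Rightarrow> real" where
  "T_B I J lam p =
     (\<Sum>i=1..I. xlnx (row_marg J p i powr lam / (\<Sum>s=1..I. row_marg J p s powr lam)))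
   + (\<Sum>j=1..J. xlnx (col_marg I p j powr lam / (\<Sum>t=1..J. col_marg I p t powr lam)))
   - (\<Sum>i=1..I. xlnx ((\<Sum>t=1..J. p (i, t) powr lam) / c_pow I J lam p))
   - (\<Sum>j=1..J. xlnx ((\<Sum>s=1..I. p (s, j) powr lam) / c_pow I J lam p))"

text \<open>
  The vector \<open>v\<close> of free coordinates is indexed by the cells other than the eliminated one,
  \<open>r\<close>; the quadratic form below does not depend on the order in which these are listed.
  \<open>complete_distr I J r v\<close> restores the eliminated probability as one minus the sum of the others.
\<close>

definition complete_distr ::
  "nat \<Rightarrow> nat \<Rightarrow> nat \<times> nat \<Rightarrow> (nat \<times> nat \<Rightarrow> real) \<Rightarrow> nat \<times> nat \<Rightarrow> real" where
  "complete_distr I J r v c = (if c = r then 1 - (\<Sum>d\<in>cells I J - {r}. v d) else v c)"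

definition grad_T_A ::
  "nat \<Rightarrow> nat \<Rightarrow> real \<Rightarrow> nat \<times> nat \<Rightarrow> (nat \<times> nat \<Rightarrow> real) \<Rightarrow> nat \<times> nat \<Rightarrow> real" where
  "grad_T_A I J lam r v c = deriv (\<lambda>x. T_A I J lam (complete_distr I J r (v(c := x)))) (v c)"

definition Sigma_entry :: "(nat \<times> nat \<Rightarrow> real) \<Rightarrow> nat \<times> nat \<Rightarrow> nat \<times> nat \<Rightarrow> real" where
  "Sigma_entry v c d = (if c = d then v c * (1 - v c) else - v c * v d)"

text \<open>
  The eliminated cell is the last one, \<open>(I, J)\<close>. Only if that cell has probability zero is
  another one, of positive probability, eliminated instead (which amounts to renumbering the
  letters): for \<open>lam < 1\<close> the partial derivatives along which a zero cell \<open>(I, J)\<close> is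
  varied do not exist. Where both choices make sense they give the same variance.
  A zero cell that is not eliminated has a zero row and column in
  the covariance matrix and so contributes nothing, whatever value \<^const>\<open>deriv\<close> takes there.
\<close>

definition elim_cell :: "nat \<Rightarrow> nat \<Rightarrow> (nat \<times> nat \<Rightarrow> real) \<Rightarrow> nat \<times> nat" where
  "elim_cell I J p =
     (if p (I, J) > 0 then (I, J) else (SOME c. c \<in> cells I J \<and> p c > 0))"

definition sigma2 :: "nat \<Rightarrow> nat \<Rightarrow> real \<Rightarrow> (nat \<times> nat \<Rightarrow> real) \<Rightarrow> real" where
  "sigma2 I J lam p =
     (let r = elim_cell I J p; K = cells I J - {r} in
      \<Sum>c\<in>K. \<Sum>d\<in>K. grad_T_A I J lam r p c * Sigma_entry p c d * grad_T_A I J lam r p d)"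

text \<open>Relative frequencies of the cells among the first \<open>n\<close> members of a sample.\<close>

definition rel_freq ::
  "(nat \<Rightarrow> 'a) \<Rightarrow> (nat \<Rightarrow> 'b) \<Rightarrow> nat \<Rightarrow> (nat \<Rightarrow> 'a \<times> 'b) \<Rightarrow> nat \<times> nat \<Rightarrow> real" where
  "rel_freq l m n x c = real (card {k. k < n \<and> x k = (l (fst c), m (snd c))}) / real n"

text \<open>
  Independence of two random variables. The constant \<open>indep_var\<close> of the library requires both
  to have values in the same type.
\<close>

definition indep_pair ::
  "'w measure \<Rightarrow> 'a measure \<Rightarrow> ('w \<Rightarrow> 'a) \<Rightarrow> 'b measure \<Rightarrow> ('w \<Rightarrow> 'b) \<Rightarrow> bool" where
  "indep_pair M A X B Y \<longleftrightarrow>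
     prob_space.indep_set M {X -` S \<inter> space M | S. S \<in> sets A} {Y -` S \<inter> space M | S. S \<in> sets B}"

text \<open>
  The statistics as functions of the vector \<open>p\<close> of relative frequencies. A quotient with
  vanishing \<open>\<sigma>\<close> is \<open>0\<close> and hence never leads to rejection.
\<close>

definition Z_A :: "nat \<Rightarrow> nat \<Rightarrow> real \<Rightarrow> nat \<Rightarrow> (nat \<times> nat \<Rightarrow> real) \<Rightarrow> real" where
  "Z_A I J lam n p = sqrt (real n) * T_A I J lam p / sqrt (sigma2 I J lam p)"

definition Z_B :: "nat \<Rightarrow> nat \<Rightarrow> real \<Rightarrow> nat \<Rightarrow> (nat \<times> nat \<Rightarrow> real) \<Rightarrow> real" where
  "Z_B I J lam n p = sqrt (real n) * T_B I J lam p / sqrt (sigma2 I J lam p)"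

definition Z_AB :: "nat \<Rightarrow> nat \<Rightarrow> real \<Rightarrow> nat \<Rightarrow> (nat \<times> nat \<Rightarrow> real) \<Rightarrow> real" where
  "Z_AB I J lam n p =
     (if \<bar>Z_A I J lam n p\<bar> \<ge> \<bar>Z_B I J lam n p\<bar> then Z_A I J lam n p else Z_B I J lam n p)"

definition std_normal_quantile :: "real \<Rightarrow> real" where
  "std_normal_quantile q = Inf {x. q \<le> cdf std_normal_distribution x}"

end

theory Submission
  imports Defs "HOL-Complex_Analysis.Complex_Analysis" "HOL-Real_Asymp.Real_Asymp"
begin

text \<open>
  Adding the two statistics cancels the entropies of the escort marginals: \<open>T_A + T_B\<close> is the
  mutual information of the escort distribution, the normalised \<open>p powr lam\<close>. It is positive at a
  dependent \<open>p\<close>, because a product form of \<open>p powr lam\<close> would make \<open>p\<close> itself a product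
  (\<open>T_A_plus_T_B_pos\<close>). So one of \<open>\<bar>T_A\<bar>\<close>, \<open>\<bar>T_B\<bar>\<close> stays away from zero near \<open>p\<close>, and since the
  relative frequencies converge to \<open>p\<close>, the factor \<open>sqrt n\<close> drives the larger of the two
  statistics to infinity, provided that the estimated standard deviation is bounded and not zero.
  Boundedness is continuity: the variance is \<open>lam ^ 4\<close> times the variance of the influence function
  of \<open>T_A\<close> (\<open>sigma2_eq\<close>).

  The real issue is that the estimated variance must be nonzero with probability tending to one.
  It vanishes exactly at the critical points of \<open>T_A\<close> on the face of the simplex spanned by the
  support \<open>S\<close> of \<open>p\<close>, and a dependent \<open>p\<close> may be such a point, so continuity alone does not suffice.
  There are two cases.

  If each row of the table meets \<open>S\<close> in one cell (or each column does), then \<open>T_A\<close> is, near \<open>p\<close> and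
  on the face, the entropy of the escort version of one marginal; its gradient vanishes only at a
  uniform marginal (\<open>variance_pos_inj\<close>). This is where non-uniformity of the marginals enters.

  Otherwise some row contains two cells \<open>c\<close>, \<open>d\<close> of \<open>S\<close> and some column also contains two cells of
  \<open>S\<close>. Up to a positive factor, the derivative of \<open>T_A\<close> in the direction that moves mass from \<open>d\<close>
  to \<open>c\<close> is a function \<open>row_slope\<close> that is analytic along that line. It is not identically zero on
  the line through \<open>p\<close>: when the mass \<open>x\<close> of \<open>c\<close> tends to zero a term \<open>x powr (lam - 1) * ln x\<close>
  survives, which nothing analytic can cancel (\<open>row_slope_nonzero_on_line\<close>). Hence a derivative of
  some order \<open>k\<close> does not vanish at \<open>p\<close>, nor near \<open>p\<close>, and by Rolle each parallel line close to \<open>p\<close>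
  carries at most \<open>k\<close> zeros (\<open>few_zeros_on_lines\<close>). Finally the multinomial distribution is spread
  out along these lines: moving one observation from \<open>d\<close> to \<open>c\<close> changes the probability of a
  vector of counts by a factor close to one, so each zero has \<open>L\<close> neighbours of comparable
  probability, and the zeros carry probability at most of order \<open>k / L\<close> (\<open>anti_concentration\<close>).
\<close>

section \<open>Positivity of the mutual information of the escort distribution\<close>

text \<open>
  The divergence inequality cell by cell, in the form \<open>a * ln (a / w) \<ge> a - w\<close>, which keeps its
  meaning at \<open>a = 0\<close>.
\<close>

lemma gibbs_term:
  assumes "a \<ge> 0" "w \<ge> 0" "a > 0 \<Longrightarrow> w > 0"
  shows "xlnx a - a * ln w - a + w \<ge> 0"
    and "a \<noteq> w \<Longrightarrow> xlnx a - a * ln w - a + w > 0"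
proof -
  have *: "xlnx a - a * ln w - a + w \<ge> 0 \<and> (a \<noteq> w \<longrightarrow> xlnx a - a * ln w - a + w > 0)"
  proof (cases "a = 0")
    case False
    then have pos: "a > 0" "w > 0" using assms by auto
    then have eq: "xlnx a - a * ln w - a + w = a * (w / a - 1 - ln (w / a))"
      by (simp add: xlnx_def ln_div field_simps)
    have ge: "w / a - 1 - ln (w / a) \<ge> 0" using pos ln_le_minus_one[of "w / a"] by simp
    moreover have "w / a - 1 - ln (w / a) \<noteq> 0" if "a \<noteq> w"
      using pos that ln_eq_minus_one[of "w / a"] by auto
    ultimately show ?thesis unfolding eq using pos by (auto simp: less_le)
  qed (use assms in \<open>auto simp: xlnx_def less_le\<close>)
  then show "xlnx a - a * ln w - a + w \<ge> 0" "a \<noteq> w \<Longrightarrow> xlnx a - a * ln w - a + w > 0" by auto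
qed

text \<open>
  The terms \<open>- a + w\<close> of \<open>gibbs_term\<close> cancel in the sum, because the joint law and the product of
  its marginals both have total mass one; a single cell with strict inequality decides.
\<close>

lemma mutual_information_pos:
  fixes a :: "'a \<Rightarrow> 'b \<Rightarrow> real"
  assumes fin: "finite R" "finite C" and nn: "\<And>i j. i \<in> R \<Longrightarrow> j \<in> C \<Longrightarrow> a i j \<ge> 0"
    and sum1: "(\<Sum>i\<in>R. \<Sum>j\<in>C. a i j) = 1"
    and dep: "i0 \<in> R" "j0 \<in> C" "a i0 j0 \<noteq> (\<Sum>j\<in>C. a i0 j) * (\<Sum>i\<in>R. a i j0)"
  shows "(\<Sum>i\<in>R. \<Sum>j\<in>C. xlnx (a i j)) - (\<Sum>i\<in>R. xlnx (\<Sum>j\<in>C. a i j)) - (\<Sum>j\<in>C. xlnx (\<Sum>i\<in>R. a i j)) > 0"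
proof -
  define r s where "r i = (\<Sum>j\<in>C. a i j)" and "s j = (\<Sum>i\<in>R. a i j)" for i j
  have rs: "r i \<ge> 0" "s j \<ge> 0" "a i j > 0 \<Longrightarrow> r i > 0" "a i j > 0 \<Longrightarrow> s j > 0"
    if "i \<in> R" "j \<in> C" for i j
    unfolding r_def s_def using that nn fin
    by (auto intro!: sum_nonneg intro: sum_pos2[of C j] sum_pos2[of R i])
  define h where "h i j = xlnx (a i j) - a i j * ln (r i * s j) - a i j + r i * s j" for i j
  have h0: "h i j \<ge> 0" if "i \<in> R" "j \<in> C" for i j
    unfolding h_def using that nn rs[of i j] by (intro gibbs_term) (auto intro: mult_nonneg_nonneg)
  have h1: "h i0 j0 > 0"
    unfolding h_def using dep nn rs[of i0 j0]
    by (intro gibbs_term) (auto intro: mult_nonneg_nonneg simp: r_def s_def)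
  have "0 < (\<Sum>j\<in>C. h i0 j)" using fin dep h0 h1 by (intro sum_pos2[of C j0]) auto
  then have "0 < (\<Sum>i\<in>R. \<Sum>j\<in>C. h i j)" using fin dep h0 by (intro sum_pos2[of R i0] sum_nonneg) auto
  also have "(\<Sum>i\<in>R. \<Sum>j\<in>C. h i j) = (\<Sum>i\<in>R. \<Sum>j\<in>C. xlnx (a i j) - a i j * ln (r i) - a i j * ln (s j) - a i j + r i * s j)"
  proof (intro sum.cong refl)
    fix i j assume ij: "i \<in> R" "j \<in> C"
    show "h i j = xlnx (a i j) - a i j * ln (r i) - a i j * ln (s j) - a i j + r i * s j"
    proof (cases "a i j = 0")
      case False
      then have "a i j > 0" using nn ij by (simp add: less_le)
      then show ?thesis using rs[of i j] ij by (simp add: h_def ln_mult algebra_simps)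
    qed (simp add: h_def)
  qed
  also have "\<dots> = (\<Sum>i\<in>R. \<Sum>j\<in>C. xlnx (a i j)) - (\<Sum>i\<in>R. \<Sum>j\<in>C. a i j * ln (r i))
      - (\<Sum>i\<in>R. \<Sum>j\<in>C. a i j * ln (s j)) - (\<Sum>i\<in>R. \<Sum>j\<in>C. a i j) + (\<Sum>i\<in>R. \<Sum>j\<in>C. r i * s j)"
    by (simp add: sum.distrib sum_subtractf)
  also have "(\<Sum>i\<in>R. \<Sum>j\<in>C. a i j * ln (r i)) = (\<Sum>i\<in>R. xlnx (r i))"
    by (simp add: xlnx_def flip: sum_distrib_right) (simp add: r_def)
  also have "(\<Sum>i\<in>R. \<Sum>j\<in>C. a i j * ln (s j)) = (\<Sum>j\<in>C. xlnx (s j))"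
    by (subst sum.swap) (simp add: xlnx_def flip: sum_distrib_right, simp add: s_def)
  also have "(\<Sum>i\<in>R. \<Sum>j\<in>C. r i * s j) = (\<Sum>i\<in>R. r i) * (\<Sum>j\<in>C. s j)"
    by (simp add: sum_product)
  also have "(\<Sum>j\<in>C. s j) = 1" unfolding s_def by (subst sum.swap) (rule sum1)
  also have "(\<Sum>i\<in>R. r i) = 1" unfolding r_def by (rule sum1)
  finally show ?thesis using sum1 by (simp add: r_def s_def)
qed

text \<open>
  Roots of a product are a product, and a probability table of product form is the product of its
  own marginals.
\<close>

lemma product_of_power_product:
  assumes nn: "\<And>i j. i \<in> R \<Longrightarrow> j \<in> C \<Longrightarrow> (q i j :: real) \<ge> 0"
    and "lam > 0" "(\<Sum>i\<in>R. \<Sum>j\<in>C. q i j) = 1"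
    and prod: "\<And>i j. i \<in> R \<Longrightarrow> j \<in> C \<Longrightarrow> q i j powr lam = x i * y j"
    and xy: "\<And>i. i \<in> R \<Longrightarrow> x i \<ge> 0" "\<And>j. j \<in> C \<Longrightarrow> y j \<ge> 0"
    and "i \<in> R" "j \<in> C"
  shows "q i j = (\<Sum>j\<in>C. q i j) * (\<Sum>i\<in>R. q i j)"
proof -
  define u v where "u i = x i powr (1 / lam)" and "v j = y j powr (1 / lam)" for i j
  have q: "q i j = u i * v j" if "i \<in> R" "j \<in> C" for i j
  proof -
    have "q i j = (q i j powr lam) powr (1 / lam)"
      using nn[OF that] assms(2) by (simp add: powr_powr)
    also have "\<dots> = u i * v j"
      using prod[OF that] xy that by (simp add: powr_mult u_def v_def)
    finally show ?thesis .
  qed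
  have "(\<Sum>i\<in>R. u i) * (\<Sum>j\<in>C. v j) = 1"
    using assms(3) q by (simp add: sum_product)
  moreover have "(\<Sum>j\<in>C. q i j) = u i * (\<Sum>j\<in>C. v j)" "(\<Sum>i\<in>R. q i j) = (\<Sum>i\<in>R. u i) * v j"
    using q assms(7,8) by (simp_all add: sum_distrib_left sum_distrib_right)
  ultimately have "(\<Sum>j\<in>C. q i j) * (\<Sum>i\<in>R. q i j) = u i * v j * 1"
    by (metis (no_types, lifting) mult.assoc mult.commute)
  then show ?thesis using q assms(7,8) by simp
qed

text \<open>
  The row sums of the escort table are the arguments of the last terms of \<^const>\<open>T_B\<close>, not the
  escort version of the row marginal; the latter occurs in both statistics with opposite signs.
\<close>

lemma T_A_plus_T_B_pos:
  assumes nn: "\<And>c. c \<in> cells I J \<Longrightarrow> p c \<ge> 0" and sum1: "sum p (cells I J) = 1" and "lam > 0"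
    and dep: "i \<in> {1..I}" "j \<in> {1..J}" "p (i, j) \<noteq> row_marg J p i * col_marg I p j"
  shows "T_A I J lam p + T_B I J lam p > 0"
proof -
  define c where "c = c_pow I J lam p"
  define a where "a i j = p (i, j) powr lam / c" for i j
  have sum1': "(\<Sum>i=1..I. \<Sum>j=1..J. p (i, j)) = 1"
    using sum1 unfolding cells_def sum.cartesian_product by (simp add: case_prod_unfold)
  have c: "c > 0"
  proof -
    obtain d where d: "d \<in> cells I J" "p d \<noteq> 0"
      using sum1 by (metis sum.neutral zero_neq_one)
    have "c = (\<Sum>d\<in>cells I J. p d powr lam)"
      unfolding c_def c_pow_def cells_def sum.cartesian_product by (simp add: case_prod_unfold)
    also have "\<dots> > 0"
      using d nn[OF d(1)] by (intro sum_pos2[of _ d]) (auto simp: cells_def)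
    finally show ?thesis .
  qed
  have "\<exists>i\<in>{1..I}. \<exists>j\<in>{1..J}. a i j \<noteq> (\<Sum>j=1..J. a i j) * (\<Sum>i=1..I. a i j)"
  proof (rule ccontr)
    assume no: "\<not> ?thesis"
    have "p (i, j) = (\<Sum>j=1..J. p (i, j)) * (\<Sum>i=1..I. p (i, j))"
    proof (rule product_of_power_product[where x = "\<lambda>i. c * (\<Sum>j=1..J. a i j)" and y = "\<lambda>j. \<Sum>i=1..I. a i j"])
      fix i j assume "i \<in> {1..I}" "j \<in> {1..J}"
      then have "a i j = (\<Sum>j=1..J. a i j) * (\<Sum>i=1..I. a i j)" using no by blast
      then show "p (i, j) powr lam = c * (\<Sum>j=1..J. a i j) * (\<Sum>i=1..I. a i j)"
        using c by (simp add: a_def field_simps)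
    qed (use nn sum1' c assms in \<open>auto simp: cells_def a_def intro!: sum_nonneg mult_nonneg_nonneg\<close>)
    with dep show False by (simp add: row_marg_def col_marg_def)
  qed
  then obtain i j where "i \<in> {1..I}" "j \<in> {1..J}" "a i j \<noteq> (\<Sum>j=1..J. a i j) * (\<Sum>i=1..I. a i j)"
    by blast
  moreover have "(\<Sum>i=1..I. \<Sum>j=1..J. a i j) = 1"
    using c unfolding a_def by (simp flip: sum_divide_distrib) (simp add: c_def c_pow_def)
  ultimately have "(\<Sum>i=1..I. \<Sum>j=1..J. xlnx (a i j)) - (\<Sum>i=1..I. xlnx (\<Sum>j=1..J. a i j)) -
      (\<Sum>j=1..J. xlnx (\<Sum>i=1..I. a i j)) > 0"
    using c by (intro mutual_information_pos) (auto simp: a_def)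
  then show ?thesis
    unfolding T_A_def T_B_def a_def sum_divide_distrib[symmetric] by (simp add: c_def)
qed

section \<open>The variance as the variance of an influence function\<close>

text \<open>
  The three sums in \<^const>\<open>T_A\<close> are negative entropies of escort distributions of marginals: of
  the cells (\<open>f = id\<close>), the rows (\<open>f = fst\<close>) and the columns (\<open>f = snd\<close>). Below, \<open>S\<close> is the set
  of cells of positive probability, so that all masses are positive and everything is
  differentiable.
\<close>

definition marg :: "'c set \<Rightarrow> ('c \<Rightarrow> 'k) \<Rightarrow> ('c \<Rightarrow> real) \<Rightarrow> 'k \<Rightarrow> real" where
  "marg S f q k = sum q {c \<in> S. f c = k}"

definition pow_sum :: "real \<Rightarrow> 'c set \<Rightarrow> ('c \<Rightarrow> 'k) \<Rightarrow> ('c \<Rightarrow> real) \<Rightarrow> real" where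
  "pow_sum lam S f q = (\<Sum>k\<in>f ` S. marg S f q k powr lam)"

definition pow_ln_sum :: "real \<Rightarrow> 'c set \<Rightarrow> ('c \<Rightarrow> 'k) \<Rightarrow> ('c \<Rightarrow> real) \<Rightarrow> real" where
  "pow_ln_sum lam S f q = (\<Sum>k\<in>f ` S. marg S f q k powr lam * ln (marg S f q k))"

definition neg_entropy :: "real \<Rightarrow> 'c set \<Rightarrow> ('c \<Rightarrow> 'k) \<Rightarrow> ('c \<Rightarrow> real) \<Rightarrow> real" where
  "neg_entropy lam S f q = (\<Sum>k\<in>f ` S. xlnx (marg S f q k powr lam / pow_sum lam S f q))"

text \<open>
  Up to the factor \<open>lam\<^sup>2\<close>, \<open>score\<close> is the partial derivative of \<open>neg_entropy\<close> in the mass of the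
  fibre \<open>k\<close>; its numerator is named separately because it involves no division.
\<close>

definition score_num :: "real \<Rightarrow> 'c set \<Rightarrow> ('c \<Rightarrow> 'k) \<Rightarrow> ('c \<Rightarrow> real) \<Rightarrow> 'k \<Rightarrow> real" where
  "score_num lam S f q k = marg S f q k powr (lam - 1) *
     (pow_sum lam S f q * ln (marg S f q k) - pow_ln_sum lam S f q)"

definition score :: "real \<Rightarrow> 'c set \<Rightarrow> ('c \<Rightarrow> 'k) \<Rightarrow> ('c \<Rightarrow> real) \<Rightarrow> 'k \<Rightarrow> real" where
  "score lam S f q k = score_num lam S f q k / (pow_sum lam S f q)\<^sup>2"

text \<open>
  Up to \<open>lam\<^sup>2\<close>, the gradient of \<^const>\<open>T_A\<close>, evaluated along directions supported in \<open>S\<close>.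
\<close>

definition influence :: "real \<Rightarrow> ('a \<times> 'b) set \<Rightarrow> ('a \<times> 'b \<Rightarrow> real) \<Rightarrow> 'a \<times> 'b \<Rightarrow> real" where
  "influence lam S q c =
     score lam S id q c - score lam S fst q (fst c) - score lam S snd q (snd c)"

definition shift :: "('c \<Rightarrow> real) \<Rightarrow> real \<Rightarrow> ('c \<Rightarrow> real) \<Rightarrow> 'c \<Rightarrow> real" where
  "shift q t e = (\<lambda>c. q c + t * e c)"

lemma sum_shift: "sum (shift q t e) B = sum q B + t * sum e B"
  by (simp add: shift_def sum.distrib sum_distrib_left)

lemma shift_0 [simp]: "shift q 0 e = q"
  by (simp add: shift_def)

lemma marg_pos:
  assumes "finite S" "\<And>c. c \<in> S \<Longrightarrow> q c > 0" "k \<in> f ` S"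
  shows "marg S f q k > 0"
  unfolding marg_def using assms by (intro sum_pos) auto

lemma pow_sum_pos:
  assumes "finite S" "S \<noteq> {}" "\<And>c. c \<in> S \<Longrightarrow> q c > 0"
  shows "pow_sum lam S f q > 0"
  unfolding pow_sum_def using assms marg_pos[of S q _ f]
  by (intro sum_pos) (auto simp: less_le)

lemma marg_shift: "marg S f (shift q t e) k = marg S f q k + t * marg S f e k"
  by (simp add: marg_def sum_shift)

lemma neg_entropy_eq:
  assumes "finite S" "S \<noteq> {}" "\<And>c. c \<in> S \<Longrightarrow> q c > 0"
  shows "neg_entropy lam S f q =
    lam * pow_ln_sum lam S f q / pow_sum lam S f q - ln (pow_sum lam S f q)"
proof -
  let ?C = "pow_sum lam S f q" and ?m = "marg S f q"
  have C: "?C > 0" using assms by (rule pow_sum_pos)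
  have "neg_entropy lam S f q = (\<Sum>k\<in>f ` S. (lam * (?m k powr lam * ln (?m k)) - ?m k powr lam * ln ?C) / ?C)"
    unfolding neg_entropy_def
  proof (intro sum.cong refl)
    fix k assume "k \<in> f ` S"
    then have "?m k > 0" using assms marg_pos by metis
    then show "xlnx (?m k powr lam / ?C) = (lam * (?m k powr lam * ln (?m k)) - ?m k powr lam * ln ?C) / ?C"
      using C by (simp add: xlnx_def ln_div field_simps)
  qed
  also have "\<dots> = (lam * pow_ln_sum lam S f q - ?C * ln ?C) / ?C"
    by (simp add: pow_ln_sum_def sum_subtractf sum_distrib_left sum_divide_distrib
        flip: sum_divide_distrib) (simp add: pow_sum_def sum_distrib_right)
  finally show ?thesis using C by (simp add: diff_divide_distrib)
qed

text \<open>
  In the derivative of \<open>lam * A / C - ln C\<close>, with \<open>A = pow_ln_sum\<close> and \<open>C = pow_sum\<close>, the derivative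
  of \<open>ln C\<close> cancels the part of the derivative of \<open>A\<close> that comes from the logarithms.
\<close>

lemma neg_entropy_derivative:
  fixes f :: "'c \<Rightarrow> 'k"
  assumes S: "finite S" "S \<noteq> {}" and q: "\<And>c. c \<in> S \<Longrightarrow> q c > 0"
  shows "((\<lambda>t. neg_entropy lam S f (shift q t e)) has_real_derivative
    lam\<^sup>2 * (\<Sum>c\<in>S. e c * score lam S f q (f c))) (at 0)"
proof -
  let ?K = "f ` S" and ?m = "marg S f q" and ?d = "marg S f e"
  let ?C = "pow_sum lam S f q" and ?A = "pow_ln_sum lam S f q"
  let ?C' = "\<Sum>k\<in>?K. lam * ?d k * ?m k powr (lam - 1)"
  let ?A' = "\<Sum>k\<in>?K. lam * ?d k * ?m k powr (lam - 1) * ln (?m k) + ?d k * ?m k powr (lam - 1)"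
  have m: "?m k > 0" if "k \<in> ?K" for k using S(1) q that by (rule marg_pos)
  have C: "?C > 0" using S q by (rule pow_sum_pos)
  have dC: "((\<lambda>t. pow_sum lam S f (shift q t e)) has_real_derivative ?C') (at 0)"
    unfolding pow_sum_def marg_shift
  proof (rule DERIV_sum)
    fix k assume "k \<in> ?K"
    from m[OF this] show "((\<lambda>t. (?m k + t * ?d k) powr lam) has_real_derivative
        lam * ?d k * ?m k powr (lam - 1)) (at 0)"
      by (auto intro!: derivative_eq_intros)
  qed
  have dA: "((\<lambda>t. pow_ln_sum lam S f (shift q t e)) has_real_derivative ?A') (at 0)"
    unfolding pow_ln_sum_def marg_shift
  proof (rule DERIV_sum)
    fix k assume "k \<in> ?K"
    from m[OF this] show "((\<lambda>t. (?m k + t * ?d k) powr lam * ln (?m k + t * ?d k)) has_real_derivative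
        lam * ?d k * ?m k powr (lam - 1) * ln (?m k) + ?d k * ?m k powr (lam - 1)) (at 0)"
      by (auto intro!: derivative_eq_intros simp: powr_diff)
  qed
  have pos: "\<forall>\<^sub>F t in at 0. \<forall>c\<in>S. shift q t e c > 0"
  proof (rule eventually_ball_finite[OF S(1)], rule ballI)
    fix c assume "c \<in> S"
    have "((\<lambda>t. shift q t e c) \<longlongrightarrow> q c + 0 * e c) (at 0)"
      unfolding shift_def by (intro tendsto_intros)
    then show "\<forall>\<^sub>F t in at 0. shift q t e c > 0"
      using q[OF \<open>c \<in> S\<close>] order_tendstoD(1) by fastforce
  qed
  have ev: "\<forall>\<^sub>F t in nhds 0. lam * pow_ln_sum lam S f (shift q t e) / pow_sum lam S f (shift q t e)
      - ln (pow_sum lam S f (shift q t e)) = neg_entropy lam S f (shift q t e)"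
    unfolding eventually_nhds_conv_at
  proof
    show "\<forall>\<^sub>F t in at 0. lam * pow_ln_sum lam S f (shift q t e) / pow_sum lam S f (shift q t e)
      - ln (pow_sum lam S f (shift q t e)) = neg_entropy lam S f (shift q t e)"
      using pos
    proof eventually_elim
      case (elim t)
      then show ?case using neg_entropy_eq[OF S, of "shift q t e" lam f] by simp
    qed
    show "lam * pow_ln_sum lam S f (shift q 0 e) / pow_sum lam S f (shift q 0 e)
      - ln (pow_sum lam S f (shift q 0 e)) = neg_entropy lam S f (shift q 0 e)"
      using neg_entropy_eq[OF S, of q lam f] q by simp
  qed
  let ?D = "lam\<^sup>2 * (\<Sum>k\<in>?K. ?d k * score lam S f q k)"
  have "((\<lambda>t. lam * pow_ln_sum lam S f (shift q t e) / pow_sum lam S f (shift q t e)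
      - ln (pow_sum lam S f (shift q t e))) has_real_derivative
      (lam * ?A' * ?C - lam * ?A * ?C') / (?C * ?C) - ?C' / ?C) (at 0)"
    using C by (auto intro!: derivative_eq_intros dC dA)
  also have "(lam * ?A' * ?C - lam * ?A * ?C') / (?C * ?C) - ?C' / ?C = ?D"
  proof -
    let ?E = "\<Sum>k\<in>?K. ?d k * ?m k powr (lam - 1)"
    let ?F = "\<Sum>k\<in>?K. ?d k * ?m k powr (lam - 1) * ln (?m k)"
    have C': "?C' = lam * ?E" by (simp add: sum_distrib_left mult.assoc)
    have A': "?A' = lam * ?F + ?E" by (simp add: sum.distrib sum_distrib_left mult.assoc)
    have s: "(\<Sum>k\<in>?K. ?d k * score lam S f q k) = (?C * ?F - ?A * ?E) / ?C\<^sup>2"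
      unfolding score_def score_num_def
      by (simp add: sum_distrib_left sum_divide_distrib flip: sum_subtractf)
         (intro sum.cong refl, simp add: algebra_simps diff_divide_distrib)
    then show ?thesis
      unfolding C' A' s using C by (simp add: field_simps power2_eq_square)
  qed
  finally have "((\<lambda>t. neg_entropy lam S f (shift q t e)) has_real_derivative ?D) (at 0)"
    using DERIV_cong_ev[OF refl ev refl] by blast
  moreover have "(\<Sum>k\<in>?K. ?d k * score lam S f q k) = (\<Sum>c\<in>S. e c * score lam S f q (f c))"
  proof -
    have "(\<Sum>c\<in>S. e c * score lam S f q (f c)) = (\<Sum>k\<in>?K. \<Sum>c\<in>{c \<in> S. f c = k}. e c * score lam S f q (f c))"
      using S(1) by (intro sum.group[symmetric]) auto
    also have "\<dots> = (\<Sum>k\<in>?K. ?d k * score lam S f q k)"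
      unfolding marg_def sum_distrib_right by (intro sum.cong) auto
    finally show ?thesis by simp
  qed
  ultimately show ?thesis by simp
qed

lemma row_marg_eq:
  assumes "S \<subseteq> cells I J" "\<And>c. c \<in> cells I J - S \<Longrightarrow> q c = 0" "i \<in> {1..I}"
  shows "row_marg J q i = marg S fst q i"
proof -
  have "row_marg J q i = sum q ((\<lambda>j. (i, j)) ` {1..J})"
    unfolding row_marg_def by (subst sum.reindex) (auto intro: inj_onI)
  also have "\<dots> = marg S fst q i"
    unfolding marg_def using assms
    by (intro sum.mono_neutral_right) (fastforce simp: cells_def)+
  finally show ?thesis .
qed

lemma col_marg_eq:
  assumes "S \<subseteq> cells I J" "\<And>c. c \<in> cells I J - S \<Longrightarrow> q c = 0" "j \<in> {1..J}"
  shows "col_marg I q j = marg S snd q j"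
proof -
  have "col_marg I q j = sum q ((\<lambda>i. (i, j)) ` {1..I})"
    unfolding col_marg_def by (subst sum.reindex) (auto intro: inj_onI)
  also have "\<dots> = marg S snd q j"
    unfolding marg_def using assms
    by (intro sum.mono_neutral_right) (fastforce simp: cells_def)+
  finally show ?thesis .
qed

text \<open>
  Cells, rows and columns of mass zero contribute nothing, since \<open>0 powr lam = 0\<close> and \<open>xlnx 0 = 0\<close>.
  So the sums over the whole table may be restricted to \<open>S\<close>.
\<close>

lemma T_A_eq:
  assumes S: "S \<subseteq> cells I J" and z: "\<And>c. c \<in> cells I J - S \<Longrightarrow> q c = 0"
  shows "T_A I J lam q = neg_entropy lam S id q - neg_entropy lam S fst q - neg_entropy lam S snd q"
proof -
  have fin: "finite (cells I J)" by (simp add: cells_def)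
  have id: "marg S id q c = q c" if "c \<in> S" for c
  proof -
    have "{d \<in> S. d = c} = {c}" using that by auto
    then show ?thesis by (simp add: marg_def)
  qed
  have cellsum: "(\<Sum>i=1..I. \<Sum>j=1..J. g (q (i, j))) = (\<Sum>c\<in>S. g (q c))" if "g 0 = 0" for g :: "real \<Rightarrow> real"
  proof -
    have "(\<Sum>i=1..I. \<Sum>j=1..J. g (q (i, j))) = (\<Sum>c\<in>cells I J. g (q c))"
      unfolding cells_def sum.cartesian_product by (simp add: case_prod_unfold)
    also have "\<dots> = (\<Sum>c\<in>S. g (q c))"
      using S z that fin by (intro sum.mono_neutral_right) auto
    finally show ?thesis .
  qed
  have C: "c_pow I J lam q = pow_sum lam S id q"
    unfolding c_pow_def pow_sum_def using cellsum[of "\<lambda>x. x powr lam"] by (simp add: id)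
  have 1: "(\<Sum>i=1..I. \<Sum>j=1..J. xlnx (q (i, j) powr lam / c_pow I J lam q)) = neg_entropy lam S id q"
    unfolding neg_entropy_def C
    using cellsum[of "\<lambda>x. xlnx (x powr lam / pow_sum lam S id q)"] by (simp add: id xlnx_def)
  have rowsum: "(\<Sum>i=1..I. g (row_marg J q i)) = (\<Sum>i\<in>fst ` S. g (marg S fst q i))"
    if "g 0 = 0" for g :: "real \<Rightarrow> real"
  proof -
    have "(\<Sum>i=1..I. g (row_marg J q i)) = (\<Sum>i=1..I. g (marg S fst q i))"
      using row_marg_eq[OF S z] by (intro sum.cong) auto
    also have "\<dots> = (\<Sum>i\<in>fst ` S. g (marg S fst q i))"
    proof (intro sum.mono_neutral_right ballI)
      fix i assume "i \<in> {1..I} - fst ` S"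
      then have "{c \<in> S. fst c = i} = {}" by (auto simp: image_iff)
      then show "g (marg S fst q i) = 0" using that unfolding marg_def by (metis sum.empty)
    qed (use S in \<open>auto simp: cells_def\<close>)
    finally show ?thesis .
  qed
  have colsum: "(\<Sum>i=1..J. g (col_marg I q i)) = (\<Sum>i\<in>snd ` S. g (marg S snd q i))"
    if "g 0 = 0" for g :: "real \<Rightarrow> real"
  proof -
    have "(\<Sum>i=1..J. g (col_marg I q i)) = (\<Sum>i=1..J. g (marg S snd q i))"
      using col_marg_eq[OF S z] by (intro sum.cong) auto
    also have "\<dots> = (\<Sum>i\<in>snd ` S. g (marg S snd q i))"
    proof (intro sum.mono_neutral_right ballI)
      fix i assume "i \<in> {1..J} - snd ` S"
      then have "{c \<in> S. snd c = i} = {}" by (auto simp: image_iff)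
      then show "g (marg S snd q i) = 0" using that unfolding marg_def by (metis sum.empty)
    qed (use S in \<open>auto simp: cells_def\<close>)
    finally show ?thesis .
  qed
  have R: "(\<Sum>s=1..I. row_marg J q s powr lam) = pow_sum lam S fst q"
    unfolding pow_sum_def using rowsum[of "\<lambda>x. x powr lam"] by simp
  have 2: "(\<Sum>i=1..I. xlnx (row_marg J q i powr lam / pow_sum lam S fst q)) = neg_entropy lam S fst q"
    unfolding neg_entropy_def
    using rowsum[of "\<lambda>x. xlnx (x powr lam / pow_sum lam S fst q)"] by (simp add: xlnx_def)
  have D: "(\<Sum>s=1..J. col_marg I q s powr lam) = pow_sum lam S snd q"
    unfolding pow_sum_def using colsum[of "\<lambda>x. x powr lam"] by simp
  have 3: "(\<Sum>i=1..J. xlnx (col_marg I q i powr lam / pow_sum lam S snd q)) = neg_entropy lam S snd q"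
    unfolding neg_entropy_def
    using colsum[of "\<lambda>x. xlnx (x powr lam / pow_sum lam S snd q)"] by (simp add: xlnx_def)
  show ?thesis unfolding T_A_def R D 1 2 3 ..
qed

lemma T_A_derivative:
  assumes S: "S \<subseteq> cells I J" "S \<noteq> {}" and z: "\<And>c. c \<in> cells I J - S \<Longrightarrow> q c = 0"
    and q: "\<And>c. c \<in> S \<Longrightarrow> q c > 0" and e: "\<And>c. c \<in> cells I J - S \<Longrightarrow> e c = 0"
  shows "((\<lambda>t. T_A I J lam (shift q t e)) has_real_derivative
    lam\<^sup>2 * (\<Sum>c\<in>S. e c * influence lam S q c)) (at 0)"
proof -
  have fin: "finite S" using S(1) by (rule finite_subset) (simp add: cells_def)
  have der: "((\<lambda>t. neg_entropy lam S f (shift q t e)) has_real_derivative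
    lam\<^sup>2 * (\<Sum>c\<in>S. e c * score lam S f q (f c))) (at 0)" for f :: "nat \<times> nat \<Rightarrow> 'k"
    using fin S(2) q by (rule neg_entropy_derivative)
  have "T_A I J lam (shift q t e) = neg_entropy lam S id (shift q t e) -
      neg_entropy lam S fst (shift q t e) - neg_entropy lam S snd (shift q t e)" for t
    using S(1) by (rule T_A_eq) (simp add: shift_def z e)
  moreover have "lam\<^sup>2 * (\<Sum>c\<in>S. e c * score lam S id q (id c)) - lam\<^sup>2 * (\<Sum>c\<in>S. e c * score lam S fst q (fst c))
      - lam\<^sup>2 * (\<Sum>c\<in>S. e c * score lam S snd q (snd c)) = lam\<^sup>2 * (\<Sum>c\<in>S. e c * influence lam S q c)"
    by (simp add: influence_def right_diff_distrib sum_subtractf)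
  ultimately show ?thesis
    using DERIV_diff[OF DERIV_diff[OF der[of id] der[of fst]] der[of snd]] by simp
qed

lemma T_A_cong:
  assumes "\<And>c. c \<in> cells I J \<Longrightarrow> q c = q' c"
  shows "T_A I J lam q = T_A I J lam q'"
proof -
  have m: "marg (cells I J) f q k = marg (cells I J) f q' k" for k and f :: "nat \<times> nat \<Rightarrow> 'k"
    unfolding marg_def using assms by (intro sum.cong) auto
  have *: "neg_entropy lam (cells I J) f q = neg_entropy lam (cells I J) f q'" for f :: "nat \<times> nat \<Rightarrow> 'k"
    unfolding neg_entropy_def pow_sum_def by (simp add: m)
  show ?thesis by (subst (1 2) T_A_eq[of "cells I J"]) (auto simp: *)
qed

text \<open>
  Varying the coordinate \<open>c\<close> while the eliminated cell \<open>r\<close> restores the total mass amounts to moving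
  mass from \<open>r\<close> to \<open>c\<close>.
\<close>

lemma grad_T_A_eq:
  assumes S: "S \<subseteq> cells I J" and z: "\<And>d. d \<in> cells I J - S \<Longrightarrow> q d = 0"
    and q: "\<And>d. d \<in> S \<Longrightarrow> q d > 0" and sum1: "sum q (cells I J) = 1"
    and r: "r \<in> S" and c: "c \<in> S" "c \<noteq> r"
  shows "grad_T_A I J lam r q c = lam\<^sup>2 * (influence lam S q c - influence lam S q r)"
proof -
  define e where "e = (\<lambda>d. if d = c then 1 else if d = r then -1 else (0::real))"
  have fin: "finite (cells I J)" by (simp add: cells_def)
  have "T_A I J lam (complete_distr I J r (q(c := x))) = T_A I J lam (shift q (x - q c) e)" for x
  proof (rule T_A_cong)
    fix d assume d: "d \<in> cells I J"
    have "(\<Sum>d\<in>cells I J - {r}. (q(c := x)) d) = x + (\<Sum>d\<in>cells I J - {r} - {c}. (q(c := x)) d)"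
      using fin c S by (subst sum.remove[of _ c]) auto
    also have "(\<Sum>d\<in>cells I J - {r} - {c}. (q(c := x)) d) = (\<Sum>d\<in>cells I J - {r} - {c}. q d)"
      by (intro sum.cong) auto
    also have "\<dots> = 1 - q r - q c"
      using sum1 fin r c S by (subst sum_diff1, simp, subst sum_diff1) auto
    finally show "complete_distr I J r (q(c := x)) d = shift q (x - q c) e d"
      using c by (auto simp: complete_distr_def shift_def e_def)
  qed
  then have eq: "(\<lambda>x. T_A I J lam (complete_distr I J r (q(c := x)))) = (\<lambda>x. T_A I J lam (shift q (x - q c) e))"
    by (intro ext)
  have "(\<Sum>d\<in>S. e d * influence lam S q d) = (\<Sum>d\<in>{c,r}. e d * influence lam S q d)"
    using r c finite_subset[OF S fin] by (intro sum.mono_neutral_right) (auto simp: e_def)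
  also have "\<dots> = influence lam S q c - influence lam S q r"
    using c by (simp add: e_def)
  finally have e: "(\<Sum>d\<in>S. e d * influence lam S q d) = influence lam S q c - influence lam S q r" .
  have "((\<lambda>t. T_A I J lam (shift q t e)) has_real_derivative
      lam\<^sup>2 * (influence lam S q c - influence lam S q r)) (at 0)"
    unfolding e[symmetric] using r c
    by (intro T_A_derivative[OF S _ z q]) (auto simp: e_def)
  then have "((\<lambda>x. T_A I J lam (shift q (x - q c) e)) has_real_derivative
      lam\<^sup>2 * (influence lam S q c - influence lam S q r)) (at (q c))"
    using DERIV_shift[of "\<lambda>x. T_A I J lam (shift q (x - q c) e)" _ 0 "q c"] by simp
  then show ?thesis unfolding grad_T_A_def eq by (rule DERIV_imp_deriv)
qed

definition variance_on :: "'c set \<Rightarrow> ('c \<Rightarrow> real) \<Rightarrow> ('c \<Rightarrow> real) \<Rightarrow> real" where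
  "variance_on S q g = (\<Sum>c\<in>S. q c * (g c - (\<Sum>d\<in>S. q d * g d))\<^sup>2)"

lemma variance_on_eq:
  assumes "sum q S = 1"
  shows "variance_on S q g = (\<Sum>c\<in>S. q c * (g c)\<^sup>2) - (\<Sum>c\<in>S. q c * g c)\<^sup>2"
proof -
  let ?m = "\<Sum>d\<in>S. q d * g d"
  have "variance_on S q g = (\<Sum>c\<in>S. q c * (g c)\<^sup>2 - 2 * ?m * (q c * g c) + ?m\<^sup>2 * q c)"
    unfolding variance_on_def by (intro sum.cong refl) (simp add: power2_diff algebra_simps)
  also have "\<dots> = (\<Sum>c\<in>S. q c * (g c)\<^sup>2) - 2 * ?m * ?m + ?m\<^sup>2 * 1"
    using assms by (simp add: sum.distrib sum_subtractf flip: sum_distrib_left)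
  finally show ?thesis by (simp add: power2_eq_square)
qed

lemma variance_on_affine:
  assumes "sum q S = 1"
  shows "variance_on S q (\<lambda>c. a * (g c - b)) = a\<^sup>2 * variance_on S q g"
proof -
  let ?m = "\<Sum>d\<in>S. q d * g d"
  have "(\<Sum>d\<in>S. q d * (a * (g d - b))) = a * ?m - a * b * sum q S"
    by (simp add: algebra_simps sum_subtractf sum_distrib_left)
  then have "variance_on S q (\<lambda>c. a * (g c - b)) = (\<Sum>c\<in>S. q c * (a * (g c - b) - (a * ?m - a * b))\<^sup>2)"
    unfolding variance_on_def assms by simp
  also have "\<dots> = (\<Sum>c\<in>S. a\<^sup>2 * (q c * (g c - ?m)\<^sup>2))"
    by (intro sum.cong refl) (simp add: power2_eq_square algebra_simps)
  finally show ?thesis by (simp add: variance_on_def sum_distrib_left)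
qed

lemma variance_on_pos:
  assumes S: "finite S" "\<And>c. c \<in> S \<Longrightarrow> q c > 0" and c: "c \<in> S" "d \<in> S" "g c \<noteq> g d"
  shows "variance_on S q g > 0"
proof -
  let ?m = "\<Sum>d\<in>S. q d * g d"
  obtain x where "x \<in> S" "g x \<noteq> ?m" using c by metis
  then have "0 < q x * (g x - ?m)\<^sup>2" using S(2) by simp
  then show ?thesis
    unfolding variance_on_def using S \<open>x \<in> S\<close>
    by (intro sum_pos2[of S x]) (auto simp: less_imp_le)
qed

text \<open>
  The quadratic form of the multinomial covariance is a variance under \<open>q\<close>, taken of the differences
  \<open>influence c - influence r\<close>; a variance ignores the constant \<open>influence r\<close>, so the choice of the
  eliminated cell does not matter.
\<close>

lemma sigma2_eq:
  assumes S: "S \<subseteq> cells I J" "S \<noteq> {}" and z: "\<And>d. d \<in> cells I J - S \<Longrightarrow> q d = 0"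
    and q: "\<And>d. d \<in> S \<Longrightarrow> q d > 0" and sum1: "sum q (cells I J) = 1"
  shows "sigma2 I J lam q = lam ^ 4 * variance_on S q (influence lam S q)"
proof -
  have fin: "finite (cells I J)" by (simp add: cells_def)
  have finS: "finite S" using S(1) fin by (rule finite_subset)
  define r where "r = elim_cell I J q"
  have supp: "c \<in> S \<longleftrightarrow> c \<in> cells I J \<and> q c > 0" for c
    using S(1) z q by (metis DiffI less_irrefl subsetD)
  have IJ: "(I, J) \<in> cells I J" using S by (auto simp: cells_def)
  have r: "r \<in> S"
  proof (cases "q (I, J) > 0")
    case True
    then show ?thesis using IJ supp by (simp add: r_def elim_cell_def)
  next
    case False
    have "\<exists>c. c \<in> cells I J \<and> q c > 0" using S(2) supp by blast
    from someI_ex[OF this] show ?thesis using False supp by (simp add: r_def elim_cell_def)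
  qed
  define g where "g c = lam\<^sup>2 * (influence lam S q c - influence lam S q r)" for c
  let ?K = "cells I J - {r}"
  have "sigma2 I J lam q = (\<Sum>c\<in>?K. \<Sum>d\<in>?K. grad_T_A I J lam r q c * Sigma_entry q c d * grad_T_A I J lam r q d)"
    unfolding sigma2_def r_def Let_def ..
  also have "\<dots> = (\<Sum>c\<in>?K. \<Sum>d\<in>?K. g c * Sigma_entry q c d * g d)"
  proof (intro sum.cong refl)
    fix c d assume cd: "c \<in> ?K" "d \<in> ?K"
    show "grad_T_A I J lam r q c * Sigma_entry q c d * grad_T_A I J lam r q d = g c * Sigma_entry q c d * g d"
    proof (cases "c \<in> S \<and> d \<in> S")
      case True
      then show ?thesis
        using grad_T_A_eq[OF S(1) z q sum1 r, of c lam] grad_T_A_eq[OF S(1) z q sum1 r, of d lam] cd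
        by (simp add: g_def)
    next
      case False
      then have "q c = 0 \<or> q d = 0" using cd z by blast
      then show ?thesis by (auto simp: Sigma_entry_def)
    qed
  qed
  also have "\<dots> = (\<Sum>c\<in>?K. \<Sum>d\<in>?K. (if c = d then q c * (g c)\<^sup>2 else 0) - (q c * g c) * (q d * g d))"
    by (intro sum.cong refl) (simp add: Sigma_entry_def power2_eq_square algebra_simps)
  also have "\<dots> = (\<Sum>c\<in>?K. q c * (g c)\<^sup>2) - (\<Sum>c\<in>?K. q c * g c)\<^sup>2"
    using fin by (simp add: sum_subtractf power2_eq_square sum_product)
  also have "(\<Sum>c\<in>?K. q c * (g c)\<^sup>2) = (\<Sum>c\<in>S. q c * (g c)\<^sup>2)"
    using S z by (intro sum.mono_neutral_cong fin finS) (auto simp: fin g_def)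
  also have "(\<Sum>c\<in>?K. q c * g c) = (\<Sum>c\<in>S. q c * g c)"
    using S z by (intro sum.mono_neutral_cong fin finS) (auto simp: fin g_def)
  also have sumS: "sum q S = 1"
    using sum1 S z fin by (subst sum.mono_neutral_left[of "cells I J" S q]) auto
  have "(\<Sum>c\<in>S. q c * (g c)\<^sup>2) - (\<Sum>c\<in>S. q c * g c)\<^sup>2 = variance_on S q g"
    using variance_on_eq[OF sumS] by simp
  also have "\<dots> = lam ^ 4 * variance_on S q (influence lam S q)"
    unfolding g_def using variance_on_affine[OF sumS, of "lam\<^sup>2"] by simp
  finally show ?thesis .
qed

section \<open>Elementary functions of a mass vector\<close>

text \<open>
  Only three properties of the slope of \<open>T_A\<close> along a line matter: all iterated derivatives along
  the line exist, they are continuous functions of the base point, and the slope extends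
  holomorphically to a complex neighbourhood of the line. The following class contains the slope
  and has all three; its closure under derivatives is what makes the iterated derivatives
  manageable.
\<close>

inductive_set elementary :: "'c set set \<Rightarrow> (('c \<Rightarrow> real) \<Rightarrow> real) set" for Bs where
  const: "(\<lambda>q. r) \<in> elementary Bs"
| powr: "B \<in> Bs \<Longrightarrow> (\<lambda>q. sum q B powr a) \<in> elementary Bs"
| ln: "B \<in> Bs \<Longrightarrow> (\<lambda>q. ln (sum q B)) \<in> elementary Bs"
| add: "F \<in> elementary Bs \<Longrightarrow> G \<in> elementary Bs \<Longrightarrow> (\<lambda>q. F q + G q) \<in> elementary Bs"
| mult: "F \<in> elementary Bs \<Longrightarrow> G \<in> elementary Bs \<Longrightarrow> (\<lambda>q. F q * G q) \<in> elementary Bs"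

lemma elementary_diff:
  assumes "F \<in> elementary Bs" "G \<in> elementary Bs"
  shows "(\<lambda>q. F q - G q) \<in> elementary Bs"
  using elementary.add[OF assms(1) elementary.mult[OF elementary.const[of "-1"] assms(2)]] by simp

lemma elementary_sum:
  "(\<And>k. k \<in> K \<Longrightarrow> F k \<in> elementary Bs) \<Longrightarrow> (\<lambda>q. \<Sum>k\<in>K. F k q) \<in> elementary Bs"
  by (induction K rule: infinite_finite_induct)
     (auto intro: elementary.const elementary.add)

lemma elementary_power2:
  assumes "F \<in> elementary Bs"
  shows "(\<lambda>q. (F q)\<^sup>2) \<in> elementary Bs"
  using elementary.mult[OF assms assms] by (simp add: power2_eq_square)

lemma elementary_derivative:
  assumes "F \<in> elementary Bs"
  shows "\<exists>F'\<in>elementary Bs. \<forall>q t. (\<forall>B\<in>Bs. sum (shift q t e) B > 0) \<longrightarrow>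
    ((\<lambda>t. F (shift q t e)) has_real_derivative F' (shift q t e)) (at t)"
  using assms
proof induction
  case (const r)
  then show ?case by (intro bexI[of _ "\<lambda>_. 0"]) (auto intro: elementary.const)
next
  case (powr B a)
  show ?case
  proof (intro bexI[of _ "\<lambda>q. a * sum e B * sum q B powr (a - 1)"] allI impI)
    fix q t
    assume "\<forall>B\<in>Bs. sum (shift q t e) B > 0"
    then have "sum q B + t * sum e B > 0" using powr by (simp add: sum_shift)
    then show "((\<lambda>t. sum (shift q t e) B powr a) has_real_derivative
        a * sum e B * sum (shift q t e) B powr (a - 1)) (at t)"
      unfolding sum_shift by (auto intro!: derivative_eq_intros)
  qed (intro elementary.mult elementary.const elementary.powr powr)
next
  case (ln B)
  show ?case
  proof (intro bexI[of _ "\<lambda>q. sum e B * sum q B powr (- 1)"] allI impI)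
    fix q t
    assume "\<forall>B\<in>Bs. sum (shift q t e) B > 0"
    then have "sum q B + t * sum e B > 0" using ln by (simp add: sum_shift)
    then show "((\<lambda>t. ln (sum (shift q t e) B)) has_real_derivative
        sum e B * sum (shift q t e) B powr (- 1)) (at t)"
      unfolding sum_shift
      by (auto intro!: derivative_eq_intros simp: powr_minus_divide)
  qed (intro elementary.mult elementary.const elementary.powr ln)
next
  case (add F G)
  then obtain F' G' where "F' \<in> elementary Bs" "G' \<in> elementary Bs" and
    *: "\<forall>q t. (\<forall>B\<in>Bs. sum (shift q t e) B > 0) \<longrightarrow>
    ((\<lambda>t. F (shift q t e)) has_real_derivative F' (shift q t e)) (at t)"
    "\<forall>q t. (\<forall>B\<in>Bs. sum (shift q t e) B > 0) \<longrightarrow>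
    ((\<lambda>t. G (shift q t e)) has_real_derivative G' (shift q t e)) (at t)" by blast
  then show ?case
    by (intro bexI[of _ "\<lambda>q. F' q + G' q"] allI impI DERIV_add elementary.add) simp_all
next
  case (mult F G)
  then obtain F' G' where el: "F' \<in> elementary Bs" "G' \<in> elementary Bs" and
    *: "\<forall>q t. (\<forall>B\<in>Bs. sum (shift q t e) B > 0) \<longrightarrow>
    ((\<lambda>t. F (shift q t e)) has_real_derivative F' (shift q t e)) (at t)"
    "\<forall>q t. (\<forall>B\<in>Bs. sum (shift q t e) B > 0) \<longrightarrow>
    ((\<lambda>t. G (shift q t e)) has_real_derivative G' (shift q t e)) (at t)" by blast
  show ?case
    by (intro bexI[of _ "\<lambda>q. F' q * G q + G' q * F q"] allI impI DERIV_mult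
        elementary.add elementary.mult el mult(1,2)) (use * in simp_all)
qed

lemma elementary_derivatives:
  assumes "F \<in> elementary Bs"
  obtains Fs where "Fs 0 = F" "\<And>n. Fs n \<in> elementary Bs"
    "\<And>n q t. (\<And>B. B \<in> Bs \<Longrightarrow> sum (shift q t e) B > 0) \<Longrightarrow>
      ((\<lambda>t. Fs n (shift q t e)) has_real_derivative Fs (Suc n) (shift q t e)) (at t)"
proof -
  have "\<exists>Fs. \<forall>n. (Fs n \<in> elementary Bs \<and> (n = 0 \<longrightarrow> Fs n = F)) \<and>
    (\<forall>q t. (\<forall>B\<in>Bs. sum (shift q t e) B > 0) \<longrightarrow>
    ((\<lambda>t. Fs n (shift q t e)) has_real_derivative Fs (Suc n) (shift q t e)) (at t))"
  proof (rule dependent_nat_choice)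
    show "\<exists>G. G \<in> elementary Bs \<and> ((0::nat) = 0 \<longrightarrow> G = F)" using assms by blast
  next
    fix G and n :: nat
    assume "G \<in> elementary Bs \<and> (n = 0 \<longrightarrow> G = F)"
    then show "\<exists>G'. (G' \<in> elementary Bs \<and> (Suc n = 0 \<longrightarrow> G' = F)) \<and>
      (\<forall>q t. (\<forall>B\<in>Bs. 0 < sum (shift q t e) B) \<longrightarrow>
        ((\<lambda>t. G (shift q t e)) has_real_derivative G' (shift q t e)) (at t))"
      using elementary_derivative[of G Bs e] by blast
  qed
  then obtain Fs where "\<And>n. (Fs n \<in> elementary Bs \<and> (n = 0 \<longrightarrow> Fs n = F)) \<and>
    (\<forall>q t. (\<forall>B\<in>Bs. sum (shift q t e) B > 0) \<longrightarrow>
    ((\<lambda>t. Fs n (shift q t e)) has_real_derivative Fs (Suc n) (shift q t e)) (at t))"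
    by (elim exE) auto
  then show ?thesis by (intro that[of Fs]) auto
qed

lemma elementary_tendsto:
  assumes "F \<in> elementary Bs"
    and "\<And>B. B \<in> Bs \<Longrightarrow> ((\<lambda>q. sum q B) \<longlongrightarrow> sum p B) L"
    and "\<And>B. B \<in> Bs \<Longrightarrow> sum p B > 0"
  shows "(F \<longlongrightarrow> F p) L"
  using assms(1)
proof induction
  case (powr B a)
  then show ?case using assms(2,3)[of B] by (intro tendsto_powr) auto
next
  case (ln B)
  then show ?case using assms(2,3)[of B] by (intro tendsto_ln) auto
qed (simp_all add: tendsto_add tendsto_mult)

lemma elementary_holomorphic:
  assumes "F \<in> elementary Bs"
    and "\<And>B z. B \<in> Bs \<Longrightarrow> z \<in> V \<Longrightarrow> sum p B + Re z * sum e B > 0"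
  shows "\<exists>f. f holomorphic_on V \<and>
    (\<forall>t. complex_of_real t \<in> V \<longrightarrow> f (complex_of_real t) = complex_of_real (F (shift p t e)))"
  using assms(1)
proof induction
  case (const r)
  then show ?case by (intro exI[of _ "\<lambda>_. complex_of_real r"]) auto
next
  case (powr B a)
  let ?l = "\<lambda>z. complex_of_real (sum p B) + z * complex_of_real (sum e B)"
  have nn: "?l z \<notin> \<real>\<^sub>\<le>\<^sub>0" if "z \<in> V" for z
    using assms(2)[OF powr that] by (auto simp: complex_nonpos_Reals_iff)
  show ?case
  proof (intro exI[of _ "\<lambda>z. exp (complex_of_real a * Ln (?l z))"] conjI allI impI)
    show "(\<lambda>z. exp (complex_of_real a * Ln (?l z))) holomorphic_on V"
      using nn by (intro holomorphic_intros) auto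
    fix t assume t: "complex_of_real t \<in> V"
    have pos: "sum p B + t * sum e B > 0" using assms(2)[OF powr t] by simp
    have "?l (complex_of_real t) = complex_of_real (sum p B + t * sum e B)" by simp
    then show "exp (complex_of_real a * Ln (?l (complex_of_real t))) =
        complex_of_real (sum (shift p t e) B powr a)"
      using pos by (simp only: Ln_of_real sum_shift)
        (simp add: powr_def mult.commute flip: exp_of_real)
  qed
next
  case (ln B)
  let ?l = "\<lambda>z. complex_of_real (sum p B) + z * complex_of_real (sum e B)"
  have nn: "?l z \<notin> \<real>\<^sub>\<le>\<^sub>0" if "z \<in> V" for z
    using assms(2)[OF ln that] by (auto simp: complex_nonpos_Reals_iff)
  show ?case
  proof (intro exI[of _ "\<lambda>z. Ln (?l z)"] conjI allI impI)
    show "(\<lambda>z. Ln (?l z)) holomorphic_on V"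
      using nn by (intro holomorphic_intros) auto
    fix t assume t: "complex_of_real t \<in> V"
    have pos: "sum p B + t * sum e B > 0" using assms(2)[OF ln t] by simp
    have "?l (complex_of_real t) = complex_of_real (sum p B + t * sum e B)" by simp
    then show "Ln (?l (complex_of_real t)) = complex_of_real (ln (sum (shift p t e) B))"
      using pos by (simp only: Ln_of_real sum_shift)
  qed
next
  case (add F G)
  then obtain f g where "f holomorphic_on V" "g holomorphic_on V"
    "\<forall>t. complex_of_real t \<in> V \<longrightarrow> f (complex_of_real t) = complex_of_real (F (shift p t e))"
    "\<forall>t. complex_of_real t \<in> V \<longrightarrow> g (complex_of_real t) = complex_of_real (G (shift p t e))" by blast
  then show ?case
    by (intro exI[of _ "\<lambda>z. f z + g z"]) (auto intro: holomorphic_intros)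
next
  case (mult F G)
  then obtain f g where "f holomorphic_on V" "g holomorphic_on V"
    "\<forall>t. complex_of_real t \<in> V \<longrightarrow> f (complex_of_real t) = complex_of_real (F (shift p t e))"
    "\<forall>t. complex_of_real t \<in> V \<longrightarrow> g (complex_of_real t) = complex_of_real (G (shift p t e))" by blast
  then show ?case
    by (intro exI[of _ "\<lambda>z. f z * g z"]) (auto intro: holomorphic_intros)
qed

text \<open>
  If all derivatives along the line vanished at \<open>p\<close>, the holomorphic extension to the strip above
  the line would vanish by the identity theorem.
\<close>

lemma elementary_nonzero_derivative:
  assumes F: "F \<in> elementary Bs" and "a < 0" "0 < b"
    and pos: "\<And>B t. B \<in> Bs \<Longrightarrow> t \<in> {a<..<b} \<Longrightarrow> sum (shift p t e) B > 0"
    and nz: "t0 \<in> {a<..<b}" "F (shift p t0 e) \<noteq> 0"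
    and Fs0: "Fs 0 = F"
    and Fs: "\<And>n q t. (\<And>B. B \<in> Bs \<Longrightarrow> sum (shift q t e) B > 0) \<Longrightarrow>
      ((\<lambda>t. Fs n (shift q t e)) has_real_derivative Fs (Suc n) (shift q t e)) (at t)"
  shows "\<exists>k. Fs k p \<noteq> (0::real)"
proof (rule ccontr)
  assume "\<not> ?thesis"
  then have zero: "Fs k p = 0" for k by blast
  define V where "V = {z. a < Re z \<and> Re z < b}"
  have V: "open V" "connected V"
  proof -
    have eq: "V = {z. a < Re z} \<inter> {z. Re z < b}" by (auto simp: V_def)
    show "open V"
      unfolding eq by (intro open_Int open_halfspace_Re_gt open_halfspace_Re_lt)
    show "connected V"
      unfolding eq by (intro convex_connected convex_Int convex_halfspace_Re_gt convex_halfspace_Re_lt)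
  qed
  obtain f where f: "f holomorphic_on V"
    "\<And>t. complex_of_real t \<in> V \<Longrightarrow> f (complex_of_real t) = complex_of_real (F (shift p t e))"
    using elementary_holomorphic[OF F, of V p e] pos unfolding V_def by (auto simp: sum_shift)
  have derivs: "(deriv ^^ n) f (complex_of_real t) = complex_of_real (Fs n (shift p t e))"
    if "t \<in> {a<..<b}" for n t
    using that
  proof (induction n arbitrary: t)
    case 0
    then show ?case using f(2)[of t] by (simp add: Fs0 V_def)
  next
    case (Suc n)
    let ?g = "(deriv ^^ n) f"
    have tV: "complex_of_real t \<in> V" using Suc.prems by (simp add: V_def)
    have "(?g has_field_derivative deriv ?g (complex_of_real t)) (at (complex_of_real t))"
      using holomorphic_higher_deriv[OF f(1) V(1), of n] tV V(1)
      by (simp add: holomorphic_derivI)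
    then have "((\<lambda>x. ?g (complex_of_real x)) has_vector_derivative deriv ?g (complex_of_real t)) (at t)"
      by (rule has_vector_derivative_real_field)
    then have "((\<lambda>x. complex_of_real (Fs n (shift p x e))) has_vector_derivative deriv ?g (complex_of_real t)) (at t)"
      by (rule has_vector_derivative_transform_within_open[where S = "{a<..<b}"])
         (use Suc.prems Suc.IH in auto)
    moreover have "((\<lambda>x. Fs n (shift p x e)) has_vector_derivative Fs (Suc n) (shift p t e)) (at t)"
      using Fs[of p t n] pos Suc.prems by (simp add: has_real_derivative_iff_has_vector_derivative)
    then have "((\<lambda>x. complex_of_real (Fs n (shift p x e))) has_vector_derivative
        complex_of_real (Fs (Suc n) (shift p t e))) (at t)"
      unfolding has_vector_derivative_def
      by (auto dest: has_derivative_of_real simp: scaleR_conv_of_real)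
    ultimately show ?case using vector_derivative_unique_at by fastforce
  qed
  have "f w = 0" if "w \<in> V" for w
  proof (rule holomorphic_fun_eq_0_on_connected[OF f(1) V _ _ that])
    show "0 \<in> V" using assms by (simp add: V_def)
    show "(deriv ^^ n) f 0 = 0" for n
      using derivs[of 0 n] zero[of n] assms by simp
  qed
  then show False using nz f(2)[of t0] by (auto simp: V_def)
qed

text \<open>
  A function whose \<open>k\<close>-th derivative has no zero has at most \<open>k\<close> zeros: Rolle's theorem puts a zero of
  the derivative between any two consecutive zeros.
\<close>

lemma finite_zeros_rolle:
  fixes f :: "nat \<Rightarrow> real \<Rightarrow> real"
  assumes "\<And>i x. i < k \<Longrightarrow> x \<in> {a<..<b} \<Longrightarrow> (f i has_real_derivative f (Suc i) x) (at x)"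
    and "\<And>x. x \<in> {a<..<b} \<Longrightarrow> f k x \<noteq> 0"
    and "finite Z" and "Z \<subseteq> {x \<in> {a<..<b}. f 0 x = 0}"
  shows "card Z \<le> k"
  using assms
proof (induction k arbitrary: f Z)
  case 0
  then have "Z = {}" by auto
  then show ?case by simp
next
  case (Suc k)
  show ?case
  proof (cases "Z = {}")
    case False
    define Z' where "Z' = Z - {Max Z}"
    \<comment> \<open>the next zero to the right; every zero but the last has one\<close>
    define nxt where "nxt z = Min {y \<in> Z. z < y}" for z
    have nxt: "nxt z \<in> Z" "z < nxt z" "\<And>y. y \<in> Z \<Longrightarrow> z < y \<Longrightarrow> nxt z \<le> y" if "z \<in> Z'" for z
    proof -
      have "z < Max Z"
        using that Suc.prems(3) by (auto simp: Z'_def order_less_le)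
      then have ne: "{y \<in> Z. z < y} \<noteq> {}"
        using Max_in[OF Suc.prems(3) False] by auto
      have fin: "finite {y \<in> Z. z < y}" using Suc.prems(3) by simp
      from Min_in[OF fin ne] show "nxt z \<in> Z" "z < nxt z" unfolding nxt_def by auto
      show "nxt z \<le> y" if "y \<in> Z" "z < y" for y
        unfolding nxt_def using fin that by (intro Min_le) auto
    qed
    have "\<exists>x. z < x \<and> x < nxt z \<and> f 1 x = 0" if z: "z \<in> Z'" for z
    proof -
      have sub: "{z..nxt z} \<subseteq> {a<..<b}"
        using nxt(1)[OF z] z Suc.prems(4) unfolding Z'_def by fastforce
      have der: "(f 0 has_real_derivative f 1 x) (at x)" if "x \<in> {z..nxt z}" for x
        using Suc.prems(1)[of 0 x] sub that by auto
      have "z \<in> Z" using z by (simp add: Z'_def)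
      then have "f 0 z = 0" "f 0 (nxt z) = 0"
        using nxt(1)[OF z] Suc.prems(4) by blast+
      then have "f 0 z = f 0 (nxt z)" by simp
      moreover have "continuous_on {z..nxt z} (f 0)"
        by (intro continuous_at_imp_continuous_on ballI DERIV_isCont) (rule der)
      moreover have "f 0 differentiable (at x)" if "z < x" "x < nxt z" for x
        using der[of x] that real_differentiable_def by auto
      ultimately have "\<exists>x>z. x < nxt z \<and> (f 0 has_real_derivative 0) (at x)"
        by (intro Rolle nxt(2)[OF z])
      then obtain x where x: "z < x" "x < nxt z" and "(f 0 has_real_derivative 0) (at x)"
        by blast
      moreover have "(f 0 has_real_derivative f 1 x) (at x)" using der x by simp
      ultimately show ?thesis using DERIV_unique by blast
    qed
    then obtain g where g: "\<And>z. z \<in> Z' \<Longrightarrow> z < g z \<and> g z < nxt z \<and> f 1 (g z) = 0" by metis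
    have "g x < g y" if "x \<in> Z'" "y \<in> Z'" "x < y" for x y
      using g[OF that(1)] g[OF that(2)] nxt(3)[OF that(1), of y] that unfolding Z'_def by auto
    then have "inj_on g Z'"
      by (intro inj_onI) (metis less_irrefl linorder_neqE_linordered_idom)
    moreover have "card (g ` Z') \<le> k"
    proof (rule Suc.IH[of "\<lambda>i. f (Suc i)"])
      show "g ` Z' \<subseteq> {x \<in> {a<..<b}. f (Suc 0) x = 0}"
        using g nxt(1) Suc.prems(4) unfolding Z'_def by fastforce
    qed (use Suc.prems in \<open>auto simp: Z'_def\<close>)
    ultimately have "card Z' \<le> k" by (simp add: card_image)
    then show ?thesis
      using Suc.prems(3) Max_in[OF Suc.prems(3) False] by (simp add: Z'_def)
  qed simp
qed

section \<open>Neighbourhoods of a distribution inside its face\<close>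

text \<open>
  Frequencies of impossible letters are almost surely zero, and \<open>T_A\<close> need not be differentiable
  across the boundary of the simplex. Limits are therefore taken within the face of \<open>p\<close>: the vectors
  of total mass one that vanish wherever \<open>p\<close> does.
\<close>

definition near :: "'c set \<Rightarrow> ('c \<Rightarrow> real) \<Rightarrow> real \<Rightarrow> ('c \<Rightarrow> real) set" where
  "near W p \<delta> = {q. (\<forall>c\<in>W. p c = 0 \<longrightarrow> q c = 0) \<and> (\<forall>c\<in>W. \<bar>q c - p c\<bar> < \<delta>) \<and> sum q W = 1}"

definition face_nhds :: "'c set \<Rightarrow> ('c \<Rightarrow> real) \<Rightarrow> ('c \<Rightarrow> real) filter" where
  "face_nhds W p = (INF \<delta>\<in>{0<..}. principal (near W p \<delta>))"

definition supp :: "'c set \<Rightarrow> ('c \<Rightarrow> real) \<Rightarrow> 'c set" where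
  "supp W p = {c \<in> W. p c > 0}"

lemma near_mono: "\<delta> \<le> \<delta>' \<Longrightarrow> near W p \<delta> \<subseteq> near W p \<delta>'"
  by (force simp: near_def)

lemma eventually_face_nhds:
  "eventually P (face_nhds W p) \<longleftrightarrow> (\<exists>\<delta>>0. \<forall>q\<in>near W p \<delta>. P q)"
  unfolding face_nhds_def
proof (subst eventually_INF_base)
  fix a b :: real
  assume "a \<in> {0<..}" "b \<in> {0<..}"
  then show "\<exists>x\<in>{0<..}. principal (near W p x) \<le> inf (principal (near W p a)) (principal (near W p b))"
    by (intro bexI[of _ "min a b"]) (auto intro: near_mono[THEN subsetD, rotated])
qed (auto simp: eventually_principal)

lemma face_nhds_zero: "c \<in> W \<Longrightarrow> p c = 0 \<Longrightarrow> \<forall>\<^sub>F q in face_nhds W p. q c = 0"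
  unfolding eventually_face_nhds by (intro exI[of _ 1]) (auto simp: near_def)

lemma tendsto_face_nhds: "c \<in> W \<Longrightarrow> ((\<lambda>q. q c) \<longlongrightarrow> p c) (face_nhds W p)"
  unfolding tendsto_iff eventually_face_nhds dist_real_def by (auto simp: near_def)

lemma face_nhds_pos: "c \<in> W \<Longrightarrow> p c > 0 \<Longrightarrow> \<forall>\<^sub>F q in face_nhds W p. q c > 0"
  by (rule order_tendstoD(1)[OF tendsto_face_nhds])

lemma face_nhds_supp:
  assumes W: "finite W" and nn: "\<And>c. c \<in> W \<Longrightarrow> p c \<ge> 0"
  shows "\<forall>\<^sub>F q in face_nhds W p. (\<forall>c\<in>W - supp W p. q c = 0) \<and> (\<forall>c\<in>supp W p. q c > 0) \<and> sum q W = 1"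
proof (intro eventually_conj)
  show "\<forall>\<^sub>F q in face_nhds W p. \<forall>c\<in>W - supp W p. q c = 0"
    using W nn by (intro eventually_ball_finite ballI face_nhds_zero) (force simp: supp_def)+
  show "\<forall>\<^sub>F q in face_nhds W p. \<forall>c\<in>supp W p. q c > 0"
    using W by (intro eventually_ball_finite ballI face_nhds_pos) (auto simp: supp_def)
  show "\<forall>\<^sub>F q in face_nhds W p. sum q W = 1"
    unfolding eventually_face_nhds by (intro exI[of _ 1]) (auto simp: near_def)
qed

definition blocks :: "'c set \<Rightarrow> 'c set set" where
  "blocks S = {B. B \<subseteq> S \<and> B \<noteq> {}}"

lemma blocks_pos:
  fixes q :: "'c \<Rightarrow> real"
  assumes "finite S" "\<And>c. c \<in> S \<Longrightarrow> q c > 0" "B \<in> blocks S"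
  shows "sum q B > 0"
proof (rule sum_pos)
  show "finite B" "B \<noteq> {}" using assms finite_subset[of B S] by (auto simp: blocks_def)
  show "q c > 0" if "c \<in> B" for c using assms that by (auto simp: blocks_def)
qed

lemma elementary_pow_sum: "pow_sum lam S f \<in> elementary (blocks S)"
  unfolding pow_sum_def[abs_def] marg_def
  by (intro elementary_sum elementary.powr) (auto simp: blocks_def)

lemma elementary_pow_ln_sum: "pow_ln_sum lam S f \<in> elementary (blocks S)"
  unfolding pow_ln_sum_def[abs_def] marg_def
  by (intro elementary_sum elementary.mult elementary.powr elementary.ln) (auto simp: blocks_def)

lemma elementary_score_num:
  assumes "k \<in> f ` S"
  shows "(\<lambda>q. score_num lam S f q k) \<in> elementary (blocks S)"
  unfolding score_num_def marg_def using assms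
  by (intro elementary.mult elementary_diff elementary.powr elementary.ln
      elementary_pow_sum elementary_pow_ln_sum) (auto simp: blocks_def)

lemma tendsto_elementary:
  assumes "finite W" "F \<in> elementary (blocks (supp W p))"
  shows "(F \<longlongrightarrow> F p) (face_nhds W p)"
  using assms(2)
proof (rule elementary_tendsto)
  fix B assume B: "B \<in> blocks (supp W p)"
  show "((\<lambda>q. sum q B) \<longlongrightarrow> sum p B) (face_nhds W p)"
    using B by (intro tendsto_sum tendsto_face_nhds) (auto simp: blocks_def supp_def)
  show "sum p B > 0"
    by (rule blocks_pos[OF _ _ B]) (use assms(1) in \<open>auto simp: supp_def\<close>)
qed

lemma tendsto_score:
  assumes "finite W" "k \<in> f ` supp W p"
  shows "((\<lambda>q. score lam (supp W p) f q k) \<longlongrightarrow> score lam (supp W p) f p k) (face_nhds W p)"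
proof -
  have "pow_sum lam (supp W p) f p > 0"
    using assms by (intro pow_sum_pos) (auto simp: supp_def)
  then show ?thesis
    unfolding score_def using assms
    by (intro tendsto_intros tendsto_elementary elementary_pow_sum elementary_score_num) auto
qed

lemma tendsto_variance_influence:
  assumes W: "finite W"
  shows "((\<lambda>q. variance_on (supp W p) q (influence lam (supp W p) q)) \<longlongrightarrow>
    variance_on (supp W p) p (influence lam (supp W p) p)) (face_nhds W p)"
proof -
  have inf: "((\<lambda>q. influence lam (supp W p) q c) \<longlongrightarrow> influence lam (supp W p) p c) (face_nhds W p)"
    if "c \<in> supp W p" for c
    unfolding influence_def using that by (intro tendsto_intros tendsto_score W) auto
  have "((\<lambda>q. q c) \<longlongrightarrow> p c) (face_nhds W p)" if "c \<in> supp W p" for c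
    using that by (intro tendsto_face_nhds) (simp add: supp_def)
  then show ?thesis unfolding variance_on_def by (intro tendsto_intros inf)
qed

lemma tendsto_xlnx: "(f \<longlongrightarrow> a) L \<Longrightarrow> a > 0 \<Longrightarrow> ((\<lambda>x. xlnx (f x)) \<longlongrightarrow> xlnx a) L"
  unfolding xlnx_def by (intro tendsto_intros) auto

text \<open>
  The only arguments of \<^const>\<open>xlnx\<close> that can vanish at \<open>p\<close> are those of single cells, and
  on the face of \<open>p\<close> these vanish identically; all others stay away from the singularity of the
  logarithm.
\<close>

lemma tendsto_T_A_plus_T_B:
  assumes nn: "\<And>c. c \<in> cells I J \<Longrightarrow> p c \<ge> 0" and lam: "lam > 0"
    and rows: "\<And>i. i \<in> {1..I} \<Longrightarrow> row_marg J p i > 0"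
    and cols: "\<And>j. j \<in> {1..J} \<Longrightarrow> col_marg I p j > 0" and IJ: "I > 0" "J > 0"
  shows "((\<lambda>q. T_A I J lam q + T_B I J lam q) \<longlongrightarrow> T_A I J lam p + T_B I J lam p)
    (face_nhds (cells I J) p)"
proof -
  let ?L = "face_nhds (cells I J) p"
  have coord: "((\<lambda>q. q (i, j)) \<longlongrightarrow> p (i, j)) ?L" if "i \<in> {1..I}" "j \<in> {1..J}" for i j
    using that by (intro tendsto_face_nhds) (auto simp: cells_def)
  have pw: "((\<lambda>q. q (i, j) powr lam) \<longlongrightarrow> p (i, j) powr lam) ?L" if "i \<in> {1..I}" "j \<in> {1..J}" for i j
  proof (rule tendsto_powr2[OF coord[OF that] tendsto_const _ lam])
    have c: "(i, j) \<in> cells I J" using that by (simp add: cells_def)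
    show "\<forall>\<^sub>F q in ?L. 0 \<le> q (i, j)"
    proof (cases "p (i, j) = 0")
      case True
      show ?thesis using face_nhds_zero[where p = p, OF c True] by eventually_elim simp
    next
      case False
      then have "p (i, j) > 0" using nn[OF c] by simp
      from face_nhds_pos[where p = p, OF c this] show ?thesis by eventually_elim simp
    qed
  qed
  have pos_row: "(\<Sum>t=1..J. p (i, t) powr lam) > 0" if i: "i \<in> {1..I}" for i
  proof -
    obtain j where "j \<in> {1..J}" "p (i, j) \<noteq> 0"
      using rows[OF i] unfolding row_marg_def by (metis less_irrefl sum.neutral)
    then show ?thesis by (intro sum_pos2[of _ j]) auto
  qed
  have pos_col: "(\<Sum>t=1..I. p (t, j) powr lam) > 0" if j: "j \<in> {1..J}" for j
  proof -
    obtain i where "i \<in> {1..I}" "p (i, j) \<noteq> 0"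
      using cols[OF j] unfolding col_marg_def by (metis less_irrefl sum.neutral)
    then show ?thesis by (intro sum_pos2[of _ i]) auto
  qed
  have cpos: "c_pow I J lam p > 0"
    unfolding c_pow_def by (rule sum_pos) (use pos_row IJ in auto)
  have c: "((\<lambda>q. c_pow I J lam q) \<longlongrightarrow> c_pow I J lam p) ?L"
    unfolding c_pow_def by (intro tendsto_intros pw)
  have row: "((\<lambda>q. row_marg J q i) \<longlongrightarrow> row_marg J p i) ?L" if "i \<in> {1..I}" for i
    unfolding row_marg_def using that by (intro tendsto_intros coord)
  have col: "((\<lambda>q. col_marg I q j) \<longlongrightarrow> col_marg I p j) ?L" if "j \<in> {1..J}" for j
    unfolding col_marg_def using that by (intro tendsto_intros coord)
  have rowp: "((\<lambda>q. row_marg J q i powr lam) \<longlongrightarrow> row_marg J p i powr lam) ?L" if "i \<in> {1..I}" for i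
    using rows[OF that] row[OF that] by (intro tendsto_powr tendsto_const) auto
  have colp: "((\<lambda>q. col_marg I q j powr lam) \<longlongrightarrow> col_marg I p j powr lam) ?L" if "j \<in> {1..J}" for j
    using cols[OF that] col[OF that] by (intro tendsto_powr tendsto_const) auto
  have rowspos: "(\<Sum>s=1..I. row_marg J p s powr lam) > 0" and colspos: "(\<Sum>t=1..J. col_marg I p t powr lam) > 0"
    using rows cols IJ by (intro sum_pos; force)+
  have cell: "((\<lambda>q. xlnx (q (i, j) powr lam / c_pow I J lam q)) \<longlongrightarrow> xlnx (p (i, j) powr lam / c_pow I J lam p)) ?L"
    if ij: "i \<in> {1..I}" "j \<in> {1..J}" for i j
  proof (cases "p (i, j) = 0")
    case True
    have "(i, j) \<in> cells I J" using ij by (simp add: cells_def)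
    from face_nhds_zero[where p = p, OF this True]
    have "\<forall>\<^sub>F q in ?L. xlnx (q (i, j) powr lam / c_pow I J lam q) = 0"
      by eventually_elim (simp add: xlnx_def)
    then show ?thesis using True by (simp add: xlnx_def tendsto_eventually)
  next
    case False
    then show ?thesis using cpos
      by (intro tendsto_xlnx tendsto_divide pw[OF ij] c) auto
  qed
  have "((\<lambda>q. T_A I J lam q) \<longlongrightarrow> T_A I J lam p) ?L"
    unfolding T_A_def
    by (intro tendsto_diff tendsto_sum cell tendsto_xlnx tendsto_divide rowp colp)
       (use rowspos colspos rows cols in \<open>auto intro!: divide_pos_pos simp: less_le\<close>)
  moreover have "((\<lambda>q. T_B I J lam q) \<longlongrightarrow> T_B I J lam p) ?L"
    unfolding T_B_def
    by (intro tendsto_diff tendsto_add tendsto_sum tendsto_xlnx tendsto_divide rowp colp pw c)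
       (use rowspos colspos rows cols cpos pos_row pos_col in \<open>auto intro!: divide_pos_pos simp: less_le\<close>)
  ultimately show ?thesis by (rule tendsto_add)
qed

section \<open>Non-vanishing of the variance at a distribution\<close>

text \<open>
  Weighting the common value \<open>v\<close> of the scores by the masses \<open>y k\<close> gives zero, because
  \<open>A / C\<close> is the escort mean of \<open>ln y\<close>. So \<open>v = 0\<close>, and every \<open>ln (y k)\<close> equals that mean.
\<close>

lemma entropy_score_constant:
  fixes y :: "'k \<Rightarrow> real"
  assumes K: "finite K" and y: "\<And>k. k \<in> K \<Longrightarrow> y k > 0"
    and C: "C = (\<Sum>k\<in>K. y k powr lam)" and A: "A = (\<Sum>k\<in>K. y k powr lam * ln (y k))"
    and const: "\<And>k l. k \<in> K \<Longrightarrow> l \<in> K \<Longrightarrow>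
      y k powr (lam - 1) * (C * ln (y k) - A) = y l powr (lam - 1) * (C * ln (y l) - A)"
  shows "uniform_on K y"
proof (cases "K = {}")
  case False
  then obtain k0 where k0: "k0 \<in> K" by blast
  have Cpos: "C > 0" unfolding C using K False y by (intro sum_pos) (auto simp: less_le)
  define v where "v = y k0 powr (lam - 1) * (C * ln (y k0) - A)"
  have v: "y k powr (lam - 1) * (C * ln (y k) - A) = v" if "k \<in> K" for k
    unfolding v_def using that k0 by (rule const)
  have "0 = (\<Sum>k\<in>K. y k powr lam * (C * ln (y k) - A))"
    by (simp add: right_diff_distrib sum_subtractf mult.left_commute[of _ C] flip: sum_distrib_left sum_distrib_right)
       (simp add: A C mult.commute)
  also have "\<dots> = (\<Sum>k\<in>K. y k * v)"
  proof (intro sum.cong refl)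
    fix k assume k: "k \<in> K"
    have "y k powr lam = y k * y k powr (lam - 1)" using y[OF k] by (simp add: powr_diff)
    then show "y k powr lam * (C * ln (y k) - A) = y k * v" using v[OF k] by simp
  qed
  also have "\<dots> = sum y K * v" by (simp add: sum_distrib_right)
  finally have "v = 0" using K False y sum_pos[of K y] by auto
  have "C * ln (y k) = A" if "k \<in> K" for k
    using v[OF that] y[OF that] \<open>v = 0\<close> by simp
  then have "ln (y k) = ln (y l)" if "k \<in> K" "l \<in> K" for k l
    using that Cpos by (metis less_irrefl mult_left_cancel)
  then show ?thesis unfolding uniform_on_def using y by (metis exp_ln)
qed (simp add: uniform_on_def)

text \<open>
  If every row contains only one cell, masses of cells and of rows agree, and the scores of the two
  entropies cancel in the influence function.
\<close>

lemma score_inj: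
  assumes "inj_on f S" "c \<in> S"
  shows "score lam S f q (f c) = score lam S id q c"
proof -
  have m: "marg S f q (f d) = marg S id q d" if "d \<in> S" for d
  proof -
    have "{c \<in> S. f c = f d} = {c \<in> S. id c = d}"
      using assms(1) that by (auto dest: inj_onD)
    then show ?thesis by (simp add: marg_def)
  qed
  have "pow_sum lam S f q = pow_sum lam S id q" "pow_ln_sum lam S f q = pow_ln_sum lam S id q"
    unfolding pow_sum_def pow_ln_sum_def by (simp_all add: sum.reindex[OF assms(1)] m)
  then show ?thesis using m[OF assms(2)] by (simp add: score_def score_num_def)
qed

lemma score_constant_imp_uniform:
  assumes S: "finite S" "S \<noteq> {}" and q: "\<And>c. c \<in> S \<Longrightarrow> q c > 0"
    and const: "\<And>c d. c \<in> S \<Longrightarrow> d \<in> S \<Longrightarrow> score lam S f q (f c) = score lam S f q (f d)"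
  shows "uniform_on (f ` S) (marg S f q)"
proof (rule entropy_score_constant[OF _ _ refl refl])
  have C: "pow_sum lam S f q > 0" using S q by (rule pow_sum_pos)
  fix k l assume kl: "k \<in> f ` S" "l \<in> f ` S"
  then have "score lam S f q k = score lam S f q l" using const by blast
  then have "score_num lam S f q k = score_num lam S f q l"
    using C by (simp add: score_def)
  then show "marg S f q k powr (lam - 1) * ((\<Sum>k\<in>f ` S. marg S f q k powr lam) * ln (marg S f q k)
        - (\<Sum>k\<in>f ` S. marg S f q k powr lam * ln (marg S f q k))) =
      marg S f q l powr (lam - 1) * ((\<Sum>k\<in>f ` S. marg S f q k powr lam) * ln (marg S f q l)
        - (\<Sum>k\<in>f ` S. marg S f q k powr lam * ln (marg S f q k)))"
    unfolding score_num_def pow_sum_def pow_ln_sum_def .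
next
  show "marg S f q k > 0" if "k \<in> f ` S" for k
    using S(1) q that by (rule marg_pos)
qed (use S in simp)

text \<open>
  With one cell per row the influence function is minus the score of the column entropy, and
  likewise with rows and columns exchanged. It separates two cells of \<open>S\<close> unless that marginal is
  uniform.
\<close>

lemma variance_pos_inj:
  assumes S: "finite S" "S \<noteq> {}" and q: "\<And>c. c \<in> S \<Longrightarrow> q c > 0"
    and "inj_on fst S \<and> \<not> uniform_on (snd ` S) (marg S snd q) \<or>
      inj_on snd S \<and> \<not> uniform_on (fst ` S) (marg S fst q)"
  shows "variance_on S q (influence lam S q) > 0"
proof -
  have "\<exists>c\<in>S. \<exists>d\<in>S. influence lam S q c \<noteq> influence lam S q d"
  proof (rule ccontr)
    assume "\<not> ?thesis"
    then have const: "influence lam S q c = influence lam S q d" if "c \<in> S" "d \<in> S" for c d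
      using that by blast
    from assms(4) show False
    proof
      assume A: "inj_on fst S \<and> \<not> uniform_on (snd ` S) (marg S snd q)"
      have "score lam S snd q (snd c) = - influence lam S q c" if "c \<in> S" for c
        using that A by (simp add: influence_def score_inj[of fst S c])
      then have "uniform_on (snd ` S) (marg S snd q)"
        using const by (intro score_constant_imp_uniform[OF S q, where lam = lam]) metis+
      with A show False by simp
    next
      assume A: "inj_on snd S \<and> \<not> uniform_on (fst ` S) (marg S fst q)"
      have "score lam S fst q (fst c) = - influence lam S q c" if "c \<in> S" for c
        using that A by (simp add: influence_def score_inj[of snd S c])
      then have "uniform_on (fst ` S) (marg S fst q)"
        using const by (intro score_constant_imp_uniform[OF S q, where lam = lam]) metis+
      with A show False by simp
    qed
  qed
  then obtain c d where "c \<in> S" "d \<in> S" "influence lam S q c \<noteq> influence lam S q d" by blast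
  then show ?thesis using q by (intro variance_on_pos[OF S(1), of q c d]) auto
qed

definition swap_dir :: "'c \<Rightarrow> 'c \<Rightarrow> 'c \<Rightarrow> real" where
  "swap_dir c d = (\<lambda>x. if x = c then 1 else if x = d then -1 else 0)"

text \<open>
  For two cells \<open>c\<close>, \<open>d\<close> in the same row the row scores cancel in \<open>influence c - influence d\<close>.
  \<open>row_slope\<close> is this difference, cleared of denominators.
\<close>

definition row_slope :: "real \<Rightarrow> ('a \<times> 'b) set \<Rightarrow> 'a \<times> 'b \<Rightarrow> 'a \<times> 'b \<Rightarrow> ('a \<times> 'b \<Rightarrow> real) \<Rightarrow> real" where
  "row_slope lam S c d q =
     (pow_sum lam S snd q)\<^sup>2 * (score_num lam S id q c - score_num lam S id q d) -
     (pow_sum lam S id q)\<^sup>2 * (score_num lam S snd q (snd c) - score_num lam S snd q (snd d))"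

lemma elementary_row_slope:
  assumes "c \<in> S" "d \<in> S"
  shows "row_slope lam S c d \<in> elementary (blocks S)"
  unfolding row_slope_def[abs_def] using assms
  by (intro elementary_diff elementary.mult elementary_power2 elementary_pow_sum elementary_score_num) auto

lemma variance_pos_row_slope:
  assumes S: "finite S" and q: "\<And>c. c \<in> S \<Longrightarrow> q c > 0"
    and cd: "c \<in> S" "d \<in> S" "fst c = fst d" "row_slope lam S c d q \<noteq> 0"
  shows "variance_on S q (influence lam S q) > 0"
proof (rule variance_on_pos[OF S q cd(1,2)])
  have "S \<noteq> {}" using cd by auto
  have pos: "pow_sum lam S f q > 0" for f :: "'a \<times> 'b \<Rightarrow> 'k"
    using S \<open>S \<noteq> {}\<close> q by (rule pow_sum_pos)
  have "row_slope lam S c d q = (pow_sum lam S snd q)\<^sup>2 * (pow_sum lam S id q)\<^sup>2 *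
      (influence lam S q c - influence lam S q d)"
    using pos[of id] pos[of snd] cd(3)
    by (simp add: row_slope_def influence_def score_def field_simps)
  with cd(4) show "influence lam S q c \<noteq> influence lam S q d" by auto
qed

section \<open>A logarithmic singularity on the line between two cells of a row\<close>

text \<open>
  At the origin an analytic function that does not vanish identically behaves like a power \<open>x ^ m\<close>.
  If \<open>m < \<beta>\<close>, this power dominates both other terms; if \<open>m \<ge> \<beta>\<close>, it disappears in the error term and
  \<open>\<kappa> x * ln x\<close> is bounded. In either case no logarithmic term with \<open>\<kappa>0 \<noteq> 0\<close> can be balanced.
\<close>

lemma no_log_term:
  fixes \<kappa> :: "real \<Rightarrow> real"
  assumes \<kappa>: "(\<kappa> \<longlongrightarrow> \<kappa>0) (at_right 0)" and f: "f analytic_on {0}"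
    and O: "(\<lambda>x. complex_of_real (\<kappa> x * x powr \<beta> * ln x) + f (complex_of_real x))
      \<in> O[at_right 0](\<lambda>x. complex_of_real (x powr \<beta>))"
  shows "\<kappa>0 = 0"
proof -
  have unit: "\<forall>\<^sub>F x::real in at_right 0. 0 < x \<and> x < 1"
    using eventually_at_right_real[of 0 1] by simp
  have ln0: "\<kappa>0 = 0" if *: "f \<circ> complex_of_real \<in> O[at_right 0](\<lambda>x. complex_of_real (x powr \<beta>))"
  proof -
    have "(\<lambda>x. complex_of_real (\<kappa> x * x powr \<beta> * ln x)) \<in> O[at_right 0](\<lambda>x. complex_of_real (x powr \<beta>))"
      using sum_in_bigo(2)[OF O *] by simp
    then obtain C where C: "C > 0" and
      1: "\<forall>\<^sub>F x in at_right 0. norm (complex_of_real (\<kappa> x * x powr \<beta> * ln x)) \<le> C * norm (complex_of_real (x powr \<beta>))"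
      by (rule landau_o.bigE)
    have ev: "\<forall>\<^sub>F x in at_right 0. \<bar>\<kappa> x\<bar> \<le> - C / ln x"
      using 1 unit
    proof eventually_elim
      case (elim x)
      have "x powr \<beta> > 0" "ln x < 0" using elim by auto
      moreover have "x powr \<beta> * (\<bar>\<kappa> x\<bar> * - ln x) \<le> x powr \<beta> * C"
        using elim(1) \<open>ln x < 0\<close> by (simp add: norm_mult abs_mult mult_ac)
      ultimately have "\<bar>\<kappa> x\<bar> * - ln x \<le> C"
        by (simp only: mult_le_cancel_left_pos)
      with \<open>ln x < 0\<close> show ?case by (simp add: field_simps)
    qed
    have lim: "((\<lambda>x::real. - C / ln x) \<longlongrightarrow> 0) (at_right 0)" by real_asymp
    have "((\<lambda>x. \<bar>\<kappa> x\<bar>) \<longlongrightarrow> 0) (at_right 0)"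
      by (rule tendsto_sandwich[OF _ ev tendsto_const lim]) auto
    then have "(\<kappa> \<longlongrightarrow> 0) (at_right 0)" by (simp add: tendsto_rabs_zero_iff)
    then show ?thesis using \<kappa> tendsto_unique trivial_limit_at_right_real by blast
  qed
  obtain r where r: "r > 0" "f holomorphic_on ball 0 r"
    using f by (auto simp: analytic_on_def)
  show ?thesis
  proof (cases "\<forall>z\<in>ball 0 r. f z = 0")
    case True
    have "\<forall>\<^sub>F x in at_right 0. (f \<circ> complex_of_real) x = 0"
      using eventually_at_right_real[OF r(1)] by eventually_elim (use True in auto)
    then show ?thesis
      by (intro ln0) (auto intro!: bigoI[where c = 1] elim!: eventually_mono)
  next
    case False
    obtain m g s where s: "0 < s" "g holomorphic_on ball 0 s" "g 0 \<noteq> 0"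
      "\<And>w. w \<in> ball 0 s \<Longrightarrow> f w = w ^ m * g w"
    proof (cases "f 0 = 0")
      case True
      have "\<not> f constant_on ball 0 r"
        using False True r(1) unfolding constant_on_def by force
      then show ?thesis
        using holomorphic_factor_zero_nonconstant[OF r(2) open_ball connected_ball, of 0] True r(1) that
        by (metis centre_in_ball diff_zero)
    next
      case False
      then show ?thesis using that[of r f 0] r by simp
    qed
    have "isCont g 0"
      using s(1,2) holomorphic_on_imp_continuous_on continuous_on_interior by fastforce
    then have "(g \<longlongrightarrow> g 0) (nhds 0)"
      by (simp add: isCont_def tendsto_nhds_iff)
    moreover have "filterlim complex_of_real (nhds 0) (at_right 0)"
      by (auto intro!: tendsto_eq_intros)
    ultimately have g: "((\<lambda>x. g (complex_of_real x)) \<longlongrightarrow> g 0) (at_right 0)"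
      by (rule filterlim_compose)
    have fg: "\<forall>\<^sub>F x in at_right 0. norm (f (complex_of_real x)) = x powr m * norm (g (complex_of_real x))"
      using eventually_at_right_real[OF s(1)]
      by eventually_elim (use s(4) in \<open>auto simp: norm_mult norm_power powr_realpow\<close>)
    show ?thesis
    proof (cases "real m < \<beta>")
      case True
      obtain C where C: "C > 0" and
        1: "\<forall>\<^sub>F x in at_right 0. norm (complex_of_real (\<kappa> x * x powr \<beta> * ln x) + f (complex_of_real x))
          \<le> C * norm (complex_of_real (x powr \<beta>))"
        using landau_o.bigE[OF O] by blast
      define \<delta> where "\<delta> = \<beta> - m"
      have ev: "\<forall>\<^sub>F x in at_right 0. norm (g (complex_of_real x)) \<le>
          C * x powr \<delta> + \<bar>\<kappa> x\<bar> * (x powr \<delta> * - ln x)"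
        using 1 fg unit
      proof eventually_elim
        case (elim x)
        have \<beta>: "x powr \<beta> = x powr m * x powr \<delta>"
          by (simp add: \<delta>_def flip: powr_add)
        have "x powr m * norm (g (complex_of_real x)) \<le>
            norm (complex_of_real (\<kappa> x * x powr \<beta> * ln x) + f (complex_of_real x))
            + norm (complex_of_real (\<kappa> x * x powr \<beta> * ln x))"
          using elim(2) norm_triangle_ineq4[of "complex_of_real (\<kappa> x * x powr \<beta> * ln x) + f (complex_of_real x)"
            "complex_of_real (\<kappa> x * x powr \<beta> * ln x)"] by simp
        also have "\<dots> \<le> C * x powr \<beta> + \<bar>\<kappa> x\<bar> * x powr \<beta> * - ln x"
          using elim(1,3) by (simp add: norm_mult abs_mult)
        also have "\<dots> = x powr m * (C * x powr \<delta> + \<bar>\<kappa> x\<bar> * (x powr \<delta> * - ln x))"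
          unfolding \<beta> by (simp add: algebra_simps)
        finally show ?case
          using elim(3) by (subst (asm) mult_le_cancel_left_pos) auto
      qed
      have "\<delta> > 0" using True by (simp add: \<delta>_def)
      then have "((\<lambda>x::real. x powr \<delta>) \<longlongrightarrow> 0) (at_right 0)"
        "((\<lambda>x::real. x powr \<delta> * - ln x) \<longlongrightarrow> 0) (at_right 0)" by real_asymp+
      then have "((\<lambda>x. C * x powr \<delta> + \<bar>\<kappa> x\<bar> * (x powr \<delta> * - ln x)) \<longlongrightarrow> C * 0 + \<bar>\<kappa>0\<bar> * 0) (at_right 0)"
        by (intro tendsto_intros \<kappa>)
      then have "((\<lambda>x. norm (g (complex_of_real x))) \<longlongrightarrow> 0) (at_right 0)"
        by (intro tendsto_sandwich[OF _ ev tendsto_const]) simp_all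
      then have "norm (g 0) = 0"
        using tendsto_norm[OF g] tendsto_unique trivial_limit_at_right_real by blast
      with s(3) show ?thesis by simp
    next
      case False
      have "\<forall>\<^sub>F x in at_right 0. norm (g (complex_of_real x)) < norm (g 0) + 1"
        by (intro order_tendstoD(2)[OF tendsto_norm[OF g]]) simp
      then have "\<forall>\<^sub>F x in at_right 0. norm ((f \<circ> complex_of_real) x) \<le> (norm (g 0) + 1) * norm (complex_of_real (x powr \<beta>))"
        using fg unit
      proof eventually_elim
        case (elim x)
        have "x powr m \<le> x powr \<beta>" using False elim by (intro powr_mono') auto
        then have "x powr m * norm (g (complex_of_real x)) \<le> x powr \<beta> * (norm (g 0) + 1)"
          using elim by (intro mult_mono) auto
        then show ?case using elim by (simp add: mult.commute)
      qed
      then show ?thesis by (intro ln0 bigoI)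
    qed
  qed
qed

lemma powr_minus_id:
  fixes u :: real
  assumes "0 \<le> u" "u \<le> 1"
  shows "(1 - lam) * (u powr lam - u) \<ge> 0"
    and "lam \<noteq> 1 \<Longrightarrow> 0 < u \<Longrightarrow> u < 1 \<Longrightarrow> (1 - lam) * (u powr lam - u) > 0"
proof -
  have *: "(1 - lam) * (u powr lam - u) > 0" if "lam \<noteq> 1" "0 < u" "u < 1"
  proof (cases "lam < 1")
    case True
    then have "u powr 1 < u powr lam" using that by (intro powr_less_mono') auto
    then show ?thesis using True that by simp
  next
    case False
    then have "u powr lam < u powr 1" using that by (intro powr_less_mono') auto
    then show ?thesis using False that by (simp add: mult_neg_neg)
  qed
  then show "lam \<noteq> 1 \<Longrightarrow> 0 < u \<Longrightarrow> u < 1 \<Longrightarrow> (1 - lam) * (u powr lam - u) > 0" .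
  show "(1 - lam) * (u powr lam - u) \<ge> 0"
    using * assms by (cases "u = 0 \<or> u = 1 \<or> lam = 1") (auto simp: less_le)
qed

text \<open>
  Strict subadditivity (\<open>lam < 1\<close>) or superadditivity (\<open>lam > 1\<close>) of \<open>x powr lam\<close>; the factor
  \<open>1 - lam\<close> treats both cases at once. After division by the total mass all arguments lie in \<open>[0, 1]\<close>.
\<close>

lemma power_sum_defect:
  fixes q :: "'c \<Rightarrow> real"
  assumes B: "finite B" and nn: "\<And>c. c \<in> B \<Longrightarrow> q c \<ge> 0"
  shows "(1 - lam) * ((\<Sum>c\<in>B. q c powr lam) - sum q B powr lam) \<ge> 0"
    and "lam \<noteq> 1 \<Longrightarrow> c \<in> B \<Longrightarrow> d \<in> B \<Longrightarrow> c \<noteq> d \<Longrightarrow> q c > 0 \<Longrightarrow> q d > 0 \<Longrightarrow>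
      (1 - lam) * ((\<Sum>c\<in>B. q c powr lam) - sum q B powr lam) > 0"
proof -
  define s where "s = sum q B"
  have s0: "s \<ge> 0" using nn by (simp add: s_def sum_nonneg)
  have le: "q c \<le> s" if "c \<in> B" for c
    unfolding s_def using B nn that by (intro member_le_sum) auto
  have eq: "(1 - lam) * ((\<Sum>c\<in>B. q c powr lam) - s powr lam) =
      s powr lam * (\<Sum>c\<in>B. (1 - lam) * ((q c / s) powr lam - q c / s))" if s: "s > 0"
  proof -
    have "(\<Sum>c\<in>B. (q c / s) powr lam) = (\<Sum>c\<in>B. q c powr lam) / s powr lam"
      using nn s by (simp add: powr_divide sum_divide_distrib)
    moreover have "(\<Sum>c\<in>B. q c / s) = 1" using s by (simp add: s_def flip: sum_divide_distrib)
    ultimately have "(\<Sum>c\<in>B. (1 - lam) * ((q c / s) powr lam - q c / s)) =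
        (1 - lam) * ((\<Sum>c\<in>B. q c powr lam) / s powr lam - 1)"
      by (simp add: sum_subtractf flip: sum_distrib_left)
    moreover have "s powr lam > 0" using s by simp
    ultimately show ?thesis by (simp add: field_simps)
  qed
  have defect: "(1 - lam) * ((q c / s) powr lam - q c / s) \<ge> 0" if "c \<in> B" "s > 0" for c
    using nn le that by (intro powr_minus_id(1)) auto
  show "(1 - lam) * ((\<Sum>c\<in>B. q c powr lam) - sum q B powr lam) \<ge> 0"
  proof (cases "s > 0")
    case True
    show ?thesis
      unfolding s_def[symmetric] eq[OF True]
      by (intro mult_nonneg_nonneg sum_nonneg defect True) auto
  next
    case False
    then have "s = 0" using s0 by simp
    then have "q c = 0" if "c \<in> B" for c using le nn that by (metis order_antisym)
    then show ?thesis using \<open>s = 0\<close> by (simp add: s_def)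
  qed
  assume lam: "lam \<noteq> 1" and c: "c \<in> B" "d \<in> B" "c \<noteq> d" "q c > 0" "q d > 0"
  have "q c + q d = sum q {c, d}" using c by simp
  also have "\<dots> \<le> s" unfolding s_def using B nn c by (intro sum_mono2) auto
  finally have s: "q c < s" "s > 0" using c by auto
  have "(1 - lam) * ((q c / s) powr lam - q c / s) > 0"
    using s c lam by (intro powr_minus_id(2)) auto
  then show "(1 - lam) * ((\<Sum>c\<in>B. q c powr lam) - sum q B powr lam) > 0"
    unfolding s_def[symmetric] eq[OF s(2)] using s B c(1) defect
    by (intro mult_pos_pos[of "s powr lam"] sum_pos2[of B c]) simp_all
qed

text \<open>
  Merging masses into fibres changes the power sum in the same direction in every fibre, strictly
  in a fibre with two positive masses.
\<close>

lemma pow_sum_fibres_neq: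
  fixes q :: "'c \<Rightarrow> real"
  assumes S: "finite S" and nn: "\<And>c. c \<in> S \<Longrightarrow> q c \<ge> 0" and lam: "lam \<noteq> 1"
    and c: "c \<in> S" "d \<in> S" "c \<noteq> d" "f c = f d" "q c > 0" "q d > 0"
  shows "pow_sum lam S f q \<noteq> pow_sum lam S id q"
proof -
  let ?g = "\<lambda>k. (1 - lam) * ((\<Sum>c\<in>{c \<in> S. f c = k}. q c powr lam) - marg S f q k powr lam)"
  have m: "marg S id q c = q c" if "c \<in> S" for c
  proof -
    have "{d \<in> S. d = c} = {c}" using that by auto
    then show ?thesis by (simp add: marg_def)
  qed
  have "pow_sum lam S id q = (\<Sum>c\<in>S. q c powr lam)" by (simp add: pow_sum_def m)
  also have "\<dots> = (\<Sum>k\<in>f ` S. \<Sum>c\<in>{c \<in> S. f c = k}. q c powr lam)"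
    using S by (intro sum.group[symmetric]) auto
  finally have "(1 - lam) * (pow_sum lam S id q - pow_sum lam S f q) = (\<Sum>k\<in>f ` S. ?g k)"
    unfolding pow_sum_def[of lam S f] by (simp add: sum_subtractf flip: sum_distrib_left)
  also have "\<dots> > 0"
  proof (rule sum_pos2[of _ "f c"])
    show "?g (f c) > 0"
      unfolding marg_def using S nn c lam by (intro power_sum_defect(2)[of _ _ lam c d]) auto
    show "?g k \<ge> 0" if "k \<in> f ` S" for k
      unfolding marg_def using S nn by (intro power_sum_defect(1)) auto
  qed (use S c in auto)
  finally show ?thesis by auto
qed

text \<open>
  Functions on the right of the origin that are analytic up to an error \<open>O(x powr \<beta>)\<close>. With
  \<open>\<beta> = lam - 1\<close> this absorbs \<open>x powr lam\<close> and \<open>x powr lam * ln x\<close>, so the power sums become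
  analytic and only the isolated factor \<open>x powr (lam - 1) * ln x\<close> remains visible.
\<close>

definition analytic_mod :: "real \<Rightarrow> (real \<Rightarrow> real) \<Rightarrow> bool" where
  "analytic_mod \<beta> g \<longleftrightarrow> (\<exists>f. f analytic_on {0} \<and>
     (\<lambda>x. complex_of_real (g x) - f (complex_of_real x)) \<in> O[at_right 0](\<lambda>x. complex_of_real (x powr \<beta>)))"

lemma analytic_bigo_1:
  assumes "f analytic_on {0}"
  shows "(\<lambda>x. f (complex_of_real x)) \<in> O[at_right 0](\<lambda>_. 1)"
proof -
  have "isCont f 0" using analytic_at_imp_isCont[OF assms] .
  then have "(f \<longlongrightarrow> f 0) (nhds 0)" by (simp add: isCont_def tendsto_nhds_iff)
  moreover have "filterlim complex_of_real (nhds 0) (at_right 0)"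
    by (auto intro!: tendsto_eq_intros)
  ultimately have "((\<lambda>x. f (complex_of_real x)) \<longlongrightarrow> f 0) (at_right 0)"
    by (rule filterlim_compose)
  then show ?thesis by (intro bigoI_tendsto[of _ _ "f 0"]) auto
qed

lemma analytic_mod_add: "analytic_mod \<beta> g \<Longrightarrow> analytic_mod \<beta> h \<Longrightarrow> analytic_mod \<beta> (\<lambda>x. g x + h x)"
  unfolding analytic_mod_def
proof (elim exE conjE)
  fix u v
  assume "u analytic_on {0}" "v analytic_on {0}" and
    *: "(\<lambda>x. complex_of_real (g x) - u (complex_of_real x)) \<in> O[at_right 0](\<lambda>x. complex_of_real (x powr \<beta>))"
    "(\<lambda>x. complex_of_real (h x) - v (complex_of_real x)) \<in> O[at_right 0](\<lambda>x. complex_of_real (x powr \<beta>))"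
  then show "\<exists>f. f analytic_on {0} \<and>
     (\<lambda>x. complex_of_real (g x + h x) - f (complex_of_real x)) \<in> O[at_right 0](\<lambda>x. complex_of_real (x powr \<beta>))"
    using sum_in_bigo(1)[OF *]
    by (intro exI[of _ "\<lambda>z. u z + v z"]) (auto intro!: analytic_intros simp: algebra_simps)
qed

lemma analytic_mod_mult:
  assumes "analytic_mod \<beta> g" "analytic_mod \<beta> h" "g \<in> O[at_right 0](\<lambda>_. 1)" "h \<in> O[at_right 0](\<lambda>_. 1)"
  shows "analytic_mod \<beta> (\<lambda>x. g x * h x)"
proof -
  obtain u v where u: "u analytic_on {0}" "(\<lambda>x. complex_of_real (g x) - u (complex_of_real x)) \<in> O[at_right 0](\<lambda>x. complex_of_real (x powr \<beta>))"
    and v: "v analytic_on {0}" "(\<lambda>x. complex_of_real (h x) - v (complex_of_real x)) \<in> O[at_right 0](\<lambda>x. complex_of_real (x powr \<beta>))"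
    using assms unfolding analytic_mod_def by blast
  have h: "(\<lambda>x. complex_of_real (h x)) \<in> O[at_right 0](\<lambda>_. 1)"
    using assms(4) landau_o.big.of_real_iff[of h "at_right 0" "\<lambda>_. 1"] by simp
  have "(\<lambda>x. (complex_of_real (g x) - u (complex_of_real x)) * complex_of_real (h x) +
      u (complex_of_real x) * (complex_of_real (h x) - v (complex_of_real x))) \<in> O[at_right 0](\<lambda>x. complex_of_real (x powr \<beta>))"
    using landau_o.big.mult[OF u(2) h] landau_o.big.mult[OF analytic_bigo_1[OF u(1)] v(2)]
    by (intro sum_in_bigo) simp_all
  then show ?thesis
    unfolding analytic_mod_def using u(1) v(1)
    by (intro exI[of _ "\<lambda>z. u z * v z"]) (auto intro!: analytic_intros simp: algebra_simps)
qed

lemma analytic_mod_bigo: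
  assumes "g \<in> O[at_right 0](\<lambda>x. x powr \<beta>)"
  shows "analytic_mod \<beta> g"
  unfolding analytic_mod_def
proof (intro exI conjI)
  show "(\<lambda>x. complex_of_real (g x) - 0) \<in> O[at_right 0](\<lambda>x. complex_of_real (x powr \<beta>))"
    using assms by (simp only: diff_0_right landau_o.big.of_real_iff)
qed auto

lemma analytic_mod_analytic:
  assumes "f analytic_on {0}" "\<forall>\<^sub>F x in at_right 0. f (complex_of_real x) = complex_of_real (g x)"
  shows "analytic_mod \<beta> g"
  unfolding analytic_mod_def
  using assms by (intro exI[of _ f] conjI) (auto intro!: bigoI[where c = 1] elim!: eventually_mono)

lemma analytic_mod_const: "analytic_mod \<beta> (\<lambda>_. r)"
  by (rule analytic_mod_analytic[of "\<lambda>_. complex_of_real r"]) auto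

lemma linear_pos_near_0:
  fixes a b :: real
  assumes "a > 0"
  shows "\<forall>\<^sub>F x in at_right 0. a + x * b > 0"
proof -
  have "((\<lambda>x. a + x * b) \<longlongrightarrow> a + 0 * b) (at_right 0)" by (intro tendsto_intros)
  with assms show ?thesis by (intro order_tendstoD(1)) auto
qed

lemma analytic_mod_linear:
  assumes a: "a > 0"
  shows "analytic_mod \<beta> (\<lambda>x. (a + x * b) powr \<gamma>)" "analytic_mod \<beta> (\<lambda>x. ln (a + x * b))"
    "(\<lambda>x. (a + x * b) powr \<gamma>) \<in> O[at_right 0](\<lambda>_. 1)" "(\<lambda>x. ln (a + x * b)) \<in> O[at_right 0](\<lambda>_. 1)"
proof -
  let ?l = "\<lambda>z. complex_of_real a + z * complex_of_real b"
  have an: "(\<lambda>z. Ln (?l z)) analytic_on {0}"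
    using a by (intro analytic_intros) (auto simp: complex_nonpos_Reals_iff)
  have eq: "Ln (?l (complex_of_real x)) = complex_of_real (ln (a + x * b))" if "a + x * b > 0" for x
    using Ln_of_real[OF that] by simp
  show "analytic_mod \<beta> (\<lambda>x. ln (a + x * b))"
    by (rule analytic_mod_analytic[OF an]) (use linear_pos_near_0[OF a, of b] eq in \<open>auto elim: eventually_mono\<close>)
  show "analytic_mod \<beta> (\<lambda>x. (a + x * b) powr \<gamma>)"
  proof (rule analytic_mod_analytic)
    show "(\<lambda>z. exp (complex_of_real \<gamma> * Ln (?l z))) analytic_on {0}"
      by (intro analytic_intros an)
    show "\<forall>\<^sub>F x in at_right 0. exp (complex_of_real \<gamma> * Ln (?l (complex_of_real x))) = complex_of_real ((a + x * b) powr \<gamma>)"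
      using linear_pos_near_0[OF a, of b]
    proof eventually_elim
      case (elim x)
      have "exp (complex_of_real \<gamma> * Ln (?l (complex_of_real x))) = exp (complex_of_real (\<gamma> * ln (a + x * b)))"
        by (simp only: eq[OF elim] of_real_mult)
      also have "\<dots> = complex_of_real ((a + x * b) powr \<gamma>)"
        using elim by (subst exp_of_real) (simp add: powr_def)
      finally show ?case .
    qed
  qed
  have lim: "((\<lambda>x. a + x * b) \<longlongrightarrow> a) (at_right 0)" by (auto intro!: tendsto_eq_intros)
  have "((\<lambda>x. (a + x * b) powr \<gamma>) \<longlongrightarrow> a powr \<gamma>) (at_right 0)"
    using a by (intro tendsto_powr lim tendsto_const) auto
  then show "(\<lambda>x. (a + x * b) powr \<gamma>) \<in> O[at_right 0](\<lambda>_. 1)"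
    by (intro bigoI_tendsto[of _ _ "a powr \<gamma>"]) auto
  have "((\<lambda>x. ln (a + x * b)) \<longlongrightarrow> ln a) (at_right 0)"
    using a by (intro tendsto_ln lim) auto
  then show "(\<lambda>x. ln (a + x * b)) \<in> O[at_right 0](\<lambda>_. 1)"
    by (intro bigoI_tendsto[of _ _ "ln a"]) auto
qed

lemma analytic_mod_powr:
  assumes "lam > 0"
  shows "analytic_mod (lam - 1) (\<lambda>x. x powr lam)" "analytic_mod (lam - 1) (\<lambda>x. x powr lam * ln x)"
    "(\<lambda>x. x powr lam) \<in> O[at_right 0](\<lambda>_. 1::real)" "(\<lambda>x. x powr lam * ln x) \<in> O[at_right 0](\<lambda>_. 1::real)"
proof -
  have "(\<lambda>x. x powr lam) \<in> O[at_right 0](\<lambda>x::real. x powr (lam - 1))"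
    "(\<lambda>x. x powr lam * ln x) \<in> O[at_right 0](\<lambda>x::real. x powr (lam - 1))"
    using assms by real_asymp+
  then show "analytic_mod (lam - 1) (\<lambda>x. x powr lam)" "analytic_mod (lam - 1) (\<lambda>x. x powr lam * ln x)"
    by (auto intro: analytic_mod_bigo)
  show "(\<lambda>x. x powr lam) \<in> O[at_right 0](\<lambda>_. 1::real)" "(\<lambda>x. x powr lam * ln x) \<in> O[at_right 0](\<lambda>_. 1::real)"
    using assms by real_asymp+
qed

text \<open>
  Boundedness is needed for products, and does not follow from analyticity up to \<open>O(x powr \<beta>)\<close> when
  \<open>\<beta> < 0\<close>.
\<close>

definition bounded_analytic_mod :: "real \<Rightarrow> (real \<Rightarrow> real) \<Rightarrow> bool" where
  "bounded_analytic_mod \<beta> g \<longleftrightarrow> analytic_mod \<beta> g \<and> g \<in> O[at_right 0](\<lambda>_. 1)"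

lemma bounded_analytic_mod_add: "bounded_analytic_mod \<beta> g \<Longrightarrow> bounded_analytic_mod \<beta> h \<Longrightarrow> bounded_analytic_mod \<beta> (\<lambda>x. g x + h x)"
  by (auto simp: bounded_analytic_mod_def intro: analytic_mod_add sum_in_bigo)

lemma bounded_analytic_mod_mult: "bounded_analytic_mod \<beta> g \<Longrightarrow> bounded_analytic_mod \<beta> h \<Longrightarrow> bounded_analytic_mod \<beta> (\<lambda>x. g x * h x)"
  using landau_o.big.mult[of g "at_right 0" "\<lambda>_. 1" h "\<lambda>_. 1"]
  by (auto simp: bounded_analytic_mod_def intro: analytic_mod_mult)

lemma bounded_analytic_mod_const: "bounded_analytic_mod \<beta> (\<lambda>_. r)"
  by (auto simp: bounded_analytic_mod_def intro: analytic_mod_const)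

lemma bounded_analytic_mod_minus: "bounded_analytic_mod \<beta> g \<Longrightarrow> bounded_analytic_mod \<beta> (\<lambda>x. - g x)"
  using bounded_analytic_mod_mult[OF bounded_analytic_mod_const[of \<beta> "-1"], of g] by simp

lemma bounded_analytic_mod_diff: "bounded_analytic_mod \<beta> g \<Longrightarrow> bounded_analytic_mod \<beta> h \<Longrightarrow> bounded_analytic_mod \<beta> (\<lambda>x. g x - h x)"
  using bounded_analytic_mod_add[OF _ bounded_analytic_mod_minus] by fastforce

lemma bounded_analytic_mod_sum:
  "(\<And>k. k \<in> K \<Longrightarrow> bounded_analytic_mod \<beta> (g k)) \<Longrightarrow> bounded_analytic_mod \<beta> (\<lambda>x. \<Sum>k\<in>K. g k x)"
  by (induction K rule: infinite_finite_induct) (auto intro: bounded_analytic_mod_const bounded_analytic_mod_add)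

lemma bounded_times_powr:
  assumes "g \<in> O[at_right 0](\<lambda>_. 1)"
  shows "analytic_mod \<beta> (\<lambda>x. g x * x powr \<beta>)"
  using landau_o.big.mult[OF assms landau_o.big_refl] by (intro analytic_mod_bigo) simp

text \<open>
  The cells \<open>c\<close>, \<open>d\<close> lie in the same row, and \<open>q0\<close> is the end of the line at which all mass of \<open>c\<close> has
  been moved to \<open>d\<close>. The parameter \<open>x\<close> is the mass given back to \<open>c\<close>.
\<close>

context
  fixes S :: "('a \<times> 'b) set" and p q0 :: "'a \<times> 'b \<Rightarrow> real" and c d :: "'a \<times> 'b" and lam :: real
    and e :: "'a \<times> 'b \<Rightarrow> real"
  assumes S: "finite S" and p: "\<And>x. x \<in> S \<Longrightarrow> p x > 0" and lam: "lam > 0" "lam \<noteq> 1"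
    and c: "c \<in> S" and d: "d \<in> S" and cd: "c \<noteq> d" "fst c = fst d"
  defines "q0 \<equiv> p(c := 0, d := p c + p d)"
    and "e \<equiv> swap_dir c d"
begin

lemma drained_nonneg: "x \<in> S \<Longrightarrow> q0 x \<ge> 0"
  using p c d by (auto simp: q0_def less_imp_le add_nonneg_nonneg)

lemma drained_pos: "x \<in> S \<Longrightarrow> x \<noteq> c \<Longrightarrow> q0 x > 0"
  using p c d by (auto simp: q0_def add_pos_pos)

lemma drained_block_pos: "B \<in> blocks S \<Longrightarrow> B \<noteq> {c} \<Longrightarrow> sum q0 B > 0"
proof -
  assume B: "B \<in> blocks S" "B \<noteq> {c}"
  then obtain x where "x \<in> B" "x \<noteq> c" by (auto simp: blocks_def)
  moreover have "B \<subseteq> S" using B by (simp add: blocks_def)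
  ultimately show "sum q0 B > 0"
    using finite_subset[OF _ S] drained_nonneg drained_pos by (intro sum_pos2[of B x]) blast+
qed

lemma mass_drained_cell: "sum (shift q0 x e) {c} = x"
  using cd by (simp add: shift_def q0_def e_def swap_dir_def)

lemma bounded_analytic_mod_block:
  assumes B: "B \<in> blocks S"
  shows "bounded_analytic_mod (lam - 1) (\<lambda>x. sum (shift q0 x e) B powr lam)"
    "bounded_analytic_mod (lam - 1) (\<lambda>x. sum (shift q0 x e) B powr lam * ln (sum (shift q0 x e) B))"
proof -
  have "bounded_analytic_mod (lam - 1) (\<lambda>x. sum (shift q0 x e) B powr lam) \<and>
    bounded_analytic_mod (lam - 1) (\<lambda>x. sum (shift q0 x e) B powr lam * ln (sum (shift q0 x e) B))"
  proof (cases "B = {c}")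
    case True
    show ?thesis unfolding True mass_drained_cell using analytic_mod_powr[OF lam(1)] by (simp add: bounded_analytic_mod_def)
  next
    case False
    note pos = drained_block_pos[OF B this]
    show ?thesis unfolding sum_shift
      by (intro conjI bounded_analytic_mod_mult) (simp_all add: bounded_analytic_mod_def analytic_mod_linear[OF pos])
  qed
  then show "bounded_analytic_mod (lam - 1) (\<lambda>x. sum (shift q0 x e) B powr lam)"
    "bounded_analytic_mod (lam - 1) (\<lambda>x. sum (shift q0 x e) B powr lam * ln (sum (shift q0 x e) B))" by auto
qed

lemma bounded_analytic_mod_pow_sum: "bounded_analytic_mod (lam - 1) (\<lambda>x. pow_sum lam S f (shift q0 x e))"
  unfolding pow_sum_def marg_def by (intro bounded_analytic_mod_sum bounded_analytic_mod_block) (auto simp: blocks_def)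

lemma bounded_analytic_mod_pow_ln_sum: "bounded_analytic_mod (lam - 1) (\<lambda>x. pow_ln_sum lam S f (shift q0 x e))"
  unfolding pow_ln_sum_def marg_def by (intro bounded_analytic_mod_sum bounded_analytic_mod_block) (auto simp: blocks_def)

lemma bounded_analytic_mod_score_num:
  assumes "k \<in> f ` S" "{x \<in> S. f x = k} \<noteq> {c}"
  shows "bounded_analytic_mod (lam - 1) (\<lambda>x. score_num lam S f (shift q0 x e) k)"
proof -
  have "sum q0 {x \<in> S. f x = k} > 0" using assms by (intro drained_block_pos) (auto simp: blocks_def)
  from analytic_mod_linear[OF this] show ?thesis
    unfolding score_num_def marg_def sum_shift
    by (intro bounded_analytic_mod_mult bounded_analytic_mod_diff bounded_analytic_mod_pow_sum bounded_analytic_mod_pow_ln_sum)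
       (simp_all add: bounded_analytic_mod_def)
qed

lemma score_num_drained_cell:
  assumes "{x \<in> S. f x = k} = {c}"
  shows "score_num lam S f (shift q0 x e) k =
    x powr (lam - 1) * (pow_sum lam S f (shift q0 x e) * ln x - pow_ln_sum lam S f (shift q0 x e))"
  unfolding score_num_def marg_def assms mass_drained_cell ..

lemma tendsto_pow_sum_drained:
  "((\<lambda>x. pow_sum lam S f (shift q0 x e)) \<longlongrightarrow> pow_sum lam S f q0) (at_right 0)"
  unfolding pow_sum_def
proof (intro tendsto_sum tendsto_powr2 tendsto_const lam(1))
  fix k assume k: "k \<in> f ` S"
  have "((\<lambda>x. marg S f q0 k + x * marg S f e k) \<longlongrightarrow> marg S f q0 k + 0 * marg S f e k) (at_right 0)"
    by (intro tendsto_intros)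
  then show "((\<lambda>x. marg S f (shift q0 x e) k) \<longlongrightarrow> marg S f q0 k) (at_right 0)"
    by (simp add: marg_shift)
  show "\<forall>\<^sub>F x in at_right 0. 0 \<le> marg S f (shift q0 x e) k"
  proof (cases "{x \<in> S. f x = k} = {c}")
    case True
    show ?thesis unfolding marg_def True mass_drained_cell
      using eventually_at_right_less[of "0::real"] by (rule eventually_mono) simp
  next
    case False
    with k have "sum q0 {x \<in> S. f x = k} > 0" by (intro drained_block_pos) (auto simp: blocks_def)
    from linear_pos_near_0[OF this] show ?thesis
      unfolding marg_def sum_shift by (rule eventually_mono) (auto intro: less_imp_le)
  qed
qed

lemma pow_sum_drained_pos: "pow_sum lam S f q0 > 0"
  unfolding pow_sum_def
proof (rule sum_pos2)
  have "marg S f q0 (f d) > 0"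
    unfolding marg_def
  proof (rule drained_block_pos)
    show "{x \<in> S. f x = f d} \<in> blocks S" unfolding blocks_def using d by blast
    show "{x \<in> S. f x = f d} \<noteq> {c}" using d cd(1) by (metis (mono_tags, lifting) CollectI singletonD)
  qed
  then show "marg S f q0 (f d) powr lam > 0" by simp
qed (use S d in auto)

text \<open>
  The score of the cell \<open>c\<close> contributes \<open>x powr (lam - 1) * ln x\<close> with coefficient \<open>D\<^sup>2 * C\<close>, where \<open>C\<close>
  and \<open>D\<close> are the power sums of the cells and of the columns. If \<open>c\<close> is the only cell of its column,
  the column score contributes \<open>- C\<^sup>2 * D\<close> as well, and the total \<open>C * D * (D - C)\<close> is nonzero since
  another column, with two cells, separates \<open>C\<close> from \<open>D\<close>.
\<close>

lemma row_slope_nonzero_near_0: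
  assumes col: "\<not> inj_on snd S"
  shows "\<not> (\<forall>\<^sub>F x in at_right 0. row_slope lam S c d (shift q0 x e) = 0)"
proof
  assume zero: "\<forall>\<^sub>F x in at_right 0. row_slope lam S c d (shift q0 x e) = 0"
  \<comment> \<open>whether \<open>c\<close> is the only cell of its column\<close>
  define alone where "alone \<longleftrightarrow> {x \<in> S. snd x = snd c} = {c}"
  let ?Q = "\<lambda>x. shift q0 x e"
  let ?C = "\<lambda>x. pow_sum lam S id (?Q x)" and ?D = "\<lambda>x. pow_sum lam S snd (?Q x)"
  let ?A = "\<lambda>x. pow_ln_sum lam S id (?Q x)" and ?E = "\<lambda>x. pow_ln_sum lam S snd (?Q x)"
  let ?sn = "\<lambda>x. score_num lam S snd (?Q x) (snd c)"
  define \<kappa> where "\<kappa> x = (?D x)\<^sup>2 * ?C x - (if alone then (?C x)\<^sup>2 * ?D x else 0)" for x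
  define r where "r x = - ((?D x)\<^sup>2 * ?A x) * x powr (lam - 1) - (?D x)\<^sup>2 * score_num lam S id (?Q x) d
    + (if alone then (?C x)\<^sup>2 * ?E x * x powr (lam - 1) else - ((?C x)\<^sup>2 * ?sn x))
    + (?C x)\<^sup>2 * score_num lam S snd (?Q x) (snd d)" for x
  have idc: "{x \<in> S. id x = c} = {c}" using c by auto
  have split: "row_slope lam S c d (?Q x) = \<kappa> x * x powr (lam - 1) * ln x + r x" for x
    unfolding row_slope_def \<kappa>_def r_def score_num_drained_cell[OF idc]
    by (cases alone) (simp_all add: alone_def score_num_drained_cell algebra_simps)
  have reg: "analytic_mod (lam - 1) r"
  proof -
    have "snd c \<noteq> snd d" using cd by (auto simp: prod_eq_iff)
    then have sd: "bounded_analytic_mod (lam - 1) (\<lambda>x. score_num lam S id (?Q x) d)"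
      "bounded_analytic_mod (lam - 1) (\<lambda>x. score_num lam S snd (?Q x) (snd d))"
      using cd d by (intro bounded_analytic_mod_score_num; force)+
    have b: "bounded_analytic_mod (lam - 1) ?C" "bounded_analytic_mod (lam - 1) ?D" "bounded_analytic_mod (lam - 1) ?A" "bounded_analytic_mod (lam - 1) ?E"
      by (rule bounded_analytic_mod_pow_sum bounded_analytic_mod_pow_ln_sum)+
    note sq = bounded_analytic_mod_mult[OF b(1,1)] bounded_analytic_mod_mult[OF b(2,2)]
    have 1: "analytic_mod (lam - 1) (\<lambda>x. - ((?D x)\<^sup>2 * ?A x) * x powr (lam - 1))"
      using bounded_analytic_mod_minus[OF bounded_analytic_mod_mult[OF sq(2) b(3)]]
      by (intro bounded_times_powr) (simp add: bounded_analytic_mod_def power2_eq_square)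
    have 2: "analytic_mod (lam - 1) (\<lambda>x. - ((?D x)\<^sup>2 * score_num lam S id (?Q x) d))"
      using bounded_analytic_mod_minus[OF bounded_analytic_mod_mult[OF sq(2) sd(1)]]
      by (simp add: bounded_analytic_mod_def power2_eq_square)
    have 3: "analytic_mod (lam - 1) (\<lambda>x. if alone then (?C x)\<^sup>2 * ?E x * x powr (lam - 1) else - ((?C x)\<^sup>2 * ?sn x))"
    proof (cases alone)
      case True
      show ?thesis
        using bounded_analytic_mod_mult[OF sq(1) b(4)] True
        by (simp, intro bounded_times_powr) (simp add: bounded_analytic_mod_def power2_eq_square)
    next
      case False
      then have "bounded_analytic_mod (lam - 1) ?sn" using c by (intro bounded_analytic_mod_score_num) (auto simp: alone_def swap_dir_def)
      then show ?thesis
        using bounded_analytic_mod_minus[OF bounded_analytic_mod_mult[OF sq(1)]] False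
        by (simp add: bounded_analytic_mod_def power2_eq_square)
    qed
    have 4: "analytic_mod (lam - 1) (\<lambda>x. (?C x)\<^sup>2 * score_num lam S snd (?Q x) (snd d))"
      using bounded_analytic_mod_mult[OF sq(1) sd(2)]
      by (simp add: bounded_analytic_mod_def power2_eq_square)
    show ?thesis
      using analytic_mod_add[OF analytic_mod_add[OF analytic_mod_add[OF 1 2] 3] 4] unfolding r_def by simp
  qed
  then obtain f where f: "f analytic_on {0}"
    "(\<lambda>x. complex_of_real (r x) - f (complex_of_real x)) \<in> O[at_right 0](\<lambda>x. complex_of_real (x powr (lam - 1)))"
    unfolding analytic_mod_def by blast
  let ?C0 = "pow_sum lam S id q0" and ?D0 = "pow_sum lam S snd q0"
  let ?\<kappa>0 = "?D0\<^sup>2 * ?C0 - (if alone then ?C0\<^sup>2 * ?D0 else 0)"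
  have "?\<kappa>0 = 0"
  proof (rule no_log_term[OF _ f(1)])
    show "(\<kappa> \<longlongrightarrow> ?\<kappa>0) (at_right 0)"
      unfolding \<kappa>_def by (cases alone; simp; intro tendsto_intros tendsto_pow_sum_drained)
    have ev: "\<forall>\<^sub>F x in at_right 0. - (complex_of_real (r x) - f (complex_of_real x)) =
        complex_of_real (\<kappa> x * x powr (lam - 1) * ln x) + f (complex_of_real x)"
      using zero
    proof eventually_elim
      case (elim x)
      then have "\<kappa> x * x powr (lam - 1) * ln x = - r x" using split[of x] by simp
      then show ?case by simp
    qed
    have "(\<lambda>x. - (complex_of_real (r x) - f (complex_of_real x))) \<in> O[at_right 0](\<lambda>x. complex_of_real (x powr (lam - 1)))"
      using f(2) by (simp only: landau_o.big.uminus_in_iff)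
    then show "(\<lambda>x. complex_of_real (\<kappa> x * x powr (lam - 1) * ln x) + f (complex_of_real x))
        \<in> O[at_right 0](\<lambda>x. complex_of_real (x powr (lam - 1)))"
      using landau_o.big.in_cong[OF ev] by blast
  qed
  moreover have "?\<kappa>0 \<noteq> 0"
  proof (cases alone)
    case True
    obtain x y where xy: "x \<in> S" "y \<in> S" "x \<noteq> y" "snd x = snd y"
      using col by (auto simp: inj_on_def)
    then have "x \<noteq> c" "y \<noteq> c" using True unfolding alone_def by (metis (mono_tags) CollectI singletonD)+
    then have "?D0 \<noteq> ?C0"
      using xy drained_nonneg drained_pos lam S by (intro pow_sum_fibres_neq[of S q0 lam x y]) auto
    moreover have "?\<kappa>0 = ?D0 * ?C0 * (?D0 - ?C0)"
      using True by (simp add: power2_eq_square algebra_simps)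
    ultimately show ?thesis using pow_sum_drained_pos[of id] pow_sum_drained_pos[of snd] by simp
  next
    case False
    then show ?thesis using pow_sum_drained_pos[of id] pow_sum_drained_pos[of snd] by simp
  qed
  ultimately show False by simp
qed

lemma row_slope_nonzero_on_line:
  assumes "\<not> inj_on snd S"
  shows "\<exists>t\<in>{- p c<..<p d}. row_slope lam S c d (shift p t e) \<noteq> 0"
proof (rule ccontr)
  assume no: "\<not> ?thesis"
  have "\<forall>\<^sub>F x in at_right 0. row_slope lam S c d (shift q0 x e) = 0"
    using eventually_at_right_real[of 0 "p c + p d"] p[OF c] p[OF d]
  proof (simp, elim eventually_mono)
    fix x assume x: "0 < x \<and> x < p c + p d"
    have "shift q0 x e = shift p (x - p c) e"
      using cd by (auto simp: shift_def q0_def e_def swap_dir_def)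
    then show "row_slope lam S c d (shift q0 x e) = 0" using no x by auto
  qed
  with row_slope_nonzero_near_0[OF assms] show False by simp
qed

end

section \<open>Spread of the multinomial distribution\<close>

text \<open>
  A finite product of countable discrete spaces is again discrete, so every condition on finitely
  many discrete observations defines an event.
\<close>

lemma finite_rv_event:
  assumes "finite K" "countable A" "\<And>k. k \<in> K \<Longrightarrow> X k \<in> measurable M (count_space A)"
  shows "{\<omega> \<in> space M. P (restrict (\<lambda>k. X k \<omega>) K)} \<in> sets M"
proof -
  have "(\<lambda>\<omega>. restrict (\<lambda>k. X k \<omega>) K) \<in> measurable M (PiM K (\<lambda>_. count_space A))"
    using assms(3) by (rule measurable_restrict)
  then have m: "(\<lambda>\<omega>. restrict (\<lambda>k. X k \<omega>) K) \<in> measurable M (count_space (PiE K (\<lambda>_. A)))"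
    using assms(1,2) by (simp add: count_space_PiM_finite)
  have "(\<lambda>\<omega>. restrict (\<lambda>k. X k \<omega>) K) -` {f \<in> PiE K (\<lambda>_. A). P f} \<inter> space M \<in> sets M"
    by (rule measurable_sets[OF m]) auto
  also have "(\<lambda>\<omega>. restrict (\<lambda>k. X k \<omega>) K) -` {f \<in> PiE K (\<lambda>_. A). P f} \<inter> space M =
      {\<omega> \<in> space M. P (restrict (\<lambda>k. X k \<omega>) K)}"
    using measurable_space[OF m] by auto
  finally show ?thesis .
qed

definition count_in :: "nat set \<Rightarrow> (nat \<Rightarrow> 'c) \<Rightarrow> 'c \<Rightarrow> nat" where
  "count_in K v x = card {k \<in> K. v k = x}"

lemma count_in_restrict: "count_in K (restrict v K) = count_in K v"
  unfolding count_in_def by (intro ext arg_cong[where f = card]) auto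

lemma count_in_remove:
  assumes "finite K" "k \<in> K"
  shows "count_in K v x = count_in (K - {k}) v x + (if v k = x then 1 else 0)"
proof -
  have "{i \<in> K. v i = x} = (if v k = x then insert k {i \<in> K - {k}. v i = x} else {i \<in> K - {k}. v i = x})"
    using assms by auto
  then show ?thesis using assms by (simp add: count_in_def)
qed

text \<open>
  Each \<open>w\<close> in \<open>Z\<close> has \<open>L\<close> translates of at least \<open>1 / C\<close> times its mass, and no point is a translate
  of points of \<open>Z\<close> in more than \<open>K\<close> ways. Summing the mass of all translates in two ways bounds
  the mass of \<open>Z\<close>.
\<close>

lemma spread_bound:
  fixes \<mu> :: "'v \<Rightarrow> real" and sh :: "nat \<Rightarrow> 'v \<Rightarrow> 'v" and L K :: nat and C :: real
  assumes U: "finite U" "\<And>w. w \<in> U \<Longrightarrow> \<mu> w \<ge> 0" "sum \<mu> U \<le> 1"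
    and Z: "finite Z" and sub: "\<And>j. j < L \<Longrightarrow> sh j ` Z \<subseteq> U" and inj: "\<And>j. j < L \<Longrightarrow> inj_on (sh j) Z"
    and le: "\<And>j w. j < L \<Longrightarrow> w \<in> Z \<Longrightarrow> \<mu> w \<le> C * \<mu> (sh j w)" and C: "C \<ge> 0"
    and few: "\<And>w'. w' \<in> U \<Longrightarrow> card {j \<in> {..<L}. w' \<in> sh j ` Z} \<le> K"
  shows "L * sum \<mu> Z \<le> C * K"
proof -
  have "L * sum \<mu> Z = (\<Sum>j<L. sum \<mu> Z)" by simp
  also have "\<dots> \<le> (\<Sum>j<L. \<Sum>w\<in>Z. C * \<mu> (sh j w))" using le by (intro sum_mono) auto
  also have "\<dots> = (\<Sum>j<L. \<Sum>w\<in>sh j ` Z. C * \<mu> w)"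
    by (rule sum.cong[OF refl], subst sum.reindex) (use inj in auto)
  also have "\<dots> = (\<Sum>j<L. \<Sum>w\<in>U. if w \<in> sh j ` Z then C * \<mu> w else 0)"
  proof (rule sum.cong[OF refl])
    fix j assume "j \<in> {..<L}"
    then have "U \<inter> sh j ` Z = sh j ` Z" using sub by auto
    then show "(\<Sum>w\<in>sh j ` Z. C * \<mu> w) = (\<Sum>w\<in>U. if w \<in> sh j ` Z then C * \<mu> w else 0)"
      using U(1) by (simp flip: sum.inter_restrict)
  qed
  also have "\<dots> = (\<Sum>w\<in>U. \<Sum>j<L. if w \<in> sh j ` Z then C * \<mu> w else 0)"
    by (rule sum.swap)
  also have "\<dots> = (\<Sum>w\<in>U. real (card {j \<in> {..<L}. w \<in> sh j ` Z}) * (C * \<mu> w))"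
    by (intro sum.cong refl) (simp flip: sum.inter_filter)
  also have "\<dots> \<le> (\<Sum>w\<in>U. real K * (C * \<mu> w))"
    using few U(2) C by (intro sum_mono mult_right_mono) auto
  also have "\<dots> = C * K * sum \<mu> U" by (simp add: sum_distrib_left mult_ac)
  also have "\<dots> \<le> C * K * 1" using U(3) C by (intro mult_left_mono) auto
  finally show ?thesis by simp
qed

text \<open>
  Independent observations with values in the finite alphabet \<open>W\<close>, each with mass function \<open>p\<close>.
\<close>

locale finite_sample = prob_space M for M :: "'w measure" +
  fixes W :: "'c set" and V :: "nat \<Rightarrow> 'w \<Rightarrow> 'c" and p :: "'c \<Rightarrow> real"
  assumes finW: "finite W" and indep: "indep_vars (\<lambda>_. count_space W) V UNIV"
    and law: "x \<in> W \<Longrightarrow> prob {\<omega> \<in> space M. V k \<omega> = x} = p x"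
begin

lemma V_measurable: "V k \<in> measurable M (count_space W)"
  using indep by (simp add: indep_vars_def)

lemma V_in: "\<omega> \<in> space M \<Longrightarrow> V k \<omega> \<in> W"
  using measurable_space[OF V_measurable] by simp

lemma p_bounds: "x \<in> W \<Longrightarrow> 0 \<le> p x" "x \<in> W \<Longrightarrow> p x \<le> 1"
  using law[of x 0] by (metis measure_nonneg, metis prob_le_1)

definition counts :: "nat \<Rightarrow> 'w \<Rightarrow> 'c \<Rightarrow> nat" where
  "counts n \<omega> = count_in {..<n} (\<lambda>k. V k \<omega>)"

definition freq :: "nat \<Rightarrow> 'w \<Rightarrow> 'c \<Rightarrow> real" where
  "freq n \<omega> x = counts n \<omega> x / n"

lemma event: "finite K \<Longrightarrow> {\<omega> \<in> space M. P (restrict (\<lambda>k. V k \<omega>) K)} \<in> events"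
  using finW V_measurable by (intro finite_rv_event[where A = W]) (auto intro: countable_finite)

lemma event_count_in: "finite K \<Longrightarrow> {\<omega> \<in> space M. P (count_in K (\<lambda>k. V k \<omega>))} \<in> events"
  using event[of K "\<lambda>f. P (count_in K f)"] by (simp add: count_in_restrict)

lemma event_counts: "{\<omega> \<in> space M. P (counts n \<omega>)} \<in> events"
  unfolding counts_def by (rule event_count_in) simp

lemma event_freq: "{\<omega> \<in> space M. P (freq n \<omega>)} \<in> events"
  using event_counts[of "\<lambda>w. P (\<lambda>x. w x / n)" n] by (simp add: freq_def[abs_def])

lemma event_V_counts: "k < n \<Longrightarrow> {\<omega> \<in> space M. V k \<omega> = x \<and> counts n \<omega> = w} \<in> events"
  using event[of "{..<n}" "\<lambda>f. f k = x \<and> count_in {..<n} f = w"]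
  by (simp add: count_in_restrict counts_def)

lemma prob_V_others:
  assumes x: "x \<in> W"
  shows "prob {\<omega> \<in> space M. V k \<omega> = x \<and> count_in ({..<n} - {k}) (\<lambda>i. V i \<omega>) = u} =
    p x * prob {\<omega> \<in> space M. count_in ({..<n} - {k}) (\<lambda>i. V i \<omega>) = u}"
proof -
  let ?K = "{..<n} - {k}"
  let ?A = "\<lambda>\<omega>. restrict (\<lambda>i. V i \<omega>) {k}" and ?B = "\<lambda>\<omega>. restrict (\<lambda>i. V i \<omega>) ?K"
  let ?SA = "{f \<in> PiE {k} (\<lambda>_. W). f k = x}" and ?SB = "{f \<in> PiE ?K (\<lambda>_. W). count_in ?K f = u}"
  have "indep_var (PiM {k} (\<lambda>_. count_space W)) ?A (PiM ?K (\<lambda>_. count_space W)) ?B"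
    using indep by (rule indep_var_restrict) auto
  then have "prob ((\<lambda>\<omega>. (?A \<omega>, ?B \<omega>)) -` (?SA \<times> ?SB) \<inter> space M) =
      prob (?A -` ?SA \<inter> space M) * prob (?B -` ?SB \<inter> space M)"
    by (rule indep_varD) (simp_all add: count_space_PiM_finite countable_finite finW)
  moreover have "(\<lambda>\<omega>. (?A \<omega>, ?B \<omega>)) -` (?SA \<times> ?SB) \<inter> space M =
      {\<omega> \<in> space M. V k \<omega> = x \<and> count_in ?K (\<lambda>i. V i \<omega>) = u}"
    using V_in by (auto simp: count_in_restrict)
  moreover have "?A -` ?SA \<inter> space M = {\<omega> \<in> space M. V k \<omega> = x}"
    using V_in by auto
  moreover have "?B -` ?SB \<inter> space M = {\<omega> \<in> space M. count_in ?K (\<lambda>i. V i \<omega>) = u}"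
    using V_in by (auto simp: count_in_restrict)
  ultimately show ?thesis using law[OF x] by simp
qed

lemma sum_prob_V_counts:
  "(\<Sum>k<n. prob {\<omega> \<in> space M. V k \<omega> = x \<and> counts n \<omega> = w}) = w x * prob {\<omega> \<in> space M. counts n \<omega> = w}"
proof -
  let ?E = "\<lambda>k. {\<omega> \<in> space M. V k \<omega> = x \<and> counts n \<omega> = w}" and ?F = "{\<omega> \<in> space M. counts n \<omega> = w}"
  have "(\<Sum>k<n. prob (?E k)) = (\<Sum>k<n. expectation (indicator (?E k)))"
    using event_V_counts by (intro sum.cong) auto
  also have "\<dots> = expectation (\<lambda>\<omega>. \<Sum>k<n. indicator (?E k) \<omega>)"
    using event_V_counts
    by (intro Bochner_Integration.integral_sum[symmetric] integrable_real_indicator) (auto simp: emeasure_eq_measure)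
  also have "\<dots> = expectation (\<lambda>\<omega>. real (w x) * indicator ?F \<omega>)"
  proof (intro Bochner_Integration.integral_cong refl)
    fix \<omega> assume \<omega>: "\<omega> \<in> space M"
    show "(\<Sum>k<n. indicator (?E k) \<omega>) = real (w x) * indicator ?F \<omega>"
    proof (cases "counts n \<omega> = w")
      case True
      then have "(\<Sum>k<n. indicator (?E k) \<omega>) = (\<Sum>k<n. if V k \<omega> = x then 1 else (0::real))"
        using \<omega> by (intro sum.cong) auto
      also have "\<dots> = w x" by (simp add: True[symmetric] counts_def count_in_def flip: sum.inter_filter)
      finally show ?thesis using True \<omega> by simp
    qed simp
  qed
  also have "\<dots> = w x * prob ?F" using event_counts[of "\<lambda>v. v = w" n] by simp
  finally show ?thesis .
qed

text \<open>
  Exchanging an observation \<open>d\<close> for an observation \<open>c\<close> at a fixed index \<open>k\<close> leaves the other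
  observations alone, and these are independent of the one at \<open>k\<close>. Summing over \<open>k\<close> counts the indices
  at which the exchange is possible.
\<close>

lemma counts_exchange:
  assumes c: "c \<in> W" "d \<in> W" "c \<noteq> d" and wd: "w d > 0"
  shows "real (w c + 1) * p d * prob {\<omega> \<in> space M. counts n \<omega> = w(c := w c + 1, d := w d - 1)} =
    real (w d) * p c * prob {\<omega> \<in> space M. counts n \<omega> = w}"
proof -
  let ?w = "w(c := w c + 1, d := w d - 1)" and ?u = "w(d := w d - 1)"
  let ?O = "\<lambda>k. {\<omega> \<in> space M. count_in ({..<n} - {k}) (\<lambda>i. V i \<omega>) = ?u}"
  have 1: "V k \<omega> = c \<and> counts n \<omega> = ?w \<longleftrightarrow> V k \<omega> = c \<and> count_in ({..<n} - {k}) (\<lambda>i. V i \<omega>) = ?u"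
    if "k < n" for k \<omega>
  proof (cases "V k \<omega> = c")
    case True
    have "counts n \<omega> x = count_in ({..<n} - {k}) (\<lambda>i. V i \<omega>) x + (if c = x then 1 else 0)" for x
      unfolding counts_def using that True by (subst count_in_remove[of _ k]) auto
    then have "counts n \<omega> = ?w \<longleftrightarrow> (\<forall>x. count_in ({..<n} - {k}) (\<lambda>i. V i \<omega>) x + (if c = x then 1 else 0) = ?w x)"
      by (auto simp: fun_eq_iff)
    also have "\<dots> \<longleftrightarrow> (\<forall>x. count_in ({..<n} - {k}) (\<lambda>i. V i \<omega>) x = ?u x)"
      using c by (intro all_cong1) auto
    finally show ?thesis by (auto simp: fun_eq_iff)
  qed simp
  have 2: "V k \<omega> = d \<and> counts n \<omega> = w \<longleftrightarrow> V k \<omega> = d \<and> count_in ({..<n} - {k}) (\<lambda>i. V i \<omega>) = ?u"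
    if "k < n" for k \<omega>
  proof (cases "V k \<omega> = d")
    case True
    have "counts n \<omega> x = count_in ({..<n} - {k}) (\<lambda>i. V i \<omega>) x + (if d = x then 1 else 0)" for x
      unfolding counts_def using that True by (subst count_in_remove[of _ k]) auto
    then have "counts n \<omega> = w \<longleftrightarrow> (\<forall>x. count_in ({..<n} - {k}) (\<lambda>i. V i \<omega>) x + (if d = x then 1 else 0) = w x)"
      by (auto simp: fun_eq_iff)
    also have "\<dots> \<longleftrightarrow> (\<forall>x. count_in ({..<n} - {k}) (\<lambda>i. V i \<omega>) x = ?u x)"
      using wd by (intro all_cong1) auto
    finally show ?thesis by (auto simp: fun_eq_iff)
  qed simp
  have "?w c = w c + 1" using c by simp
  then have "real (w c + 1) * prob {\<omega> \<in> space M. counts n \<omega> = ?w} =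
      (\<Sum>k<n. prob {\<omega> \<in> space M. V k \<omega> = c \<and> counts n \<omega> = ?w})"
    unfolding sum_prob_V_counts by simp
  also have "\<dots> = (\<Sum>k<n. p c * prob (?O k))"
    using 1 prob_V_others[OF c(1)] by (intro sum.cong refl) simp
  finally have A: "real (w c + 1) * prob {\<omega> \<in> space M. counts n \<omega> = ?w} = p c * (\<Sum>k<n. prob (?O k))"
    by (simp add: sum_distrib_left)
  have "real (w d) * prob {\<omega> \<in> space M. counts n \<omega> = w} =
      (\<Sum>k<n. prob {\<omega> \<in> space M. V k \<omega> = d \<and> counts n \<omega> = w})"
    unfolding sum_prob_V_counts by simp
  also have "\<dots> = (\<Sum>k<n. p d * prob (?O k))"
    using 2 prob_V_others[OF c(2)] by (intro sum.cong refl) simp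
  finally have B: "real (w d) * prob {\<omega> \<in> space M. counts n \<omega> = w} = p d * (\<Sum>k<n. prob (?O k))"
    by (simp add: sum_distrib_left)
  have "real (w c + 1) * p d * prob {\<omega> \<in> space M. counts n \<omega> = ?w} = p d * (p c * (\<Sum>k<n. prob (?O k)))"
    unfolding A[symmetric] by (simp only: mult_ac)
  also have "\<dots> = p c * (p d * (\<Sum>k<n. prob (?O k)))" by (simp only: mult_ac)
  also have "\<dots> = real (w d) * p c * prob {\<omega> \<in> space M. counts n \<omega> = w}"
    unfolding B[symmetric] by (simp only: mult_ac)
  finally show ?thesis .
qed

lemma prob_counts_sum:
  assumes "finite Z"
  shows "prob {\<omega> \<in> space M. counts n \<omega> \<in> Z} = (\<Sum>w\<in>Z. prob {\<omega> \<in> space M. counts n \<omega> = w})"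
proof -
  have "{\<omega> \<in> space M. counts n \<omega> \<in> Z} = (\<Union>w\<in>Z. {\<omega> \<in> space M. counts n \<omega> = w})" by auto
  moreover have "prob (\<Union>w\<in>Z. {\<omega> \<in> space M. counts n \<omega> = w}) =
      (\<Sum>w\<in>Z. prob {\<omega> \<in> space M. counts n \<omega> = w})"
    by (rule finite_measure_finite_Union[OF assms])
       (auto simp: disjoint_family_on_def intro: event_counts[where P = "\<lambda>v. v = w" for w])
  ultimately show ?thesis by simp
qed

text \<open>
  Within a distance of order \<open>1 / L\<close> of \<open>p\<close>, \<open>counts_exchange\<close> bounds the ratio of the probabilities of
  neighbouring count vectors by \<open>1 + 1 / L\<close>, so \<open>L\<close> steps cost at most a factor \<open>3 > exp 1\<close>, and
  \<open>spread_bound\<close> gives the bound \<open>3 * K / L\<close>. The assumption \<open>few\<close> says that a line in the direction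
  of the exchange meets \<open>G\<close> in at most \<open>K\<close> points near \<open>p\<close>.
\<close>

lemma anti_concentration:
  assumes c: "c \<in> W" "d \<in> W" "c \<noteq> d" and pos: "p c > 0" "p d > 0" and \<delta>0: "\<delta>0 > 0"
    and few: "\<And>q T. q \<in> near W p \<delta>0 \<Longrightarrow> finite T \<Longrightarrow>
      T \<subseteq> {t. shift q t (swap_dir c d) \<in> near W p \<delta>0 \<and> G (shift q t (swap_dir c d))} \<Longrightarrow> card T \<le> K"
    and \<epsilon>: "\<epsilon> > 0"
  shows "\<exists>\<delta>>0. \<forall>\<^sub>F n in sequentially. prob {\<omega> \<in> space M. freq n \<omega> \<in> near W p \<delta> \<and> G (freq n \<omega>)} \<le> \<epsilon>"
proof -
  let ?e = "swap_dir c d"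
  obtain L :: nat where L: "L > 3 * K / \<epsilon>" using reals_Archimedean2 by blast
  have "3 * K / \<epsilon> \<ge> 0" using \<epsilon> by simp
  with L have "real L > 0" by linarith
  then have L0: "L > 0" by simp
  define \<rho> :: real where "\<rho> = 1 + 1 / L"
  have \<rho>: "\<rho> \<ge> 1" "\<rho> \<le> 2" using L0 by (auto simp: \<rho>_def field_simps)
  have \<rho>L: "\<rho> ^ L \<le> 3"
    using exp_ge_one_plus_x_over_n_power_n[of L 1] L0 exp_le by (simp add: \<rho>_def)
  \<comment> \<open>small enough for the ratio bound \<open>ratio\<close> below, which only uses that the masses are at most one\<close>
  define \<delta>1 where "\<delta>1 = min \<delta>0 (p c * p d / (4 * L))"
  have p1: "p c \<le> 1" "p d \<le> 1" using p_bounds c by auto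
  have \<delta>1: "\<delta>1 > 0" "\<delta>1 \<le> \<delta>0" "4 * \<delta>1 \<le> p c * p d / L"
    using \<delta>0 pos L0 by (auto simp: \<delta>1_def min_def field_simps)
  have "p c * p d / L \<le> p c * p d" using L0 pos by (simp add: field_simps)
  also have "\<dots> \<le> p d" using p1 pos by simp
  finally have \<delta>1d: "4 * \<delta>1 \<le> p d" using \<delta>1 by simp
  have ratio: "(p c + 2 * \<delta>1) * p d \<le> \<rho> * (p d - \<delta>1) * p c"
  proof -
    have "2 * \<delta>1 * p d \<le> 2 * \<delta>1" "\<rho> * \<delta>1 * p c \<le> 2 * \<delta>1"
      using \<delta>1(1) p1 pos \<rho> by (auto simp: mult_le_cancel_left2 intro: order_trans[OF mult_right_le_one_le])
    moreover have "\<rho> * (p d - \<delta>1) * p c = p c * p d + p c * p d / L - \<rho> * \<delta>1 * p c"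
      by (simp add: \<rho>_def algebra_simps diff_divide_distrib)
    ultimately show ?thesis using \<delta>1(3) by (simp add: algebra_simps)
  qed
  have "\<forall>\<^sub>F n in sequentially. prob {\<omega> \<in> space M. freq n \<omega> \<in> near W p (\<delta>1 / 2) \<and> G (freq n \<omega>)} \<le> \<epsilon>"
  proof -
    have "((\<lambda>n. real L / real n) \<longlonglongrightarrow> 0)" by (rule lim_const_over_n)
    then have "\<forall>\<^sub>F n in sequentially. real L / real n < \<delta>1 / 2"
      using \<delta>1(1) by (intro order_tendstoD(2)) auto
    then show ?thesis using eventually_gt_at_top[of "0::nat"]
    proof eventually_elim
      case (elim n)
      define fr :: "('c \<Rightarrow> nat) \<Rightarrow> 'c \<Rightarrow> real" where "fr w x = w x / n" for w x
      \<comment> \<open>The bound \<open>n + L\<close> leaves room for the \<open>L\<close> exchanges, whether or not the result is attainable.\<close>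
      define U where "U = {w :: 'c \<Rightarrow> nat. \<forall>x. (x \<in> W \<longrightarrow> w x \<in> {..n + L}) \<and> (x \<notin> W \<longrightarrow> w x = 0)}"
      define Z where "Z = {w \<in> U. fr w \<in> near W p (\<delta>1 / 2) \<and> G (fr w) \<and> (\<forall>x. w x \<le> n)}"
      define sh where "sh j w = w(c := w c + j, d := w d - j)" for j and w :: "'c \<Rightarrow> nat"
      define \<mu> where "\<mu> w = prob {\<omega> \<in> space M. counts n \<omega> = w}" for w
      have finU: "finite U" unfolding U_def using finW by (intro finite_set_of_finite_funs) auto
      then have finZ: "finite Z" by (simp add: Z_def)
      have small: "real j / n < \<delta>1 / 2" if "j \<le> L" for j
      proof -
        have "real j / n \<le> real L / n" using that by (intro divide_right_mono) auto
        then show ?thesis using elim by linarith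
      qed
      have wd: "w d > L" if "w \<in> Z" for w
      proof -
        have "\<bar>real (w d) / n - p d\<bar> < \<delta>1 / 2"
          using that c(2) by (simp add: Z_def near_def fr_def)
        then have "real (w d) / n > p d - \<delta>1 / 2" by linarith
        then have "real L / n < real (w d) / n" using elim \<delta>1d \<delta>1(1) by linarith
        then show ?thesis using elim by (simp add: field_simps)
      qed
      have frsh: "fr (sh j w) = shift (fr w) (j / n) ?e" if "w \<in> Z" "j \<le> L" for j w
      proof
        fix x
        show "fr (sh j w) x = shift (fr w) (j / n) ?e x"
          using wd[OF that(1)] that(2) c(3)
          by (simp add: fr_def sh_def shift_def swap_dir_def of_nat_diff add_divide_distrib diff_divide_distrib)
      qed
      have sume: "sum ?e W = 0"
      proof -
        have "sum ?e W = sum ?e {c, d}"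
          using c finW by (intro sum.mono_neutral_right) (auto simp: swap_dir_def)
        then show ?thesis using c by (simp add: swap_dir_def)
      qed
      have near1: "fr (sh j w) \<in> near W p \<delta>1" if "w \<in> Z" "j \<le> L" for j w
      proof -
        have w: "fr w \<in> near W p (\<delta>1 / 2)" using that by (simp add: Z_def)
        have "\<bar>shift (fr w) (j / n) ?e x - p x\<bar> < \<delta>1" if "x \<in> W" for x
        proof -
          have "\<bar>fr w x - p x\<bar> < \<delta>1 / 2" using w that by (simp add: near_def)
          moreover have "\<bar>?e x\<bar> \<le> 1" by (simp add: swap_dir_def)
          then have "\<bar>real j / n * ?e x\<bar> \<le> real j / n"
            using mult_left_le[of "\<bar>?e x\<bar>" "real j / n"] by (simp add: abs_mult)
          moreover have "\<bar>a + u - b\<bar> < \<delta>1" if "\<bar>a - b\<bar> < \<delta>1 / 2" "\<bar>u\<bar> \<le> v" "v < \<delta>1 / 2" for a u v b :: real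
            using that by linarith
          ultimately show ?thesis using small[OF \<open>j \<le> L\<close>] unfolding shift_def by blast
        qed
        moreover have "shift (fr w) (j / n) ?e x = 0" if "x \<in> W" "p x = 0" for x
          using w that pos by (auto simp: near_def shift_def swap_dir_def)
        moreover have "sum (shift (fr w) (j / n) ?e) W = 1"
          using w by (simp add: sum_shift sume near_def)
        ultimately show ?thesis unfolding frsh[OF that] by (auto simp: near_def)
      qed
      have step: "\<mu> (sh j w) \<le> \<rho> * \<mu> (sh (Suc j) w)" if w: "w \<in> Z" and j: "j < L" for j w
      proof -
        let ?w = "sh j w"
        have nr: "fr ?w \<in> near W p \<delta>1" using near1 w j by simp
        have wd0: "?w d > 0" using wd[OF w] j by (simp add: sh_def)
        have eq: "?w(c := ?w c + 1, d := ?w d - 1) = sh (Suc j) w"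
          using c by (auto simp: sh_def fun_eq_iff)
        have ex: "real (?w c + 1) * p d * \<mu> (sh (Suc j) w) = real (?w d) * p c * \<mu> ?w"
          using counts_exchange[where w = ?w and n = n, OF c wd0] unfolding \<mu>_def eq .
        have "\<bar>real (?w c) / n - p c\<bar> < \<delta>1" using nr c(1) by (simp add: near_def fr_def)
        then have "real (?w c) / n < p c + \<delta>1" by linarith
        moreover have "1 / n \<le> \<delta>1" using small[of 1] L0 \<delta>1 by simp
        ultimately have "real (?w c + 1) / n \<le> p c + 2 * \<delta>1" by (simp add: add_divide_distrib)
        then have "real (?w c + 1) / n * p d \<le> (p c + 2 * \<delta>1) * p d"
          using pos by (intro mult_right_mono) auto
        also note ratio
        also have "\<rho> * (p d - \<delta>1) * p c \<le> \<rho> * (real (?w d) / n) * p c"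
        proof -
          have "\<bar>real (?w d) / n - p d\<bar> < \<delta>1" using nr c(2) by (simp add: near_def fr_def)
          then have "p d - \<delta>1 \<le> real (?w d) / n" by linarith
          then show ?thesis using pos \<rho> by (intro mult_right_mono mult_left_mono) auto
        qed
        finally have "(real (?w c + 1) * p d) / n \<le> (\<rho> * (real (?w d) * p c)) / n"
          by (simp only: times_divide_eq_left times_divide_eq_right mult.assoc)
        then have "real (?w c + 1) * p d \<le> \<rho> * (real (?w d) * p c)"
          using elim by (simp only: divide_le_cancel of_nat_0_less_iff if_True)
        then have "real (?w d) * p c * \<mu> ?w \<le> \<rho> * (real (?w d) * p c) * \<mu> (sh (Suc j) w)"
          unfolding ex[symmetric] by (intro mult_right_mono) (auto simp: \<mu>_def)
        then have "(real (?w d) * p c) * \<mu> ?w \<le> (real (?w d) * p c) * (\<rho> * \<mu> (sh (Suc j) w))"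
          by (simp only: mult_ac)
        moreover have "real (?w d) * p c > 0" using wd0 pos by simp
        ultimately show ?thesis by (simp only: mult_le_cancel_left_pos)
      qed
      have steps: "\<mu> w \<le> \<rho> ^ j * \<mu> (sh j w)" if "w \<in> Z" "j \<le> L" for j w
        using that(2)
      proof (induction j)
        case 0
        then show ?case by (simp add: sh_def)
      next
        case (Suc j)
        then have "\<mu> w \<le> \<rho> ^ j * \<mu> (sh j w)" by simp
        also have "\<dots> \<le> \<rho> ^ j * (\<rho> * \<mu> (sh (Suc j) w))"
          using step[OF that(1)] Suc.prems \<rho> by (intro mult_left_mono) auto
        finally show ?case by (simp add: mult_ac)
      qed
      have "real L * sum \<mu> Z \<le> 3 * real K"
      proof (rule spread_bound[where U = U and sh = sh])
        show "sum \<mu> U \<le> 1"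
          using prob_counts_sum[OF finU, of n] unfolding \<mu>_def by (metis prob_le_1)
        show "sh j ` Z \<subseteq> U" if "j < L" for j
          using that c by (auto simp: Z_def U_def sh_def intro!: add_mono order_trans[OF diff_le_self])
        show "inj_on (sh j) Z" if j: "j < L" for j
        proof (rule inj_onI)
          fix v w assume vw: "v \<in> Z" "w \<in> Z" "sh j v = sh j w"
          have "v x = w x" for x
            using fun_cong[OF vw(3), of x] wd[OF vw(1)] wd[OF vw(2)] j
            by (auto simp: sh_def split: if_splits)
          then show "v = w" by blast
        qed
        show "\<mu> w \<le> 3 * \<mu> (sh j w)" if "j < L" "w \<in> Z" for j w
        proof -
          have "\<mu> w \<le> \<rho> ^ j * \<mu> (sh j w)" using steps that by simp
          also have "\<rho> ^ j \<le> \<rho> ^ L" using that \<rho> by (intro power_increasing) auto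
          then have "\<rho> ^ j * \<mu> (sh j w) \<le> 3 * \<mu> (sh j w)"
            using \<rho>L by (intro mult_right_mono) (auto simp: \<mu>_def)
          finally show ?thesis .
        qed
        show "card {j \<in> {..<L}. w' \<in> sh j ` Z} \<le> K" if "w' \<in> U" for w'
        proof (cases "{j \<in> {..<L}. w' \<in> sh j ` Z} = {}")
          case False
          then obtain j0 w0 where w0: "j0 < L" "w0 \<in> Z" "w' = sh j0 w0" by auto
          \<comment> \<open>All \<open>j\<close> that reach \<open>w'\<close> start on one line, which is parametrised from \<open>w0\<close>.\<close>
          let ?T = "(\<lambda>j. (real j0 - real j) / n) ` {j \<in> {..<L}. w' \<in> sh j ` Z}"
          have "card ?T \<le> K"
          proof (rule few[of "fr w0"])
            show "fr w0 \<in> near W p \<delta>0"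
              using w0 near_mono[of "\<delta>1 / 2" \<delta>0 W p] \<delta>1 by (auto simp: Z_def)
            show "?T \<subseteq> {t. shift (fr w0) t ?e \<in> near W p \<delta>0 \<and> G (shift (fr w0) t ?e)}"
            proof (rule image_subsetI)
              fix j assume "j \<in> {j \<in> {..<L}. w' \<in> sh j ` Z}"
              then obtain w where w: "j < L" "w \<in> Z" "w' = sh j w" by auto
              have "shift (fr w0) (j0 / n) ?e = shift (fr w) (j / n) ?e"
                using frsh[of w0 j0] frsh[of w j] w w0 by simp
              then have "fr w x = shift (fr w0) ((real j0 - real j) / n) ?e x" for x
                by (auto simp: shift_def fun_eq_iff algebra_simps diff_divide_distrib dest: spec[of _ x])
              then have "fr w = shift (fr w0) ((real j0 - real j) / n) ?e" by blast
              then show "(real j0 - real j) / n \<in> {t. shift (fr w0) t ?e \<in> near W p \<delta>0 \<and> G (shift (fr w0) t ?e)}"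
                using w(2) near_mono[of "\<delta>1 / 2" \<delta>0 W p] \<delta>1 by (auto simp: Z_def)
            qed
          qed auto
          moreover have "inj_on (\<lambda>j. (real j0 - real j) / n) {j \<in> {..<L}. w' \<in> sh j ` Z}"
            using elim by (auto intro!: inj_onI)
          ultimately show ?thesis by (simp add: card_image)
        qed (metis card.empty le0)
      qed (auto simp: finU finZ \<mu>_def)
      moreover have "prob {\<omega> \<in> space M. freq n \<omega> \<in> near W p (\<delta>1 / 2) \<and> G (freq n \<omega>)} = sum \<mu> Z"
      proof -
        have cn: "counts n \<omega> x \<le> n" for \<omega> x
          unfolding counts_def count_in_def
          using card_mono[of "{..<n}" "{k \<in> {..<n}. V k \<omega> = x}"] by auto
        have "counts n \<omega> \<in> Z \<longleftrightarrow> freq n \<omega> \<in> near W p (\<delta>1 / 2) \<and> G (freq n \<omega>)" if "\<omega> \<in> space M" for \<omega>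
        proof -
          have "fr (counts n \<omega>) = freq n \<omega>" by (simp add: fr_def freq_def fun_eq_iff)
          moreover have "counts n \<omega> x = 0" if "x \<notin> W" for x
            using V_in[OF \<open>\<omega> \<in> space M\<close>] that by (auto simp: counts_def count_in_def)
          then have "counts n \<omega> \<in> U" using cn by (auto simp: U_def intro: trans_le_add1)
          ultimately show ?thesis using cn by (simp add: Z_def)
        qed
        then have "{\<omega> \<in> space M. freq n \<omega> \<in> near W p (\<delta>1 / 2) \<and> G (freq n \<omega>)} = {\<omega> \<in> space M. counts n \<omega> \<in> Z}"
          by auto
        then show ?thesis using prob_counts_sum[OF finZ] by (simp add: \<mu>_def)
      qed
      moreover have "3 * real K \<le> real L * \<epsilon>" using L \<epsilon> by (simp add: field_simps)
      ultimately have "real L * prob {\<omega> \<in> space M. freq n \<omega> \<in> near W p (\<delta>1 / 2) \<and> G (freq n \<omega>)} \<le> real L * \<epsilon>"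
        by (metis order_trans)
      then show ?case using L0 by (simp add: mult_le_cancel_left_pos)
    qed
  qed
  then show ?thesis using \<delta>1(1) by (intro exI[of _ "\<delta>1 / 2"]) auto
qed

text \<open>
  The weak law of large numbers within the face, from Hoeffding's inequality for each letter;
  letters of mass zero almost surely do not occur at all.
\<close>

lemma freq_near:
  assumes \<delta>: "\<delta> > 0"
  shows "(\<lambda>n. prob {\<omega> \<in> space M. freq n \<omega> \<in> near W p \<delta>}) \<longlonglongrightarrow> 1"
proof -
  let ?b = "\<lambda>n x. prob {\<omega> \<in> space M. \<bar>freq n \<omega> x - p x\<bar> \<ge> \<delta>}"
  let ?z = "\<lambda>n x. prob {\<omega> \<in> space M. p x = 0 \<and> freq n \<omega> x \<noteq> 0}"
  have b: "?b n x \<le> 2 * exp (- 2 * \<delta>\<^sup>2 * n)" if x: "x \<in> W" and n: "n > 0" for n x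
  proof -
    let ?X = "\<lambda>k \<omega>. indicator {x} (V k \<omega>) :: real"
    have iv: "indep_vars (\<lambda>_. borel) ?X {..<n}"
      using indep_vars_subset[OF indep, of "{..<n}"]
      by (rule indep_vars_compose2) auto
    have ex: "expectation (?X k) = p x" for k
    proof -
      have "expectation (?X k) = expectation (indicator {\<omega> \<in> space M. V k \<omega> = x})"
        by (intro Bochner_Integration.integral_cong) (auto simp: indicator_def)
      also have "\<dots> = p x"
        using event[of "{k}" "\<lambda>f. f k = x"] law[OF x] by simp
      finally show ?thesis .
    qed
    interpret H: Hoeffding_ineq M "{..<n}" ?X "\<lambda>_. 0" "\<lambda>_. 1" "n * p x"
      by unfold_locales (use iv ex in \<open>auto simp: indicator_def\<close>)
    have "prob {\<omega> \<in> space M. \<bar>(\<Sum>k<n. ?X k \<omega>) - n * p x\<bar> \<ge> n * \<delta>} \<le> 2 * exp (- 2 * (n * \<delta>)\<^sup>2 / (\<Sum>k<n. (1 - 0)\<^sup>2))"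
      using n \<delta> by (intro H.Hoeffding_ineq_abs_ge) auto
    also have "- 2 * (n * \<delta>)\<^sup>2 / (\<Sum>k<n. (1 - 0)\<^sup>2) = - 2 * \<delta>\<^sup>2 * n"
      using n by (simp add: power2_eq_square field_simps)
    also have "{\<omega> \<in> space M. \<bar>(\<Sum>k<n. ?X k \<omega>) - n * p x\<bar> \<ge> n * \<delta>} = {\<omega> \<in> space M. \<bar>freq n \<omega> x - p x\<bar> \<ge> \<delta>}"
    proof -
      have "\<bar>(\<Sum>k<n. ?X k \<omega>) - n * p x\<bar> = n * \<bar>freq n \<omega> x - p x\<bar>" for \<omega>
      proof -
        have "{..<n} \<inter> {k. V k \<omega> = x} = {k. k < n \<and> V k \<omega> = x}" by auto
        then have "(\<Sum>k<n. ?X k \<omega>) = n * freq n \<omega> x"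
          using n by (simp add: freq_def counts_def count_in_def indicator_def)
        then show ?thesis using n by (simp add: abs_mult flip: right_diff_distrib)
      qed
      then show ?thesis using n by simp
    qed
    finally show ?thesis .
  qed
  have z: "?z n x = 0" if x: "x \<in> W" for n x
  proof (cases "p x = 0")
    case True
    have "{\<omega> \<in> space M. p x = 0 \<and> freq n \<omega> x \<noteq> 0} \<subseteq> (\<Union>k<n. {\<omega> \<in> space M. V k \<omega> = x})"
    proof clarify
      fix \<omega> assume "\<omega> \<in> space M" "freq n \<omega> x \<noteq> 0"
      then have "{k \<in> {..<n}. V k \<omega> = x} \<noteq> {}"
        by (auto simp: freq_def counts_def count_in_def)
      then show "\<omega> \<in> (\<Union>k<n. {\<omega> \<in> space M. V k \<omega> = x})" using \<open>\<omega> \<in> space M\<close> by auto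
    qed
    moreover have ev: "{\<omega> \<in> space M. V k \<omega> = x} \<in> events" for k
      using event[of "{k}" "\<lambda>f. f k = x"] by simp
    ultimately have "?z n x \<le> prob (\<Union>k<n. {\<omega> \<in> space M. V k \<omega> = x})"
      by (intro finite_measure_mono) auto
    also have "\<dots> \<le> (\<Sum>k<n. prob {\<omega> \<in> space M. V k \<omega> = x})"
      using ev by (intro finite_measure_subadditive_finite) auto
    also have "\<dots> = 0" using law[OF x] True by simp
    finally show ?thesis by (simp add: measure_le_0_iff)
  qed simp
  have low: "1 - (\<Sum>x\<in>W. 2 * exp (- 2 * \<delta>\<^sup>2 * n)) \<le> prob {\<omega> \<in> space M. freq n \<omega> \<in> near W p \<delta>}"
    if n: "n > 0" for n
  proof -
    let ?N = "{\<omega> \<in> space M. \<not> freq n \<omega> \<in> near W p \<delta>}"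
    have "?N \<subseteq> (\<Union>x\<in>W. {\<omega> \<in> space M. \<bar>freq n \<omega> x - p x\<bar> \<ge> \<delta>} \<union> {\<omega> \<in> space M. p x = 0 \<and> freq n \<omega> x \<noteq> 0})"
    proof (rule subsetI)
      fix \<omega> assume \<omega>: "\<omega> \<in> ?N"
      have "sum (freq n \<omega>) W = 1"
      proof -
        have "(\<Sum>x\<in>W. real (counts n \<omega> x)) = (\<Sum>x\<in>W. \<Sum>k\<in>{k \<in> {..<n}. V k \<omega> = x}. 1)"
          by (simp add: counts_def count_in_def)
        also have "\<dots> = (\<Sum>k<n. 1)" using finW V_in \<omega> by (intro sum.group) auto
        finally show ?thesis using n by (simp add: freq_def flip: sum_divide_distrib)
      qed
      then show "\<omega> \<in> (\<Union>x\<in>W. {\<omega> \<in> space M. \<bar>freq n \<omega> x - p x\<bar> \<ge> \<delta>} \<union> {\<omega> \<in> space M. p x = 0 \<and> freq n \<omega> x \<noteq> 0})"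
        using \<omega> by (force simp: near_def)
    qed
    then have "prob ?N \<le> prob (\<Union>x\<in>W. {\<omega> \<in> space M. \<bar>freq n \<omega> x - p x\<bar> \<ge> \<delta>} \<union> {\<omega> \<in> space M. p x = 0 \<and> freq n \<omega> x \<noteq> 0})"
      using finW event_freq by (intro finite_measure_mono) auto
    also have "\<dots> \<le> (\<Sum>x\<in>W. prob ({\<omega> \<in> space M. \<bar>freq n \<omega> x - p x\<bar> \<ge> \<delta>} \<union> {\<omega> \<in> space M. p x = 0 \<and> freq n \<omega> x \<noteq> 0}))"
      using finW event_freq by (intro finite_measure_subadditive_finite) auto
    also have "\<dots> \<le> (\<Sum>x\<in>W. ?b n x + ?z n x)"
      using event_freq by (intro sum_mono measure_Un_le) auto
    also have "\<dots> \<le> (\<Sum>x\<in>W. 2 * exp (- 2 * \<delta>\<^sup>2 * n))"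
      using b z n by (intro sum_mono) simp
    finally show ?thesis
      using prob_neg[OF event_freq[of "\<lambda>q. q \<in> near W p \<delta>" n]] by simp
  qed
  have "(\<lambda>n. exp (- 2 * \<delta>\<^sup>2 * real n)) \<longlonglongrightarrow> 0" using \<delta> by real_asymp
  then have "(\<lambda>n. 1 - (\<Sum>x\<in>W. 2 * exp (- 2 * \<delta>\<^sup>2 * real n))) \<longlonglongrightarrow> 1 - (\<Sum>x\<in>W. 2 * 0)"
    by (intro tendsto_intros)
  then have lim: "(\<lambda>n. 1 - (\<Sum>x\<in>W. 2 * exp (- 2 * \<delta>\<^sup>2 * real n))) \<longlonglongrightarrow> 1" by simp
  have "\<forall>\<^sub>F n in sequentially. 1 - (\<Sum>x\<in>W. 2 * exp (- 2 * \<delta>\<^sup>2 * real n)) \<le>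
      prob {\<omega> \<in> space M. freq n \<omega> \<in> near W p \<delta>}"
    using eventually_gt_at_top[of "0::nat"] by eventually_elim (rule low)
  then show ?thesis
    by (rule tendsto_sandwich[OF _ _ lim tendsto_const]) (intro always_eventually allI prob_le_1)
qed

end

text \<open>
  A derivative of some order \<open>k\<close> is nonzero at \<open>p\<close>, hence by continuity on a whole neighbourhood,
  where Rolle's theorem applies to every parallel line.
\<close>

lemma few_zeros_on_lines:
  assumes W: "finite W" and F: "F \<in> elementary (blocks (supp W p))"
    and c: "c \<in> supp W p" "d \<in> supp W p" "c \<noteq> d"
    and nz: "t0 \<in> {- p c<..<p d}" "F (shift p t0 (swap_dir c d)) \<noteq> 0"
  obtains \<delta> K where "\<delta> > 0" "\<And>q T. q \<in> near W p \<delta> \<Longrightarrow> finite T \<Longrightarrow>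
    T \<subseteq> {t. shift q t (swap_dir c d) \<in> near W p \<delta> \<and> F (shift q t (swap_dir c d)) = 0} \<Longrightarrow> card T \<le> K"
proof -
  let ?S = "supp W p" and ?e = "swap_dir c d"
  have S: "finite ?S" "\<And>x. x \<in> ?S \<Longrightarrow> p x > 0" using W by (auto simp: supp_def)
  obtain Fs where Fs0: "Fs 0 = F" and Fsel: "\<And>n. Fs n \<in> elementary (blocks ?S)"
    and Fs: "\<And>n q t. (\<And>B. B \<in> blocks ?S \<Longrightarrow> sum (shift q t ?e) B > 0) \<Longrightarrow>
      ((\<lambda>t. Fs n (shift q t ?e)) has_real_derivative Fs (Suc n) (shift q t ?e)) (at t)"
    by (rule elementary_derivatives[OF F, where e = ?e]) blast
  have "\<exists>k. Fs k p \<noteq> 0"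
  proof (rule elementary_nonzero_derivative[OF F _ _ _ nz Fs0 Fs])
    show "- p c < 0" "0 < p d" using S(2) c by auto
    fix B t assume B: "B \<in> blocks ?S" and t: "t \<in> {- p c<..<p d}"
    show "sum (shift p t ?e) B > 0"
      using t S(2) c(3) by (intro blocks_pos[OF S(1) _ B]) (auto simp: shift_def swap_dir_def)
  qed
  then obtain k where k: "Fs k p \<noteq> 0" by blast
  have "\<forall>\<^sub>F q in face_nhds W p. (\<forall>x\<in>?S. q x > 0) \<and> Fs k q \<noteq> 0"
  proof (rule eventually_conj)
    show "\<forall>\<^sub>F q in face_nhds W p. \<forall>x\<in>?S. q x > 0"
      using S(1) by (intro eventually_ball_finite ballI face_nhds_pos) (auto simp: supp_def)
    show "\<forall>\<^sub>F q in face_nhds W p. Fs k q \<noteq> 0"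
      using tendsto_imp_eventually_ne[OF tendsto_elementary[OF W Fsel] k] .
  qed
  then obtain \<delta> where \<delta>: "\<delta> > 0" and near: "\<And>q. q \<in> near W p \<delta> \<Longrightarrow> (\<forall>x\<in>?S. q x > 0) \<and> Fs k q \<noteq> 0"
    unfolding eventually_face_nhds by blast
  have cW: "c \<in> W" "d \<in> W" "p c > 0" "p d > 0" using c by (auto simp: supp_def)
  have sume: "sum ?e W = 0"
  proof -
    have "sum ?e W = sum ?e {c, d}"
      using cW W by (intro sum.mono_neutral_right) (auto simp: swap_dir_def)
    then show ?thesis using c by (simp add: swap_dir_def)
  qed
  have "card T \<le> k" if q: "q \<in> near W p \<delta>" and T: "finite T"
    "T \<subseteq> {t. shift q t ?e \<in> near W p \<delta> \<and> F (shift q t ?e) = 0}" for q T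
  proof -
    \<comment> \<open>Only the coordinates \<open>c\<close> and \<open>d\<close> move, so the part of the line inside the neighbourhood is an interval.\<close>
    let ?a = "max (p c - \<delta> - q c) (q d - p d - \<delta>)" and ?b = "min (p c + \<delta> - q c) (q d - p d + \<delta>)"
    have iff: "shift q t ?e \<in> near W p \<delta> \<longleftrightarrow> t \<in> {?a<..<?b}" for t
    proof
      assume "shift q t ?e \<in> near W p \<delta>"
      then have "\<bar>shift q t ?e c - p c\<bar> < \<delta>" "\<bar>shift q t ?e d - p d\<bar> < \<delta>"
        using cW by (auto simp only: near_def mem_Collect_eq)
      then show "t \<in> {?a<..<?b}" using c(3) by (simp add: shift_def swap_dir_def abs_less_iff)
    next
      assume t: "t \<in> {?a<..<?b}"
      have "\<bar>shift q t ?e x - p x\<bar> < \<delta>" if "x \<in> W" for x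
      proof -
        consider "x = c" | "x = d" | "x \<noteq> c" "x \<noteq> d" by blast
        then show ?thesis
          using t q that c(3) by cases (auto simp: near_def shift_def swap_dir_def abs_less_iff)
      qed
      moreover have "shift q t ?e x = 0" if "x \<in> W" "p x = 0" for x
        using q that cW by (auto simp: near_def shift_def swap_dir_def)
      moreover have "sum (shift q t ?e) W = 1"
        using q by (simp add: sum_shift sume near_def)
      ultimately show "shift q t ?e \<in> near W p \<delta>" by (auto simp: near_def)
    qed
    show ?thesis
    proof (rule finite_zeros_rolle[where f = "\<lambda>i t. Fs i (shift q t ?e)" and a = ?a and b = ?b])
      show "((\<lambda>t. Fs i (shift q t ?e)) has_real_derivative Fs (Suc i) (shift q t ?e)) (at t)"
        if "t \<in> {?a<..<?b}" for i t
      proof (rule Fs)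
        fix B assume "B \<in> blocks ?S"
        then show "sum (shift q t ?e) B > 0"
          using near[of "shift q t ?e"] iff that by (intro blocks_pos[OF S(1)]) auto
      qed
      show "Fs k (shift q t ?e) \<noteq> 0" if "t \<in> {?a<..<?b}" for t
        using near[of "shift q t ?e"] iff that by blast
      show "T \<subseteq> {t \<in> {?a<..<?b}. Fs 0 (shift q t ?e) = 0}"
        using T(2) iff Fs0 by auto
    qed (rule T(1))
  qed
  then show thesis by (rule that[OF \<delta>])
qed

context finite_sample
begin

lemma sum_p: "sum p W = 1"
proof -
  have "(\<Sum>x\<in>W. p x) = (\<Sum>x\<in>W. prob {\<omega> \<in> space M. V 0 \<omega> = x})" using law by simp
  also have "\<dots> = prob (\<Union>x\<in>W. {\<omega> \<in> space M. V 0 \<omega> = x})"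
    using finW event[of "{0}" "\<lambda>f. f 0 = x" for x]
    by (intro finite_measure_finite_Union[symmetric]) (auto simp: disjoint_family_on_def)
  also have "(\<Union>x\<in>W. {\<omega> \<in> space M. V 0 \<omega> = x}) = space M" using V_in by auto
  finally show ?thesis by (simp add: prob_space)
qed

lemma freq_eventually:
  assumes "eventually P (face_nhds W p)"
  shows "(\<lambda>n. prob {\<omega> \<in> space M. P (freq n \<omega>)}) \<longlonglongrightarrow> 1"
proof -
  obtain \<delta> where \<delta>: "\<delta> > 0" "\<And>q. q \<in> near W p \<delta> \<Longrightarrow> P q"
    using assms unfolding eventually_face_nhds by blast
  have le: "prob {\<omega> \<in> space M. freq n \<omega> \<in> near W p \<delta>} \<le> prob {\<omega> \<in> space M. P (freq n \<omega>)}" for n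
    using \<delta>(2) event_freq by (intro finite_measure_mono) auto
  show ?thesis
    by (rule tendsto_sandwich[OF _ _ freq_near[OF \<delta>(1)] tendsto_const])
       (intro always_eventually allI le prob_le_1)+
qed

end

lemma (in prob_space) prob_conj_tendsto_1:
  assumes "\<And>n. {\<omega> \<in> space M. P n \<omega>} \<in> events" "\<And>n. {\<omega> \<in> space M. Q n \<omega>} \<in> events"
    and "(\<lambda>n. prob {\<omega> \<in> space M. P n \<omega>}) \<longlonglongrightarrow> 1" "(\<lambda>n. prob {\<omega> \<in> space M. Q n \<omega>}) \<longlonglongrightarrow> 1"
  shows "(\<lambda>n. prob {\<omega> \<in> space M. P n \<omega> \<and> Q n \<omega>}) \<longlonglongrightarrow> 1"
proof -
  have le: "prob {\<omega> \<in> space M. P n \<omega>} + prob {\<omega> \<in> space M. Q n \<omega>} - 1 \<le> prob {\<omega> \<in> space M. P n \<omega> \<and> Q n \<omega>}" for n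
  proof -
    let ?A = "{\<omega> \<in> space M. P n \<omega>}" and ?B = "{\<omega> \<in> space M. Q n \<omega>}"
    have "prob ?A + prob ?B = prob (?A \<union> ?B) + prob (?A \<inter> ?B)"
      using finite_measure_Union'[of ?A ?B] finite_measure_Diff'[of ?B ?A] assms(1,2)[of n]
      by (simp add: Int_commute)
    moreover have "?A \<inter> ?B = {\<omega> \<in> space M. P n \<omega> \<and> Q n \<omega>}" by auto
    ultimately show ?thesis using prob_le_1[of "?A \<union> ?B"] by simp
  qed
  have "(\<lambda>n. prob {\<omega> \<in> space M. P n \<omega>} + prob {\<omega> \<in> space M. Q n \<omega>} - 1) \<longlonglongrightarrow> 1 + 1 - 1"
    by (intro tendsto_intros assms)
  then have lim: "(\<lambda>n. prob {\<omega> \<in> space M. P n \<omega>} + prob {\<omega> \<in> space M. Q n \<omega>} - 1) \<longlonglongrightarrow> 1" by simp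
  show ?thesis
    by (rule tendsto_sandwich[OF _ _ lim tendsto_const]) (intro always_eventually allI le prob_le_1)+
qed

text \<open>
  Near \<open>p\<close> the zeros are few on every line in the direction of the exchange, so
  \<open>anti_concentration\<close> applies to the event \<open>F (freq n \<omega>) = 0\<close>.
\<close>

lemma (in finite_sample) elementary_nonzero_whp:
  assumes F: "F \<in> elementary (blocks (supp W p))"
    and c: "c \<in> supp W p" "d \<in> supp W p" "c \<noteq> d"
    and nz: "t0 \<in> {- p c<..<p d}" "F (shift p t0 (swap_dir c d)) \<noteq> 0"
  shows "(\<lambda>n. prob {\<omega> \<in> space M. F (freq n \<omega>) \<noteq> 0}) \<longlonglongrightarrow> 1"
proof (rule order_tendstoI)
  fix a :: real assume a: "a < 1"
  obtain \<delta>0 K where \<delta>0: "\<delta>0 > 0" and few: "\<And>q T. q \<in> near W p \<delta>0 \<Longrightarrow> finite T \<Longrightarrow>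
    T \<subseteq> {t. shift q t (swap_dir c d) \<in> near W p \<delta>0 \<and> F (shift q t (swap_dir c d)) = 0} \<Longrightarrow> card T \<le> K"
    by (rule few_zeros_on_lines[OF finW F c nz]) blast
  have c': "c \<in> W" "d \<in> W" "p c > 0" "p d > 0" using c by (auto simp: supp_def)
  have "\<exists>\<delta>>0. \<forall>\<^sub>F n in sequentially. prob {\<omega> \<in> space M. freq n \<omega> \<in> near W p \<delta> \<and> F (freq n \<omega>) = 0} \<le> (1 - a) / 3"
  proof (rule anti_concentration[OF c'(1,2) c(3) c'(3,4) \<delta>0])
    show "(1 - a) / 3 > 0" using a by simp
  qed (rule few)
  then obtain \<delta> where \<delta>: "\<delta> > 0" and
    1: "\<forall>\<^sub>F n in sequentially. prob {\<omega> \<in> space M. freq n \<omega> \<in> near W p \<delta> \<and> F (freq n \<omega>) = 0} \<le> (1 - a) / 3"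
    by blast
  have 2: "\<forall>\<^sub>F n in sequentially. prob {\<omega> \<in> space M. freq n \<omega> \<in> near W p \<delta>} > 1 - (1 - a) / 3"
    by (rule order_tendstoD(1)[OF freq_near[OF \<delta>]]) (use a in simp)
  show "\<forall>\<^sub>F n in sequentially. a < prob {\<omega> \<in> space M. F (freq n \<omega>) \<noteq> 0}"
    using 1 2
  proof eventually_elim
    case (elim n)
    let ?A = "{\<omega> \<in> space M. freq n \<omega> \<in> near W p \<delta> \<and> F (freq n \<omega>) = 0}" and ?B = "{\<omega> \<in> space M. F (freq n \<omega>) \<noteq> 0}"
    have ev: "?A \<in> events" "?B \<in> events" by (rule event_freq)+
    then have "prob {\<omega> \<in> space M. freq n \<omega> \<in> near W p \<delta>} \<le> prob (?A \<union> ?B)"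
      by (intro finite_measure_mono) auto
    also have "\<dots> \<le> prob ?A + prob ?B" using ev by (rule measure_Un_le)
    finally show ?case using elim a by (simp add: field_simps)
  qed
next
  fix a :: real assume "1 < a"
  then show "\<forall>\<^sub>F n in sequentially. prob {\<omega> \<in> space M. F (freq n \<omega>) \<noteq> 0} < a"
    by (intro always_eventually allI le_less_trans[OF prob_le_1])
qed

section \<open>Consistency of the test\<close>

text \<open>
  If \<open>fst\<close> or \<open>snd\<close> is injective on the support, the variance is positive at \<open>p\<close> and hence near
  \<open>p\<close>. Otherwise it may vanish at \<open>p\<close>, and \<open>row_slope\<close> certifies that the frequencies avoid its
  zeros.
\<close>

lemma variance_pos_whp:
  fixes V :: "nat \<Rightarrow> 'w \<Rightarrow> 'a \<times> 'b"
  assumes "finite_sample M W V p" and lam: "lam > 0" "lam \<noteq> 1"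
    and nonunif: "\<not> uniform_on (fst ` supp W p) (marg (supp W p) fst p)"
      "\<not> uniform_on (snd ` supp W p) (marg (supp W p) snd p)"
  shows "(\<lambda>n. measure M {\<omega> \<in> space M.
      variance_on (supp W p) (finite_sample.freq V n \<omega>) (influence lam (supp W p) (finite_sample.freq V n \<omega>)) > 0})
    \<longlonglongrightarrow> 1"
proof -
  interpret finite_sample M W V p by fact
  let ?S = "supp W p"
  have S: "finite ?S" "\<And>x. x \<in> ?S \<Longrightarrow> p x > 0" using finW by (auto simp: supp_def)
  have "?S \<noteq> {}"
  proof
    assume "?S = {}"
    then have "sum p W \<le> 0" by (intro sum_nonpos) (force simp: supp_def)
    then show False using sum_p by simp
  qed
  have supp_ev: "\<forall>\<^sub>F q in face_nhds W p. \<forall>x\<in>?S. q x > 0"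
    using face_nhds_supp[OF finW, of p] p_bounds by (auto elim: eventually_mono)
  show ?thesis
  proof (cases "inj_on fst ?S \<or> inj_on snd ?S")
    case True
    then have "variance_on ?S p (influence lam ?S p) > 0"
      using nonunif by (intro variance_pos_inj[OF S(1) \<open>?S \<noteq> {}\<close> S(2)]) auto
    from order_tendstoD(1)[OF tendsto_variance_influence[OF finW] this]
    show ?thesis by (rule freq_eventually)
  next
    case False
    then obtain c d where c: "c \<in> ?S" "d \<in> ?S" "c \<noteq> d" "fst c = fst d"
      by (auto simp: inj_on_def)
    let ?F = "row_slope lam ?S c d"
    have "\<exists>t0\<in>{- p c<..<p d}. ?F (shift p t0 (swap_dir c d)) \<noteq> 0"
      by (rule row_slope_nonzero_on_line) (use S lam c False in auto)
    then obtain t0 where t0: "t0 \<in> {- p c<..<p d}" "?F (shift p t0 (swap_dir c d)) \<noteq> 0" by blast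
    have "(\<lambda>n. prob {\<omega> \<in> space M. ?F (freq n \<omega>) \<noteq> 0 \<and> (\<forall>x\<in>?S. freq n \<omega> x > 0)}) \<longlonglongrightarrow> 1"
      by (intro prob_conj_tendsto_1 event_freq freq_eventually[OF supp_ev]
          elementary_nonzero_whp[OF elementary_row_slope[OF c(1,2)] c(1-3) t0])
    then have lim: "(\<lambda>n. prob {\<omega> \<in> space M. ?F (freq n \<omega>) \<noteq> 0 \<and> (\<forall>x\<in>?S. freq n \<omega> x > 0)}) \<longlonglongrightarrow> 1" .
    have le: "prob {\<omega> \<in> space M. ?F (freq n \<omega>) \<noteq> 0 \<and> (\<forall>x\<in>?S. freq n \<omega> x > 0)} \<le>
        prob {\<omega> \<in> space M. variance_on ?S (freq n \<omega>) (influence lam ?S (freq n \<omega>)) > 0}" for n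
    proof (rule finite_measure_mono[OF subsetI event_freq])
      fix \<omega> assume "\<omega> \<in> {\<omega> \<in> space M. ?F (freq n \<omega>) \<noteq> 0 \<and> (\<forall>x\<in>?S. freq n \<omega> x > 0)}"
      then show "\<omega> \<in> {\<omega> \<in> space M. variance_on ?S (freq n \<omega>) (influence lam ?S (freq n \<omega>)) > 0}"
        using variance_pos_row_slope[OF S(1) _ c(1,2,4), of "freq n \<omega>" lam] by simp
    qed
    show ?thesis
      by (rule tendsto_sandwich[OF _ _ lim tendsto_const]) (intro always_eventually allI le prob_le_1)+
  qed
qed

lemma score_cong:
  assumes "\<And>c. c \<in> S \<Longrightarrow> q c = q' c"
  shows "score lam S f q = score lam S f q'"
proof -
  have m: "marg S f q = marg S f q'"
    unfolding marg_def by (intro ext sum.cong) (use assms in auto)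
  show ?thesis
    unfolding score_def[abs_def] score_num_def pow_sum_def pow_ln_sum_def m ..
qed

lemma variance_influence_cong:
  assumes "\<And>c. c \<in> S \<Longrightarrow> q c = q' c"
  shows "variance_on S q (influence lam S q) = variance_on S q' (influence lam S q')"
proof -
  have "influence lam S q = influence lam S q'"
    unfolding influence_def[abs_def]
    using score_cong[of S q q' lam id] score_cong[of S q q' lam fst] score_cong[of S q q' lam snd] assms
    by simp
  then show ?thesis unfolding variance_on_def using assms by simp
qed

text \<open>
  Whichever of \<open>T_A\<close>, \<open>T_B\<close> carries at least half of their sum decides: \<^const>\<open>Z_AB\<close> is at least
  as large in absolute value as both statistics.
\<close>

lemma Z_AB_large:
  assumes S: "S \<subseteq> cells I J" "S \<noteq> {}" and z: "\<And>c. c \<in> cells I J - S \<Longrightarrow> q c = 0"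
    and q: "\<And>c. c \<in> S \<Longrightarrow> q c > 0" and sum1: "sum q (cells I J) = 1"
    and v: "variance_on S q (influence lam S q) > 0" "variance_on S q (influence lam S q) < b"
    and T: "T_A I J lam q + T_B I J lam q > \<tau>" and lam: "lam > 0" and "\<tau> > 0"
    and n: "sqrt n * (\<tau> / 2) / sqrt (lam ^ 4 * b) > \<bar>z\<bar>"
  shows "Z_AB I J lam n q \<in> {..<- z} \<union> {z<..}"
proof -
  let ?s = "sqrt (sigma2 I J lam q)"
  have s2: "sigma2 I J lam q = lam ^ 4 * variance_on S q (influence lam S q)"
    using S z q sum1 by (rule sigma2_eq)
  have s: "0 < ?s" "?s \<le> sqrt (lam ^ 4 * b)"
    unfolding s2 using v lam by auto
  have ge: "sqrt n * (\<tau> / 2) / sqrt (lam ^ 4 * b) \<le> \<bar>sqrt n * t / ?s\<bar>" if "\<tau> / 2 \<le> \<bar>t\<bar>" for t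
  proof -
    have "sqrt n * (\<tau> / 2) / sqrt (lam ^ 4 * b) \<le> sqrt n * \<bar>t\<bar> / ?s"
      using s that \<open>\<tau> > 0\<close> by (intro frac_le mult_left_mono) auto
    also have "\<dots> = \<bar>sqrt n * t / ?s\<bar>" using s by (simp add: abs_mult)
    finally show ?thesis .
  qed
  have "\<tau> / 2 \<le> \<bar>T_A I J lam q\<bar> \<or> \<tau> / 2 \<le> \<bar>T_B I J lam q\<bar>" using T by linarith
  then have "\<bar>z\<bar> < \<bar>Z_A I J lam n q\<bar> \<or> \<bar>z\<bar> < \<bar>Z_B I J lam n q\<bar>"
    unfolding Z_A_def Z_B_def using ge n by (meson less_le_trans)
  then have "\<bar>z\<bar> < \<bar>Z_AB I J lam n q\<bar>" unfolding Z_AB_def by auto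
  then show ?thesis by auto
qed

lemma (in prob_space) indep_pair_if_product:
  assumes XY: "X \<in> measurable M (count_space (l ` {1..I}))" "Y \<in> measurable M (count_space (m ` {1..J}))"
    and inj: "inj_on l {1..I}" "inj_on m {1..J}"
    and p: "\<And>i j. i \<in> {1..I} \<Longrightarrow> j \<in> {1..J} \<Longrightarrow> p (i, j) = prob {\<omega> \<in> space M. X \<omega> = l i \<and> Y \<omega> = m j}"
    and prod: "\<And>i j. i \<in> {1..I} \<Longrightarrow> j \<in> {1..J} \<Longrightarrow> p (i, j) = row_marg J p i * col_marg I p j"
  shows "indep_pair M (count_space (l ` {1..I})) X (count_space (m ` {1..J})) Y"
proof -
  have ev: "X -` S \<inter> space M \<in> events" "Y -` T \<inter> space M \<in> events" for S T
  proof -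
    have "X -` S \<inter> space M = X -` (S \<inter> l ` {1..I}) \<inter> space M"
      using measurable_space[OF XY(1)] by auto
    then show "X -` S \<inter> space M \<in> events" using measurable_sets[OF XY(1), of "S \<inter> l ` {1..I}"] by simp
    have "Y -` T \<inter> space M = Y -` (T \<inter> m ` {1..J}) \<inter> space M"
      using measurable_space[OF XY(2)] by auto
    then show "Y -` T \<inter> space M \<in> events" using measurable_sets[OF XY(2), of "T \<inter> m ` {1..J}"] by simp
  qed
  have cell: "{\<omega> \<in> space M. X \<omega> = l i \<and> Y \<omega> = m j} \<in> events" for i j
  proof -
    have "{\<omega> \<in> space M. X \<omega> = l i \<and> Y \<omega> = m j} = (X -` {l i} \<inter> space M) \<inter> (Y -` {m j} \<inter> space M)" by auto
    then show ?thesis using ev by auto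
  qed
  have pr: "prob ((X -` S \<inter> space M) \<inter> (Y -` T \<inter> space M)) =
      (\<Sum>i\<in>{i \<in> {1..I}. l i \<in> S}. \<Sum>j\<in>{j \<in> {1..J}. m j \<in> T}. p (i, j))" for S T
  proof -
    let ?D = "{i \<in> {1..I}. l i \<in> S} \<times> {j \<in> {1..J}. m j \<in> T}"
    have eq: "(X -` S \<inter> space M) \<inter> (Y -` T \<inter> space M) = (\<Union>c\<in>?D. {\<omega> \<in> space M. X \<omega> = l (fst c) \<and> Y \<omega> = m (snd c)})"
      using measurable_space[OF XY(1)] measurable_space[OF XY(2)] by fastforce
    have "prob (\<Union>c\<in>?D. {\<omega> \<in> space M. X \<omega> = l (fst c) \<and> Y \<omega> = m (snd c)}) =
        (\<Sum>c\<in>?D. prob {\<omega> \<in> space M. X \<omega> = l (fst c) \<and> Y \<omega> = m (snd c)})"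
    proof (rule finite_measure_finite_Union)
      show "disjoint_family_on (\<lambda>c. {\<omega> \<in> space M. X \<omega> = l (fst c) \<and> Y \<omega> = m (snd c)}) ?D"
        unfolding disjoint_family_on_def
      proof (intro ballI impI)
        fix c c' assume c: "c \<in> ?D" "c' \<in> ?D" "c \<noteq> c'"
        then have "l (fst c) \<noteq> l (fst c') \<or> m (snd c) \<noteq> m (snd c')"
          using inj by (auto simp: prod_eq_iff inj_on_eq_iff)
        then show "{\<omega> \<in> space M. X \<omega> = l (fst c) \<and> Y \<omega> = m (snd c)} \<inter>
            {\<omega> \<in> space M. X \<omega> = l (fst c') \<and> Y \<omega> = m (snd c')} = {}" by auto
      qed
    qed (use cell in auto)
    also have "\<dots> = (\<Sum>c\<in>?D. p c)" using p by (intro sum.cong) auto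
    finally show ?thesis unfolding eq sum.cartesian_product by (simp add: case_prod_unfold)
  qed
  have "indep_set {X -` S \<inter> space M | S. S \<in> sets (count_space (l ` {1..I}))}
      {Y -` S \<inter> space M | S. S \<in> sets (count_space (m ` {1..J}))}"
  proof (rule indep_setI)
    fix a b
    assume "a \<in> {X -` S \<inter> space M | S. S \<in> sets (count_space (l ` {1..I}))}"
      "b \<in> {Y -` S \<inter> space M | S. S \<in> sets (count_space (m ` {1..J}))}"
    then obtain S T where a: "a = X -` S \<inter> space M" and b: "b = Y -` T \<inter> space M" by blast
    let ?R = "{i \<in> {1..I}. l i \<in> S}" and ?C = "{j \<in> {1..J}. m j \<in> T}"
    have all: "{i \<in> {1..I}. l i \<in> UNIV} = {1..I}" "{j \<in> {1..J}. m j \<in> UNIV} = {1..J}" by auto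
    have "a = a \<inter> (Y -` UNIV \<inter> space M)" "b = (X -` UNIV \<inter> space M) \<inter> b" by (auto simp: a b)
    then have pa: "prob a = (\<Sum>i\<in>?R. row_marg J p i)" and pb: "prob b = (\<Sum>i=1..I. \<Sum>j\<in>?C. p (i, j))"
      using pr[of S UNIV] pr[of UNIV T] unfolding a b all row_marg_def by metis+
    have "prob b = (\<Sum>j\<in>?C. col_marg I p j)"
      unfolding col_marg_def pb by (rule sum.swap)
    moreover have "prob (a \<inter> b) = (\<Sum>i\<in>?R. \<Sum>j\<in>?C. row_marg J p i * col_marg I p j)"
      unfolding a b pr using prod by (intro sum.cong) auto
    ultimately show "prob (a \<inter> b) = prob a * prob b" by (simp only: pa sum_product)
  qed (use ev in auto)
  then show ?thesis unfolding indep_pair_def .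
qed

theorem proposition3:
  fixes M :: "'w measure"
    and l :: "nat \<Rightarrow> 'a" and m :: "nat \<Rightarrow> 'b"
    and I J :: nat
    and X :: "'w \<Rightarrow> 'a" and Y :: "'w \<Rightarrow> 'b"
    and U :: "nat \<Rightarrow> 'w \<Rightarrow> 'a \<times> 'b"
    and p :: "nat \<times> nat \<Rightarrow> real"
    and lam \<alpha> :: real
  defines "A \<equiv> count_space (l ` {1..I})"
    and "B \<equiv> count_space (m ` {1..J})"
    and "AB \<equiv> count_space (l ` {1..I} \<times> m ` {1..J})"
  assumes "prob_space M"
    and "inj_on l {1..I}" and "inj_on m {1..J}"
    \<comment> \<open>the pair and its joint distribution\<close>
    and "X \<in> measurable M A" and "Y \<in> measurable M B"
    and "\<And>i j. i \<in> {1..I} \<Longrightarrow> j \<in> {1..J} \<Longrightarrow>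
           p (i, j) = measure M {\<omega> \<in> space M. X \<omega> = l i \<and> Y \<omega> = m j}"
    and "\<And>i. i \<in> {1..I} \<Longrightarrow> row_marg J p i > 0"
    and "\<And>j. j \<in> {1..J} \<Longrightarrow> col_marg I p j > 0"
    and "\<not> uniform_on {1..I} (row_marg J p)"
    and "\<not> uniform_on {1..J} (col_marg I p)"
    \<comment> \<open>the alternative\<close>
    and "\<not> indep_pair M A X B Y"
    \<comment> \<open>the i.i.d. sample\<close>
    and "prob_space.indep_vars M (\<lambda>_. AB) U UNIV"
    and "\<And>k. distr M AB (U k) = distr M AB (\<lambda>\<omega>. (X \<omega>, Y \<omega>))"
    and "lam \<in> {0<..<1} \<union> {1<..}" and "\<alpha> \<in> {0<..<1}"
  shows "(\<lambda>n. measure M {\<omega> \<in> space M.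
             Z_AB I J lam n (rel_freq l m n (\<lambda>k. U k \<omega>))
               \<in> {..<- std_normal_quantile (1 - \<alpha> / 2)} \<union> {std_normal_quantile (1 - \<alpha> / 2)<..}})
         \<longlonglongrightarrow> 1"
proof -
  interpret prob_space M by fact
  let ?W = "cells I J" and ?z = "std_normal_quantile (1 - \<alpha> / 2)"
  have lam: "lam > 0" "lam \<noteq> 1" using assms(17) by auto
  have U: "U k \<in> measurable M AB" for k using assms(15) by (simp add: indep_vars_def)
  have XY: "(\<lambda>\<omega>. (X \<omega>, Y \<omega>)) \<in> measurable M AB"
  proof -
    have "AB = A \<Otimes>\<^sub>M B"
      unfolding A_def B_def AB_def by (rule pair_measure_count_space[symmetric]) auto
    then show ?thesis using assms(7,8) by simp
  qed
  \<comment> \<open>The observations are renamed to cells, so that the sample takes values in \<open>cells I J\<close>.\<close>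
  define cellof where "cellof ab = (inv_into {1..I} l (fst ab), inv_into {1..J} m (snd ab))" for ab
  define V where "V k \<omega> = cellof (U k \<omega>)" for k \<omega>
  have cellof: "cellof ab = c \<longleftrightarrow> ab = (l (fst c), m (snd c))"
    if "ab \<in> l ` {1..I} \<times> m ` {1..J}" "c \<in> ?W" for ab c
    using that assms(5,6) by (auto simp: cellof_def cells_def)
  have Uin: "U k \<omega> \<in> l ` {1..I} \<times> m ` {1..J}" if "\<omega> \<in> space M" for k \<omega>
    using measurable_space[OF U that] by (simp add: AB_def)
  have V_iff: "V k \<omega> = c \<longleftrightarrow> U k \<omega> = (l (fst c), m (snd c))" if "\<omega> \<in> space M" "c \<in> ?W" for k \<omega> c
    unfolding V_def using cellof[OF Uin[OF that(1)] that(2)] .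
  have fs: "finite_sample M ?W V p"
  proof unfold_locales
    show "finite ?W" by (simp add: cells_def)
    show "indep_vars (\<lambda>_. count_space ?W) V UNIV"
      unfolding V_def using assms(15)
    proof (rule indep_vars_compose2)
      have "cellof ab \<in> ?W" if "ab \<in> l ` {1..I} \<times> m ` {1..J}" for ab
        using that inv_into_into[of "fst ab" l "{1..I}"] inv_into_into[of "snd ab" m "{1..J}"]
        unfolding cellof_def cells_def by (simp only: mem_Times_iff fst_conv snd_conv)
      then show "cellof \<in> measurable AB (count_space ?W)"
        unfolding AB_def by (simp add: Pi_iff)
    qed
    fix c k assume c: "c \<in> ?W"
    let ?a = "(l (fst c), m (snd c))"
    have a: "{?a} \<in> sets AB" using c by (auto simp: AB_def cells_def)
    have "prob {\<omega> \<in> space M. V k \<omega> = c} = prob (U k -` {?a} \<inter> space M)"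
      using V_iff[OF _ c] by (intro arg_cong[where f = prob]) auto
    also have "\<dots> = measure (distr M AB (U k)) {?a}"
      using measure_distr[OF U a] by simp
    also have "\<dots> = prob ((\<lambda>\<omega>. (X \<omega>, Y \<omega>)) -` {?a} \<inter> space M)"
      unfolding assms(16) by (rule measure_distr[OF XY a])
    also have "(\<lambda>\<omega>. (X \<omega>, Y \<omega>)) -` {?a} \<inter> space M = {\<omega> \<in> space M. X \<omega> = l (fst c) \<and> Y \<omega> = m (snd c)}" by auto
    also have "prob \<dots> = p c" using c assms(9)[of "fst c" "snd c"] by (auto simp: cells_def)
    finally show "prob {\<omega> \<in> space M. V k \<omega> = c} = p c" .
  qed
  interpret finite_sample M ?W V p by (rule fs)
  define S where "S = supp ?W p"
  have S: "S \<subseteq> ?W" "finite S" "\<And>c. c \<in> S \<Longrightarrow> p c > 0" and Sz: "\<And>c. c \<in> ?W - S \<Longrightarrow> p c = 0"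
    using finW p_bounds(1) by (auto simp: S_def supp_def intro: finite_subset order_antisym)
  obtain i1 where i1: "i1 \<in> {1..I}" using assms(12) by (auto simp: uniform_on_def)
  obtain j1 where j1: "j1 \<in> {1..J}" using assms(13) by (auto simp: uniform_on_def)
  have Sfst: "fst ` S = {1..I}"
  proof (intro equalityI subsetI)
    fix i assume i: "i \<in> {1..I}"
    then have "sum p {c \<in> S. fst c = i} > 0"
      using assms(10)[OF i] row_marg_eq[OF S(1) Sz i] by (simp add: marg_def)
    then have "{c \<in> S. fst c = i} \<noteq> {}" by (metis less_irrefl sum.empty)
    then show "i \<in> fst ` S" by force
  qed (use S in \<open>auto simp: cells_def\<close>)
  have Ssnd: "snd ` S = {1..J}"
  proof (intro equalityI subsetI)
    fix j assume j: "j \<in> {1..J}"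
    then have "sum p {c \<in> S. snd c = j} > 0"
      using assms(11)[OF j] col_marg_eq[OF S(1) Sz j] by (simp add: marg_def)
    then have "{c \<in> S. snd c = j} \<noteq> {}" by (metis less_irrefl sum.empty)
    then show "j \<in> snd ` S" by force
  qed (use S in \<open>auto simp: cells_def\<close>)
  have Sne: "S \<noteq> {}" using Sfst i1 by auto
  have nonunif: "\<not> uniform_on (fst ` S) (marg S fst p)" "\<not> uniform_on (snd ` S) (marg S snd p)"
  proof -
    have "uniform_on {1..I} (marg S fst p) \<longleftrightarrow> uniform_on {1..I} (row_marg J p)"
      unfolding uniform_on_def by (intro ball_cong refl) (simp only: row_marg_eq[OF S(1) Sz])
    then show "\<not> uniform_on (fst ` S) (marg S fst p)" using assms(12) Sfst by simp
    have "uniform_on {1..J} (marg S snd p) \<longleftrightarrow> uniform_on {1..J} (col_marg I p)"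
      unfolding uniform_on_def by (intro ball_cong refl) (simp only: col_marg_eq[OF S(1) Sz])
    then show "\<not> uniform_on (snd ` S) (marg S snd p)" using assms(13) Ssnd by simp
  qed
  obtain i0 j0 where dep: "i0 \<in> {1..I}" "j0 \<in> {1..J}" "p (i0, j0) \<noteq> row_marg J p i0 * col_marg I p j0"
    using indep_pair_if_product[of X l I Y m J p] assms(5-9,14) unfolding A_def B_def by blast
  define \<tau> where "\<tau> = (T_A I J lam p + T_B I J lam p) / 2"
  have \<tau>: "\<tau> > 0"
    unfolding \<tau>_def using T_A_plus_T_B_pos[OF p_bounds(1) sum_p lam(1) dep] by simp
  \<comment> \<open>any bound strictly above the limit of the variances\<close>
  define b where "b = variance_on S p (influence lam S p) + 1"
  have b: "b > 0"
    unfolding b_def variance_on_def using S(3)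
    by (intro add_nonneg_pos sum_nonneg mult_nonneg_nonneg) (auto intro: less_imp_le)
  define good where "good q \<longleftrightarrow> (\<forall>c\<in>?W - S. q c = 0) \<and> (\<forall>c\<in>S. q c > 0) \<and> sum q ?W = 1 \<and>
    T_A I J lam q + T_B I J lam q > \<tau> \<and> variance_on S q (influence lam S q) < b" for q
  have "\<forall>\<^sub>F q in face_nhds ?W p. good q"
  proof -
    have "\<forall>\<^sub>F q in face_nhds ?W p. T_A I J lam q + T_B I J lam q > \<tau>"
      using \<tau> i1 j1 p_bounds(1) assms(10,11) lam(1)
      by (intro order_tendstoD(1)[OF tendsto_T_A_plus_T_B]) (auto simp: \<tau>_def)
    moreover have "\<forall>\<^sub>F q in face_nhds ?W p. variance_on S q (influence lam S q) < b"
      unfolding S_def by (rule order_tendstoD(2)[OF tendsto_variance_influence[OF finW]])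
        (simp add: b_def S_def)
    moreover have "\<forall>\<^sub>F q in face_nhds ?W p.
        (\<forall>c\<in>?W - supp ?W p. q c = 0) \<and> (\<forall>c\<in>supp ?W p. q c > 0) \<and> sum q ?W = 1"
      using finW by (rule face_nhds_supp) (rule p_bounds(1))
    ultimately show ?thesis
    proof eventually_elim
      case (elim q)
      then show ?case unfolding good_def S_def by blast
    qed
  qed
  then obtain \<delta> where \<delta>: "\<delta> > 0" "\<And>q. q \<in> near ?W p \<delta> \<Longrightarrow> good q"
    unfolding eventually_face_nhds by blast
  let ?E = "\<lambda>n \<omega>. freq n \<omega> \<in> near ?W p \<delta> \<and> variance_on S (freq n \<omega>) (influence lam S (freq n \<omega>)) > 0"
  let ?R = "\<lambda>n \<omega>. Z_AB I J lam n (rel_freq l m n (\<lambda>k. U k \<omega>)) \<in> {..<- ?z} \<union> {?z<..}"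
  have lim: "(\<lambda>n. prob {\<omega> \<in> space M. ?E n \<omega>}) \<longlonglongrightarrow> 1"
    unfolding S_def
    by (intro prob_conj_tendsto_1 event_freq freq_near \<delta>(1) variance_pos_whp[OF fs lam])
       (use nonunif in \<open>simp_all add: S_def\<close>)
  have R: "{\<omega> \<in> space M. ?R n \<omega>} \<in> events" for n
  proof -
    have eq: "rel_freq l m n (restrict (\<lambda>k. U k \<omega>) {..<n}) = rel_freq l m n (\<lambda>k. U k \<omega>)" for \<omega>
      unfolding rel_freq_def by (intro ext arg_cong2[where f = "(/)"] arg_cong[where f = "\<lambda>x. real (card x)"]) auto
    have "{\<omega> \<in> space M. Z_AB I J lam n (rel_freq l m n (restrict (\<lambda>k. U k \<omega>) {..<n})) \<in> {..<- ?z} \<union> {?z<..}} \<in> events"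
      using U unfolding AB_def
      by (intro finite_rv_event[where A = "l ` {1..I} \<times> m ` {1..J}"]) (auto intro: countable_finite)
    then show ?thesis unfolding eq .
  qed
  have "\<forall>\<^sub>F n in sequentially. sqrt (real n) * (\<tau> / 2) / sqrt (lam ^ 4 * b) > \<bar>?z\<bar>"
  proof -
    have "(\<tau> / 2) / sqrt (lam ^ 4 * b) > 0" using \<tau> b lam by simp
    moreover have "filterlim (\<lambda>n. sqrt (real n)) at_top sequentially" by real_asymp
    ultimately have "filterlim (\<lambda>n. (\<tau> / 2) / sqrt (lam ^ 4 * b) * sqrt (real n)) at_top sequentially"
      by (intro filterlim_tendsto_pos_mult_at_top[OF tendsto_const])
    then have "\<forall>\<^sub>F n in sequentially. (\<tau> / 2) / sqrt (lam ^ 4 * b) * sqrt (real n) > \<bar>?z\<bar>"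
      unfolding filterlim_at_top_dense by blast
    then show ?thesis by (simp add: mult.commute)
  qed
  then have "\<forall>\<^sub>F n in sequentially. prob {\<omega> \<in> space M. ?E n \<omega>} \<le> prob {\<omega> \<in> space M. ?R n \<omega>}"
  proof eventually_elim
    case (elim n)
    have "?R n \<omega>" if \<omega>: "\<omega> \<in> space M" and E: "?E n \<omega>" for \<omega>
    proof -
      let ?q = "rel_freq l m n (\<lambda>k. U k \<omega>)"
      have eq: "?q c = freq n \<omega> c" if "c \<in> ?W" for c
        unfolding rel_freq_def freq_def counts_def count_in_def
        using V_iff[OF \<omega> that] by simp
      have "?q \<in> near ?W p \<delta>"
        using E sum.cong[OF refl eq] by (auto simp: near_def eq)
      from \<delta>(2)[OF this] have good: "good ?q" .
      have "variance_on S ?q (influence lam S ?q) = variance_on S (freq n \<omega>) (influence lam S (freq n \<omega>))"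
        using eq S(1) by (intro variance_influence_cong) auto
      then have "variance_on S ?q (influence lam S ?q) > 0" using E by simp
      then show ?thesis
        using good by (intro Z_AB_large[OF S(1) Sne, of ?q lam b \<tau>]) (use \<tau> lam elim in \<open>auto simp: good_def\<close>)
    qed
    then show ?case using R by (intro finite_measure_mono) auto
  qed
  then show ?thesis
    by (rule tendsto_sandwich[OF _ _ lim tendsto_const]) (intro always_eventually allI prob_le_1)
qed

end
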